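(* Let $\varrho$ be a probability density on $\mathbb{R}$ satisfying: $\varrho>0$ everywhere, $\varrho$ has mean zero and unit variance, and the function $a(h)=\frac{1}{\varrho(h)}\int_h^\infty k\,\varrho(k)\,dk$ is bounded and Lipschitz continuous on $\mathbb{R}$. For each $N\in\mathbb{N}$ let $H(1)$ be a random real symmetric $N\times N$ matrix whose entries $H_{ij}(1)$, $i\le j$, are independent and such that each $\sqrt{N}\,H_{ij}(1)$ has density $\varrho$, and let $G(1,z)=(H(1)-z)^{-1}$ for $\operatorname{Im} z>0$. Fix $\kappa>0$, a fixed interval $W=[W_1,W_2]\subset[-2+\kappa,2-\kappa]$, and $\theta\in(0,1)$, and set $\eta=N^{-1+\theta}$ and $$D=W+i(\eta,1)=\{x+iy: x\in W,\ \eta<y<1\}.$$ Then $$\sup_{z\in D}\left|\langle G(1,z)\rangle-m_{sc}(z)\right|\prec\frac{1}{\sqrt{N\eta}}.$$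
   Context: For an $N\times N$ matrix $A$, $\langle A\rangle=N^{-1}\operatorname{Tr}A$. The function $m_{sc}$ is the Stieltjes transform of the semicircle law: $m_{sc}(z)=\frac{-z+\sqrt{z^2-4}}{2}=\int_{-2}^2\frac{1}{\lambda-z}\frac{\sqrt{4-\lambda^2}}{2\pi}\,d\lambda$ for $\operatorname{Im}z>0$. Stochastic domination: for $N$-dependent families $\{X(u)\}_{u\in U}$, $\{Y(u)\}_{u\in U}$ of non-negative random variables, "$X\prec Y$ uniformly in $u\in U$" means that for all $\varepsilon,p>0$ there is $N_0(\varepsilon,p)$ such that $\sup_{u\in U}\mathbb{P}(X(u)>N^\varepsilon Y(u))\le N^{-p}$ for all $N\ge N_0(\varepsilon,p)$. For single $N$-dependent random variables (no parameter $u$), $X\prec Y$ is the same with $U$ a singleton. The quantities $\varrho,\kappa,W,\theta$ are fixed, independent of $N$ ($N_0$ may depend on them). *)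

theory Defs
  imports
    "HOL-Probability.Probability"
    "Jordan_Normal_Form.Gauss_Jordan_Elimination"
begin

definition msc :: "complex \<Rightarrow> complex" where
  "msc z = (LBINT x:{-2..2}.
     1 / (complex_of_real x - z) * complex_of_real (sqrt (4 - x\<^sup>2) / (2 * pi)))"

definition ntr :: "complex mat \<Rightarrow> complex" where
  "ntr A = (\<Sum>i<dim_row A. A $$ (i, i)) / of_nat (dim_row A)"

text \<open>The inverse below is only meant for symmetric \<open>A\<close> and non-real \<open>z\<close>, where it exists;
  \<^const>\<open>mat_inverse\<close> is the partial matrix inverse over a field.\<close>

definition resolvent :: "real mat \<Rightarrow> complex \<Rightarrow> complex mat" where
  "resolvent A z =
     the (mat_inverse (map_mat complex_of_real A - z \<cdot>\<^sub>m 1\<^sub>m (dim_row A)))"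

definition tail_ratio :: "(real \<Rightarrow> real) \<Rightarrow> real \<Rightarrow> real" where
  "tail_ratio \<rho> h = 1 / \<rho> h * (LBINT k:{h..}. k * \<rho> k)"

text \<open>Stochastic domination, uniformly in \<open>u \<in> U\<close>.  The variables of size \<open>N\<close> live on the
  probability space \<open>M N\<close>.  As non-measurable sets get measure \<open>0\<close>, the requirement
  that \<open>X\<close> and \<open>Y\<close> consist of random variables is part of the definition.\<close>

definition stoch_dom ::
  "(nat \<Rightarrow> 'a measure) \<Rightarrow> 'u set \<Rightarrow> (nat \<Rightarrow> 'u \<Rightarrow> 'a \<Rightarrow> ennreal) \<Rightarrow>
    (nat \<Rightarrow> 'u \<Rightarrow> 'a \<Rightarrow> ennreal) \<Rightarrow> bool" where
  "stoch_dom M U X Y \<longleftrightarrow>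
     (\<forall>N\<ge>1. \<forall>u\<in>U. X N u \<in> borel_measurable (M N) \<and> Y N u \<in> borel_measurable (M N)) \<and>
     (\<forall>\<epsilon>>0. \<forall>p>0. \<exists>N0. \<forall>N\<ge>max 1 N0.
        (SUP u\<in>U. emeasure (M N)
           {\<omega> \<in> space (M N). X N u \<omega> > ennreal (real N powr \<epsilon>) * Y N u \<omega>})
        \<le> ennreal (real N powr (- p)))"

definition stoch_dom_single ::
  "(nat \<Rightarrow> 'a measure) \<Rightarrow> (nat \<Rightarrow> 'a \<Rightarrow> ennreal) \<Rightarrow> (nat \<Rightarrow> 'a \<Rightarrow> ennreal) \<Rightarrow> bool" where
  "stoch_dom_single M X Y \<longleftrightarrow> stoch_dom M {()} (\<lambda>N _. X N) (\<lambda>N _. Y N)"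

text \<open>Matrix indices start at \<open>0\<close>.\<close>

definition wigner_matrix ::
  "'a measure \<Rightarrow> (real \<Rightarrow> real) \<Rightarrow> nat \<Rightarrow> ('a \<Rightarrow> real mat) \<Rightarrow> bool" where
  "wigner_matrix M \<rho> N H \<longleftrightarrow>
     (\<forall>\<omega>\<in>space M. H \<omega> \<in> carrier_mat N N \<and> transpose_mat (H \<omega>) = H \<omega>) \<and>
     prob_space.indep_vars M (\<lambda>_. borel) (\<lambda>(i, j) \<omega>. H \<omega> $$ (i, j)) {(i, j). i \<le> j \<and> j < N} \<and>
     (\<forall>i j. i \<le> j \<longrightarrow> j < N \<longrightarrow>
        distributed M lborel (\<lambda>\<omega>. sqrt (real N) * H \<omega> $$ (i, j)) (\<lambda>x. ennreal (\<rho> x)))"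

definition spectral_domain :: "real set \<Rightarrow> real \<Rightarrow> complex set" where
  "spectral_domain W \<eta> = {z. Re z \<in> W \<and> \<eta> < Im z \<and> Im z < 1}"

end

(*
  Let m(z) = <G(1,z)> and let H^(i) be the minor of H without row and column i. By the Schur
  complement formula, 1/G_ii = -(z + m + eps_i), where eps_i consists of -H_ii, the difference of
  the normalised traces of G and of the resolvent G^(i) of the minor, at most 1/(N Im z), and the
  fluctuation of the quadratic form of row i with coefficients G^(i). Row i is independent of G^(i);
  boundedness of the ratio a makes all moments of the entries finite, so a high moment bound and the
  Ward identity make this fluctuation O(N^eps sqrt((Im m + 1/(N Im z)) / (N Im z))), for all i and all z in a
  polynomially fine grid, with overwhelming probability. Averaging over i gives
  m^2 + z m + 1 = O(max |eps_i|), hence m - m_sc = O(max |eps_i|) in the bulk, where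
  |m + m_sc + z| >= Im m_sc is bounded below. That the G_ii stay bounded is propagated from Im z = 1
  down to Im z = eta along the grid.
*)
theory Submission
  imports Defs
    "HOL-Complex_Analysis.Complex_Analysis"
    "Jordan_Normal_Form.Determinant"
begin

subsection \<open>Moments of the entries\<close>

text \<open>The circularity to break is that the fluctuation of row i is governed by Im m, the very
  quantity under study. Self-normalisation breaks it: the good event bounds the quadratic form
  relative to the Hilbert-Schmidt norm of the minor's resolvent, which is itself random, so its
  probability needs no a priori bound on m. All randomness is thus spent in one union over grid
  points and rows; Schur complement, stability and bootstrap then run for a single fixed matrix. The
  high moment bound is obtained by adding one index at a time. Each increment is orthogonal to the
  past, and the squared \<open>L^(2p)\<close> norm then grows additively up to a constant, so the
  2p-th power is never expanded over index tuples. Replacing the average of the errors by their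
  maximum gives up the cancellation between rows; what remains is of order 1/sqrt(N eta), just the
  claimed rate. Stochastic domination includes measurability of a supremum over uncountably many z
  of entries of an algorithmically computed inverse. Cramer's rule and a Lipschitz bound at heights
  above 1/N settle this; the same Lipschitz bound drives the descent along the grid.\<close>

lemma nn_integral_power_derivative:
  fixes k :: real
  assumes "n \<ge> 1" "k \<ge> 0"
  shows "(\<integral>\<^sup>+h. ennreal (real n * h ^ (n - 1)) * indicator {0..k} h \<partial>lborel) = ennreal (k ^ n)"
proof -
  have "(\<integral>\<^sup>+h. ennreal (real n * h ^ (n - 1)) * indicator {0..k} h \<partial>lborel) = ennreal (k ^ n - 0 ^ n)"
  proof (rule nn_integral_FTC_Icc)
    show "DERIV (\<lambda>h. h ^ n) h :> real n * h ^ (n - 1)" for h :: real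
      by (auto intro!: derivative_eq_intros)
  qed (use assms in auto)
  then show ?thesis using assms by (simp add: power_0_left)
qed

text \<open>Layer-cake form of the Stein identity \<open>E X\<^sup>n\<^sup>+\<^sup>1 = n E a(X) X\<^sup>n\<^sup>-\<^sup>1\<close>, which needs no
  integrability a priori.\<close>

lemma half_moment_step:
  fixes r :: "real \<Rightarrow> real"
  assumes r: "\<And>x. r x \<ge> 0" and [measurable]: "r \<in> borel_measurable borel"
    and i: "integrable lborel (\<lambda>x. x * r x)" and A: "A \<ge> 0"
    and tail: "\<And>h. h \<ge> 0 \<Longrightarrow> (LBINT k:{h..}. k * r k) \<le> A * r h" and n: "n \<ge> 1"
  shows "(\<integral>\<^sup>+k\<in>{0..}. ennreal (k ^ (n + 1) * r k) \<partial>lborel)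
      \<le> ennreal (real n * A) * (\<integral>\<^sup>+k\<in>{0..}. ennreal (k ^ (n - 1) * r k) \<partial>lborel)"
proof -
  let ?g = "\<lambda>h. ennreal (real n * h ^ (n - 1))"
  have "(\<integral>\<^sup>+k\<in>{0..}. ennreal (k ^ (n + 1) * r k) \<partial>lborel)
      = (\<integral>\<^sup>+k. (\<integral>\<^sup>+h. (?g h * indicator {0..k} h) * (ennreal (k * r k) * indicator {0..} k) \<partial>lborel) \<partial>lborel)"
  proof (intro nn_integral_cong)
    fix k :: real
    show "ennreal (k ^ (n + 1) * r k) * indicator {0..} k
        = (\<integral>\<^sup>+h. (?g h * indicator {0..k} h) * (ennreal (k * r k) * indicator {0..} k) \<partial>lborel)"
    proof (cases "k \<ge> 0")
      case True
      have "(\<integral>\<^sup>+h. (?g h * indicator {0..k} h) * (ennreal (k * r k) * indicator {0..} k) \<partial>lborel)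
          = ennreal (k ^ n) * (ennreal (k * r k) * indicator {0..} k)"
        using nn_integral_power_derivative[OF n True] by (subst nn_integral_multc) auto
      then show ?thesis using True r[of k] by (simp add: ennreal_mult[symmetric] mult.assoc mult.left_commute)
    qed auto
  qed
  also have "\<dots> = (\<integral>\<^sup>+h. (\<integral>\<^sup>+k. (?g h * indicator {0..k} h) * (ennreal (k * r k) * indicator {0..} k) \<partial>lborel) \<partial>lborel)"
  proof -
    \<comment> \<open>Merging the two indicators into the single condition
      \<open>0 \<le> h \<and> h \<le> k\<close> exhibits the joint measurability that Tonelli
      requires.\<close>
    have "(\<lambda>(k, h). (?g h * indicator {0..k} h) * (ennreal (k * r k) * indicator {0..} k))
        = (\<lambda>(k, h). if 0 \<le> h \<and> h \<le> k then ?g h * ennreal (k * r k) else 0)"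
      by (auto simp: fun_eq_iff indicator_def)
    also have "\<dots> \<in> borel_measurable (lborel \<Otimes>\<^sub>M lborel)" by measurable
    finally show ?thesis by (rule lborel_pair.Fubini'[symmetric])
  qed
  also have "\<dots> \<le> (\<integral>\<^sup>+h. ennreal (real n * A) * (ennreal (h ^ (n - 1) * r h) * indicator {0..} h) \<partial>lborel)"
  proof (intro nn_integral_mono)
    fix h :: real
    show "(\<integral>\<^sup>+k. (?g h * indicator {0..k} h) * (ennreal (k * r k) * indicator {0..} k) \<partial>lborel)
      \<le> ennreal (real n * A) * (ennreal (h ^ (n - 1) * r h) * indicator {0..} h)"
    proof (cases "h \<ge> 0")
      case True
      have "(\<integral>\<^sup>+k. (?g h * indicator {0..k} h) * (ennreal (k * r k) * indicator {0..} k) \<partial>lborel)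
          = (\<integral>\<^sup>+k. ?g h * ennreal (indicator {h..} k *\<^sub>R (k * r k)) \<partial>lborel)"
        using True by (intro nn_integral_cong) (auto simp: indicator_def)
      also have "\<dots> = ?g h * (\<integral>\<^sup>+k. ennreal (indicator {h..} k *\<^sub>R (k * r k)) \<partial>lborel)"
        by (rule nn_integral_cmult) measurable
      also have "(\<integral>\<^sup>+k. ennreal (indicator {h..} k *\<^sub>R (k * r k)) \<partial>lborel)
          = ennreal (LBINT k:{h..}. k * r k)"
        unfolding set_lebesgue_integral_def
        using True r by (intro nn_integral_eq_integral integrable_mult_indicator i) (auto simp: indicator_def)
      also have "?g h * ennreal (LBINT k:{h..}. k * r k) \<le> ?g h * ennreal (A * r h)"
        using tail[OF True] by (intro mult_left_mono ennreal_leI) auto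
      also have "\<dots> = ennreal (real n * A) * (ennreal (h ^ (n - 1) * r h) * indicator {0..} h)"
        using True A r[of h] by (simp add: ennreal_mult[symmetric] algebra_simps)
      finally show ?thesis .
    qed auto
  qed
  also have "\<dots> = ennreal (real n * A) * (\<integral>\<^sup>+k\<in>{0..}. ennreal (k ^ (n - 1) * r k) \<partial>lborel)"
    by (rule nn_integral_cmult) measurable
  finally show ?thesis .
qed

text \<open>The step raises the exponent by two, so the induction has two base cases: the
  integrability of \<open>r\<close> and of its first moment.\<close>

lemma half_moment_finite:
  fixes r :: "real \<Rightarrow> real"
  assumes r: "\<And>x. r x \<ge> 0" and i0: "integrable lborel r"
    and i: "integrable lborel (\<lambda>x. x * r x)" and A: "A \<ge> 0"
    and tail: "\<And>h. h \<ge> 0 \<Longrightarrow> (LBINT k:{h..}. k * r k) \<le> A * r h"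
  shows "(\<integral>\<^sup>+k\<in>{0..}. ennreal (k ^ n * r k) \<partial>lborel) < \<infinity>"
proof (induction n rule: less_induct)
  case (less n)
  have [measurable]: "r \<in> borel_measurable borel" using borel_measurable_integrable[OF i0] by simp
  consider "n = 0" | "n = 1" | m where "n = m + 2"
    by (metis One_nat_def Suc_1 add_2_eq_Suc' less_2_cases_iff not_less le_Suc_ex add.commute)
  then show ?case
  proof cases
    case 1
    have "(\<integral>\<^sup>+k\<in>{0..}. ennreal (k ^ n * r k) \<partial>lborel) \<le> (\<integral>\<^sup>+k. ennreal (norm (r k)) \<partial>lborel)"
      using r by (intro nn_integral_mono) (auto simp: 1 indicator_def)
    then show ?thesis using i0 by (auto simp: integrable_iff_bounded intro: le_less_trans)
  next
    case 2
    have "(\<integral>\<^sup>+k\<in>{0..}. ennreal (k ^ n * r k) \<partial>lborel) \<le> (\<integral>\<^sup>+k. ennreal (norm (k * r k)) \<partial>lborel)"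
      using r by (intro nn_integral_mono) (auto simp: 2 indicator_def)
    then show ?thesis using i by (auto simp: integrable_iff_bounded intro: le_less_trans)
  next
    case 3
    have "(\<integral>\<^sup>+k\<in>{0..}. ennreal (k ^ (m + 1 + 1) * r k) \<partial>lborel)
      \<le> ennreal (real (m + 1) * A) * (\<integral>\<^sup>+k\<in>{0..}. ennreal (k ^ (m + 1 - 1) * r k) \<partial>lborel)"
      by (rule half_moment_step[OF r _ i A tail]) auto
    also have "\<dots> < \<infinity>"
      using less.IH[of m] 3 by (auto simp: ennreal_mult_less_top)
    finally show ?thesis using 3 by simp
  qed
qed

text \<open>The bound on the ratio controls right tails only. The left half-line is treated by
  reflecting the density; mean zero turns the reflected tail at \<open>h\<close> into the original
  tail at \<open>-h\<close>, so the same constant \<open>A\<close> serves.\<close>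

lemma tail_ratio_bounded_imp_moments:
  fixes \<rho> :: "real \<Rightarrow> real"
  assumes pos: "\<And>x. \<rho> x > 0" and i0: "integrable lborel \<rho>"
    and mean: "has_bochner_integral lborel (\<lambda>x. x * \<rho> x) 0"
    and bdd: "bounded (range (tail_ratio \<rho>))"
  shows "integrable lborel (\<lambda>x. \<rho> x * x ^ n)"
proof -
  have [measurable]: "\<rho> \<in> borel_measurable borel" using borel_measurable_integrable[OF i0] by simp
  from bdd obtain A where A: "\<And>h. \<bar>tail_ratio \<rho> h\<bar> \<le> A" by (auto simp: bounded_iff)
  have A0: "A \<ge> 0" using A[of 0] by linarith
  have i: "integrable lborel (\<lambda>x. x * \<rho> x)" using mean by (simp add: has_bochner_integral_iff)
  have tail: "\<bar>LBINT k:{h..}. k * \<rho> k\<bar> \<le> A * \<rho> h" for h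
    using A[of h] pos[of h] by (simp add: tail_ratio_def abs_mult field_simps)
  have fin1: "(\<integral>\<^sup>+k\<in>{0..}. ennreal (k ^ n * \<rho> k) \<partial>lborel) < \<infinity>"
    using tail by (intro half_moment_finite[OF _ i0 i A0]) (auto intro: less_imp_le[OF pos] simp: abs_le_iff)
  have i0': "integrable lborel (\<lambda>x. \<rho> (- x))"
    using lborel_integrable_real_affine[OF i0, of "-1" 0] by simp
  have i': "integrable lborel (\<lambda>x. x * \<rho> (- x))"
    using lborel_integrable_real_affine[OF i, of "-1" 0] by simp
  have tail': "(LBINT k:{h..}. k * \<rho> (- k)) \<le> A * \<rho> (- h)" for h
  proof -
    have s: "set_integrable lborel B (\<lambda>k. k * \<rho> k)" if "B \<in> sets borel" for B
      unfolding set_integrable_def using that by (intro integrable_mult_indicator i) auto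
    have "(LBINT k:{h..}. k * \<rho> (- k)) = - (LBINT k:{..-h}. k * \<rho> k)"
    proof -
      have "(LBINT k:{h..}. k * \<rho> (- k)) = (LBINT k. - (indicator {..-h} (- k) *\<^sub>R ((- k) * \<rho> (- k))))"
        unfolding set_lebesgue_integral_def by (intro Bochner_Integration.integral_cong) (auto simp: indicator_def)
      also have "\<dots> = - (LBINT k. indicator {..-h} (- k) *\<^sub>R ((- k) * \<rho> (- k)))"
        by (rule Bochner_Integration.integral_minus)
      also have "(LBINT k. indicator {..-h} (- k) *\<^sub>R ((- k) * \<rho> (- k))) = (LBINT k. indicator {..-h} k *\<^sub>R (k * \<rho> k))"
        using lborel_integral_real_affine[of "-1" "\<lambda>k. indicator {..-h} k *\<^sub>R (k * \<rho> k)" 0] by simp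
      finally show ?thesis unfolding set_lebesgue_integral_def by simp
    qed
    \<comment> \<open>The null endpoint is dropped to make the half-line the exact complement of
      \<open>{-h..}\<close>.\<close>
    also have "(LBINT k:{..-h}. k * \<rho> k) = (LBINT k:{..<-h}. k * \<rho> k)"
      using AE_lborel_singleton[of "-h"] unfolding set_lebesgue_integral_def
      by (intro integral_cong_AE) (auto elim!: eventually_mono simp: indicator_def)
    also have "- (LBINT k:{..<-h}. k * \<rho> k) = (LBINT k:{-h..}. k * \<rho> k)"
    proof -
      have "(LBINT k:{..<-h} \<union> {-h..}. k * \<rho> k) = (LBINT k:{..<-h}. k * \<rho> k) + (LBINT k:{-h..}. k * \<rho> k)"
        by (intro set_integral_Un s) auto
      moreover have "{..<-h} \<union> {-h..} = (UNIV :: real set)" by auto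
      ultimately show ?thesis
        using has_bochner_integral_integral_eq[OF mean] by (simp add: set_lebesgue_integral_def)
    qed
    finally show ?thesis using tail[of "-h"] by (simp add: abs_le_iff)
  qed
  have "(\<integral>\<^sup>+k\<in>{0..}. ennreal (k ^ n * \<rho> (- k)) \<partial>lborel) < \<infinity>"
    by (rule half_moment_finite[OF _ i0' i' A0]) (auto intro: less_imp_le[OF pos] tail')
  also have "(\<integral>\<^sup>+k\<in>{0..}. ennreal (k ^ n * \<rho> (- k)) \<partial>lborel) = (\<integral>\<^sup>+k\<in>{..0}. ennreal (\<bar>k\<bar> ^ n * \<rho> k) \<partial>lborel)"
    using nn_integral_real_affine[of "\<lambda>k. ennreal (\<bar>k\<bar> ^ n * \<rho> k) * indicator {..0} k" "-1" 0]
    by (auto simp: indicator_def intro!: nn_integral_cong)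
  finally have fin2: "(\<integral>\<^sup>+k\<in>{..0}. ennreal (\<bar>k\<bar> ^ n * \<rho> k) \<partial>lborel) < \<infinity>" .
  have "(\<integral>\<^sup>+x. ennreal (norm (\<rho> x * x ^ n)) \<partial>lborel)
      \<le> (\<integral>\<^sup>+k. ennreal (k ^ n * \<rho> k) * indicator {0..} k + ennreal (\<bar>k\<bar> ^ n * \<rho> k) * indicator {..0} k \<partial>lborel)"
    using less_imp_le[OF pos] by (intro nn_integral_mono) (auto simp: indicator_def abs_mult power_abs mult.commute)
  also have "\<dots> = (\<integral>\<^sup>+k\<in>{0..}. ennreal (k ^ n * \<rho> k) \<partial>lborel) + (\<integral>\<^sup>+k\<in>{..0}. ennreal (\<bar>k\<bar> ^ n * \<rho> k) \<partial>lborel)"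
    by (rule nn_integral_add) measurable
  also have "\<dots> < \<infinity>" using fin1 fin2 by simp
  finally show ?thesis by (intro integrableI_bounded) auto
qed

subsection \<open>Moments of quadratic forms\<close>

lemma power_even_add_le:
  fixes a b :: real
  shows "(a + b) ^ (2 * q) \<le> 4 ^ q * (a ^ (2 * q) + b ^ (2 * q))"
proof -
  have "(a + b) ^ (2 * q) = \<bar>a + b\<bar> ^ (2 * q)" by (simp add: power_mult)
  also have "\<dots> \<le> (2 * max \<bar>a\<bar> \<bar>b\<bar>) ^ (2 * q)" by (intro power_mono) auto
  also have "\<dots> = 4 ^ q * max \<bar>a\<bar> \<bar>b\<bar> ^ (2 * q)" by (simp add: power_mult power_mult_distrib)
  also have "\<dots> \<le> 4 ^ q * (a ^ (2 * q) + b ^ (2 * q))"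
    by (intro mult_left_mono) (auto simp: max_def power_mult)
  finally show ?thesis .
qed

lemma power_mult_le_add_powers:
  fixes a b :: real
  shows "a ^ (2 * q) * b ^ (2 * q) \<le> a ^ (2 * (2 * q)) + b ^ (2 * (2 * q))"
proof -
  have "0 \<le> (a ^ (2 * q) - b ^ (2 * q))\<^sup>2" "0 \<le> (a ^ (2*q))^2" "0 \<le> (b ^ (2*q))^2" by auto
  then have "a ^ (2 * q) * b ^ (2 * q) \<le> (a ^ (2 * q))\<^sup>2 + (b ^ (2 * q))\<^sup>2"
    unfolding power2_diff by linarith
  then show ?thesis by (simp add: power_mult[symmetric] mult.commute mult.left_commute)
qed

section \<open>Random variables with finite moments of all orders\<close>

text \<open>Even powers are non-negative, which keeps the domination arguments free of signs. The
  class is an algebra (products by passing from exponent 2q to 4q), so every integrability side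
  condition below reduces to membership.\<close>

definition all_moments :: "'a measure \<Rightarrow> ('a \<Rightarrow> real) \<Rightarrow> bool" where
  "all_moments M f \<longleftrightarrow> f \<in> borel_measurable M \<and> (\<forall>q. integrable M (\<lambda>\<omega>. f \<omega> ^ (2 * q)))"

lemma all_moments_borel [measurable_dest]: "all_moments M f \<Longrightarrow> f \<in> borel_measurable M"
  by (simp add: all_moments_def)

lemma all_moments_add:
  assumes "all_moments M f" "all_moments M g"
  shows "all_moments M (\<lambda>\<omega>. f \<omega> + g \<omega>)"
  unfolding all_moments_def
proof (intro conjI allI)
  note [measurable] = assms[THEN all_moments_borel]
  show "(\<lambda>\<omega>. f \<omega> + g \<omega>) \<in> borel_measurable M" by simp
  fix q
  have "integrable M (\<lambda>\<omega>. 4 ^ q * (f \<omega> ^ (2 * q) + g \<omega> ^ (2 * q)))"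
    using assms by (auto simp: all_moments_def)
  then show "integrable M (\<lambda>\<omega>. (f \<omega> + g \<omega>) ^ (2 * q))"
  proof (rule Bochner_Integration.integrable_bound)
    show "AE \<omega> in M. norm ((f \<omega> + g \<omega>) ^ (2 * q)) \<le> norm (4 ^ q * (f \<omega> ^ (2 * q) + g \<omega> ^ (2 * q)))"
      using power_even_add_le[of "f _" "g _" q] by (intro AE_I2) (simp add: power_mult)
  qed simp
qed

lemma all_moments_mult:
  assumes "all_moments M f" "all_moments M g"
  shows "all_moments M (\<lambda>\<omega>. f \<omega> * g \<omega>)"
  unfolding all_moments_def
proof (intro conjI allI)
  note [measurable] = assms[THEN all_moments_borel]
  show "(\<lambda>\<omega>. f \<omega> * g \<omega>) \<in> borel_measurable M" by simp
  fix q
  have "integrable M (\<lambda>\<omega>. f \<omega> ^ (2 * (2 * q)) + g \<omega> ^ (2 * (2 * q)))"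
    using assms unfolding all_moments_def by (intro Bochner_Integration.integrable_add) blast+
  then show "integrable M (\<lambda>\<omega>. (f \<omega> * g \<omega>) ^ (2 * q))"
  proof (rule Bochner_Integration.integrable_bound)
    show "AE \<omega> in M. norm ((f \<omega> * g \<omega>) ^ (2 * q)) \<le> norm (f \<omega> ^ (2 * (2 * q)) + g \<omega> ^ (2 * (2 * q)))"
      using power_mult_le_add_powers[of "f _" q "g _"]
      by (intro AE_I2) (simp add: power_mult_distrib power_mult)
  qed simp
qed

lemma all_moments_integrable:
  assumes "prob_space M" "all_moments M f"
  shows "integrable M f"
proof -
  interpret prob_space M by fact
  note [measurable] = assms(2)[THEN all_moments_borel]
  have "integrable M (\<lambda>\<omega>. f \<omega> ^ (2 * 1))"
    using assms(2) unfolding all_moments_def by blast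
  then have "integrable M (\<lambda>\<omega>. 1 + f \<omega> ^ 2)" by simp
  then show ?thesis
  proof (rule Bochner_Integration.integrable_bound)
    have "\<bar>x\<bar> \<le> 1 + x\<^sup>2" for x :: real
      using zero_le_power2[of "\<bar>x\<bar> - 1"] unfolding power2_diff by (simp add: algebra_simps)
    then show "AE \<omega> in M. norm (f \<omega>) \<le> norm (1 + f \<omega> ^ 2)" by auto
  qed simp
qed

lemma all_moments_const: "prob_space M \<Longrightarrow> all_moments M (\<lambda>_. c)"
proof -
  assume "prob_space M"
  then interpret prob_space M .
  show ?thesis by (simp add: all_moments_def)
qed

lemma all_moments_power:
  assumes "prob_space M" "all_moments M f"
  shows "all_moments M (\<lambda>\<omega>. f \<omega> ^ n)"
  by (induction n) (use assms in \<open>auto intro: all_moments_mult all_moments_const\<close>)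

lemma all_moments_diff:
  assumes "prob_space M" "all_moments M f" "all_moments M g"
  shows "all_moments M (\<lambda>\<omega>. f \<omega> - g \<omega>)"
  using all_moments_add[OF assms(2) all_moments_mult[OF all_moments_const[OF assms(1), of "-1"] assms(3)]]
  by simp

lemma all_moments_sum:
  assumes "prob_space M" "\<And>i. i \<in> I \<Longrightarrow> all_moments M (f i)"
  shows "all_moments M (\<lambda>\<omega>. \<Sum>i\<in>I. f i \<omega>)"
  using assms(2)
  by (induction I rule: infinite_finite_induct)
     (auto intro: all_moments_add all_moments_const[OF assms(1)])

section \<open>Even moments under an orthogonal increment\<close>

text \<open>The first-order term keeps its sign, since orthogonality is going to remove it. Every
  later binomial term is at most its coefficient times \<open>R\<close>, as seen by comparing |d|
  with |f|, and the coefficients sum to \<open>2 ^ (2 * p) = 4 ^ p\<close>.\<close>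

lemma power_even_add_Taylor:
  fixes f d :: real
  assumes "p \<ge> 1"
  shows "(f + d) ^ (2 * p) \<le> f ^ (2 * p) + 2 * p * (f ^ (2 * p - 1) * d)
           + 4 ^ p * ((f\<^sup>2) ^ (p - 1) * d\<^sup>2 + (d\<^sup>2) ^ p)"
proof -
  define n where "n = 2 * p"
  have n: "n \<ge> 2" using assms by (simp add: n_def)
  have en: "even n" "even (n - 2)" using assms by (auto simp: n_def)
  define R where "R = \<bar>f\<bar> ^ (n - 2) * \<bar>d\<bar>\<^sup>2 + \<bar>d\<bar> ^ n"
  have R0: "R \<ge> 0" by (auto simp: R_def)
  define t where "t k = real (n choose k) * d ^ k * f ^ (n - k)" for k
  have tk: "t k \<le> real (n choose k) * R" if k: "k \<in> {2..n}" for k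
  proof -
    have "d ^ k * f ^ (n - k) \<le> \<bar>d\<bar> ^ k * \<bar>f\<bar> ^ (n - k)"
      by (metis abs_ge_self abs_mult power_abs)
    also have "\<dots> \<le> R"
    proof (cases "\<bar>d\<bar> \<le> \<bar>f\<bar>")
      case True
      have "\<bar>d\<bar> ^ k * \<bar>f\<bar> ^ (n - k) = \<bar>d\<bar> ^ 2 * (\<bar>d\<bar> ^ (k - 2) * \<bar>f\<bar> ^ (n - k))"
      proof -
        have "\<bar>d\<bar> ^ k = \<bar>d\<bar> ^ 2 * \<bar>d\<bar> ^ (k - 2)"
          using k power_add[of "\<bar>d\<bar>" 2 "k - 2"] by (simp only: le_add_diff_inverse atLeastAtMost_iff)
        then show ?thesis by (simp only: mult.assoc)
      qed
      also have "\<dots> \<le> \<bar>d\<bar> ^ 2 * (\<bar>f\<bar> ^ (k - 2) * \<bar>f\<bar> ^ (n - k))"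
        using True by (intro mult_left_mono mult_right_mono power_mono) auto
      also have "\<dots> = \<bar>f\<bar> ^ (n - 2) * \<bar>d\<bar>\<^sup>2"
        using k power_add[of "\<bar>f\<bar>" "k - 2" "n - k"] by (simp del: power2_abs)
      also have "\<dots> \<le> R" by (simp add: R_def)
      finally show ?thesis .
    next
      case False
      have "\<bar>d\<bar> ^ k * \<bar>f\<bar> ^ (n - k) \<le> \<bar>d\<bar> ^ k * \<bar>d\<bar> ^ (n - k)"
        using False by (intro mult_left_mono power_mono) auto
      also have "\<dots> = \<bar>d\<bar> ^ n" using k by (simp add: power_add[symmetric])
      also have "\<dots> \<le> R" by (simp add: R_def)
      finally show ?thesis .
    qed
    finally show ?thesis unfolding t_def by (simp add: mult.assoc mult_left_mono)
  qed
  have "(f + d) ^ n = (\<Sum>k\<le>n. t k)"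
    unfolding t_def by (subst add.commute) (simp add: binomial_ring)
  also have "{..n} = {0, 1} \<union> {2..n}" using n by auto
  also have "sum t \<dots> = t 0 + t 1 + sum t {2..n}" by (subst sum.union_disjoint) auto
  also have "sum t {2..n} \<le> (\<Sum>k\<in>{2..n}. real (n choose k) * R)" by (intro sum_mono tk)
  also have "\<dots> \<le> (\<Sum>k\<le>n. real (n choose k) * R)"
    using R0 by (intro sum_mono2) auto
  also have "\<dots> = 2 ^ n * R"
    using arg_cong[OF choose_row_sum[of n], of real] by (simp add: sum_distrib_right[symmetric])
  finally have "(f + d) ^ n \<le> t 0 + t 1 + 2 ^ n * R" by simp
  moreover have "t 0 = f ^ (2 * p)" "t 1 = 2 * p * (f ^ (2 * p - 1) * d)"
    by (auto simp: t_def n_def)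
  moreover have "(2::real) ^ n = 4 ^ p" by (simp add: n_def power_mult)
  moreover have "R = (f\<^sup>2) ^ (p - 1) * d\<^sup>2 + (d\<^sup>2) ^ p"
    unfolding R_def n_def by (simp add: power_mult[symmetric] right_diff_distrib' power_even_abs)
  ultimately show ?thesis by (simp add: n_def)
qed

text \<open>Folds the outcome of the Taylor estimate back into a single p-th power, the shape that
  an induction over indices can reuse. The \<open>1\<close> in \<open>2 * (1 + c)\<close> makes the
  base dominate \<open>D\<close> even when \<open>c\<close> is small.\<close>

lemma add_power_superadditive:
  fixes F D :: real
  assumes "p \<ge> 1" "0 \<le> F" "0 \<le> D" "0 \<le> c"
  shows "F ^ p + c * F ^ (p - 1) * D + c * D ^ p \<le> (F + 2 * (1 + c) * D) ^ p"
proof -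
  define X where "X = F + 2 * (1 + c) * D"
  have cD: "D \<le> 2 * (1 + c) * D" using assms mult_right_mono[of 1 "2 * (1+c)" D] by simp
  have XF: "X \<ge> F" and XD: "X \<ge> D" using assms cD by (auto simp: X_def)
  have cD0: "0 \<le> c * D" using assms by simp
  have "F ^ p + c * F ^ (p - 1) * D + c * D ^ p
        = F * F ^ (p - 1) + c * D * F ^ (p - 1) + c * D * D ^ (p - 1)"
    using assms(1) by (cases p) (auto simp: algebra_simps)
  also have "\<dots> \<le> F * X ^ (p - 1) + c * D * X ^ (p - 1) + c * D * X ^ (p - 1)"
    using assms XF XD by (intro add_mono mult_left_mono power_mono) auto
  also have "\<dots> = (F + 2 * c * D) * X ^ (p - 1)" by (simp add: algebra_simps)
  also have "\<dots> \<le> X * X ^ (p - 1)"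
    using assms XF by (intro mult_right_mono) (auto simp: X_def algebra_simps)
  also have "\<dots> = X ^ p" using assms(1) by (cases p) auto
  finally show ?thesis by (simp add: X_def)
qed

text \<open>The factor \<open>2 * (1 + c)\<close> of the preceding inequality at
  \<open>c = 2 * 4 ^ p\<close>.\<close>

definition mart_const :: "nat \<Rightarrow> real" where "mart_const p = 2 * (1 + 2 * 4 ^ p)"

lemma mart_const_ge_1: "mart_const p \<ge> 1"
  by (simp add: mart_const_def)

text \<open>An orthogonal increment enlarges the squared \<open>L\<^sup>2\<^sup>p\<close> norm additively, as in the
  Burkholder inequality.\<close>

lemma moment_orthogonal_increment:
  assumes M: "prob_space M" and f: "all_moments M f" and d: "all_moments M d" and p: "p \<ge> 1"
    and F: "integral\<^sup>L M (\<lambda>\<omega>. f \<omega> ^ (2 * p)) \<le> F ^ p" "0 \<le> F"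
    and D: "integral\<^sup>L M (\<lambda>\<omega>. d \<omega> ^ (2 * p)) \<le> D ^ p" "0 \<le> D"
    and orth: "integral\<^sup>L M (\<lambda>\<omega>. f \<omega> ^ (2 * p - 1) * d \<omega>) = 0"
  shows "integral\<^sup>L M (\<lambda>\<omega>. (f \<omega> + d \<omega>) ^ (2 * p)) \<le> (F + mart_const p * D) ^ p"
proof -
  interpret prob_space M by fact
  have int: "integrable M g" if "all_moments M g" for g
    using all_moments_integrable[OF M that] .
  note am = all_moments_add all_moments_mult all_moments_power[OF M] f d all_moments_const[OF M]
  \<comment> \<open>The bounds are first enlarged strictly, so that division by them is legitimate
    when \<open>F\<close> or \<open>D\<close> is zero.\<close>
  have pos: "integral\<^sup>L M (\<lambda>\<omega>. (f \<omega> + d \<omega>) ^ (2 * p)) \<le> (F' + mart_const p * D') ^ p"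
    if F': "F' > F" and D': "D' > D" for F' D'
  proof -
    have F0: "F' > 0" and D0: "D' > 0" using F D that by auto
    have Fp: "integral\<^sup>L M (\<lambda>\<omega>. f \<omega> ^ (2 * p)) \<le> F' ^ p"
      using F F' by (meson less_imp_le order_trans power_mono)
    have Dp: "integral\<^sup>L M (\<lambda>\<omega>. d \<omega> ^ (2 * p)) \<le> D' ^ p"
      using D D' by (meson less_imp_le order_trans power_mono)
    \<comment> \<open>Plays the role of Hoelder's inequality: after normalising by \<open>F'\<close>
      and \<open>D'\<close>, the mixed term is at most the sum of the two pure powers, which costs
      only a factor 2 in expectation.\<close>
    have young: "u ^ (p - 1) * v \<le> F' ^ (p - 1) * D' * (u ^ p / F' ^ p + v ^ p / D' ^ p)"
      if "u \<ge> 0" "v \<ge> 0" for u v :: real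
    proof -
      define a b where "a = u / F'" and "b = v / D'"
      have ab: "a \<ge> 0" "b \<ge> 0" using that F0 D0 by (auto simp: a_def b_def)
      have pS: "x ^ p = x ^ (p - 1) * x" for x :: real using p by (cases p) auto
      have "a ^ (p - 1) * b \<le> a ^ p + b ^ p"
      proof (cases "b \<le> a")
        case True
        then have "a ^ (p - 1) * b \<le> a ^ (p - 1) * a" using ab by (intro mult_left_mono) auto
        then show ?thesis using ab pS[of a] zero_le_power[of b p] by linarith
      next
        case False
        then have "a ^ (p - 1) * b \<le> b ^ (p - 1) * b"
          using ab by (intro mult_right_mono power_mono) auto
        then show ?thesis using ab pS[of b] zero_le_power[of a p] by linarith
      qed
      then have "F' ^ (p - 1) * D' * (a ^ (p - 1) * b) \<le> F' ^ (p - 1) * D' * (a ^ p + b ^ p)"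
        using F0 D0 by (intro mult_left_mono) auto
      moreover have "F' ^ (p - 1) * D' * (a ^ (p - 1) * b) = u ^ (p - 1) * v"
        using F0 D0 by (simp add: a_def b_def power_divide)
      ultimately show ?thesis by (simp add: a_def b_def power_divide)
    qed
    have i1: "integrable M (\<lambda>\<omega>. f \<omega> ^ (2 * p))" "integrable M (\<lambda>\<omega>. d \<omega> ^ (2 * p))"
      by (intro int am)+
    have i2: "integrable M (\<lambda>\<omega>. (f \<omega>)\<^sup>2 ^ (p - 1) * (d \<omega>)\<^sup>2)" by (intro int am)
    have i3: "integrable M (\<lambda>\<omega>. f \<omega> ^ (2 * p - 1) * d \<omega>)" by (intro int am)
    have i4: "integrable M (\<lambda>\<omega>. (d \<omega>)\<^sup>2 ^ p)" by (intro int am)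
    have "integral\<^sup>L M (\<lambda>\<omega>. (f \<omega>)\<^sup>2 ^ (p - 1) * (d \<omega>)\<^sup>2)
       \<le> integral\<^sup>L M (\<lambda>\<omega>. F' ^ (p - 1) * D' * (f \<omega> ^ (2 * p) / F' ^ p + d \<omega> ^ (2 * p) / D' ^ p))"
    proof (rule integral_mono[OF i2])
      show "integrable M (\<lambda>\<omega>. F' ^ (p - 1) * D' * (f \<omega> ^ (2 * p) / F' ^ p + d \<omega> ^ (2 * p) / D' ^ p))"
        using i1 by simp
      show "(f \<omega>)\<^sup>2 ^ (p - 1) * (d \<omega>)\<^sup>2
        \<le> F' ^ (p - 1) * D' * (f \<omega> ^ (2 * p) / F' ^ p + d \<omega> ^ (2 * p) / D' ^ p)" for \<omega>
        using young[of "(f \<omega>)\<^sup>2" "(d \<omega>)\<^sup>2"] by (simp add: power_mult)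
    qed
    also have "\<dots> = F' ^ (p - 1) * D' * (integral\<^sup>L M (\<lambda>\<omega>. f \<omega> ^ (2 * p)) / F' ^ p
        + integral\<^sup>L M (\<lambda>\<omega>. d \<omega> ^ (2 * p)) / D' ^ p)" using i1 by simp
    also have "\<dots> \<le> F' ^ (p - 1) * D' * (1 + 1)"
      using F0 D0 Fp Dp by (intro mult_left_mono add_mono) auto
    finally have mixed: "integral\<^sup>L M (\<lambda>\<omega>. (f \<omega>)\<^sup>2 ^ (p - 1) * (d \<omega>)\<^sup>2) \<le> 2 * F' ^ (p - 1) * D'"
      by simp
    have "integral\<^sup>L M (\<lambda>\<omega>. (f \<omega> + d \<omega>) ^ (2 * p))
      \<le> integral\<^sup>L M (\<lambda>\<omega>. f \<omega> ^ (2 * p) + 2 * p * (f \<omega> ^ (2 * p - 1) * d \<omega>)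
           + 4 ^ p * ((f \<omega>)\<^sup>2 ^ (p - 1) * (d \<omega>)\<^sup>2 + (d \<omega>)\<^sup>2 ^ p))"
    proof (rule integral_mono)
      show "integrable M (\<lambda>\<omega>. (f \<omega> + d \<omega>) ^ (2 * p))" by (intro int am)
      show "integrable M (\<lambda>\<omega>. f \<omega> ^ (2 * p) + 2 * p * (f \<omega> ^ (2 * p - 1) * d \<omega>)
           + 4 ^ p * ((f \<omega>)\<^sup>2 ^ (p - 1) * (d \<omega>)\<^sup>2 + (d \<omega>)\<^sup>2 ^ p))"
        using i1 i2 i3 i4 by (intro Bochner_Integration.integrable_add integrable_mult_right)
    qed (use power_even_add_Taylor[OF p] in simp)
    also have "\<dots> = integral\<^sup>L M (\<lambda>\<omega>. f \<omega> ^ (2 * p)) + 4 ^ p * (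
         integral\<^sup>L M (\<lambda>\<omega>. (f \<omega>)\<^sup>2 ^ (p - 1) * (d \<omega>)\<^sup>2) + integral\<^sup>L M (\<lambda>\<omega>. d \<omega> ^ (2 * p)))"
    proof -
      have "integral\<^sup>L M (\<lambda>\<omega>. (d \<omega>)\<^sup>2 ^ p) = integral\<^sup>L M (\<lambda>\<omega>. d \<omega> ^ (2 * p))"
        by (simp add: power_mult)
      moreover have "integrable M (\<lambda>\<omega>. 2 * p * (f \<omega> ^ (2 * p - 1) * d \<omega>))"
        using i3 by (rule integrable_mult_right)
      moreover have "integral\<^sup>L M (\<lambda>\<omega>. 2 * p * (f \<omega> ^ (2 * p - 1) * d \<omega>)) = 0"
        by (subst integral_mult_right_zero) (simp only: orth mult_zero_right)
      ultimately show ?thesis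
        using i1(1) i2 i4 by (simp only: Bochner_Integration.integral_add integral_mult_right_zero
          Bochner_Integration.integrable_add integrable_mult_right add_0_right)
    qed
    also have "\<dots> \<le> F' ^ p + 4 ^ p * (2 * F' ^ (p - 1) * D' + D' ^ p)"
      using Fp mixed Dp by (intro add_mono mult_left_mono) auto
    also have "\<dots> \<le> F' ^ p + (2 * 4 ^ p) * F' ^ (p - 1) * D' + (2 * 4 ^ p) * D' ^ p"
      using D0 by (auto simp: algebra_simps)
    also have "\<dots> \<le> (F' + mart_const p * D') ^ p"
      unfolding mart_const_def using F0 D0 p by (intro add_power_superadditive) auto
    finally show ?thesis .
  qed
  \<comment> \<open>The enlarged bounds now decrease to \<open>F\<close> and
    \<open>D\<close>.\<close>
  have lim: "((\<lambda>e. ((F + e) + mart_const p * (D + e)) ^ p) \<longlongrightarrow> ((F + 0) + mart_const p * (D + 0)) ^ p)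
      (at_right 0)"
    by (intro tendsto_intros)
  have ev: "eventually (\<lambda>e. integral\<^sup>L M (\<lambda>\<omega>. (f \<omega> + d \<omega>) ^ (2 * p))
      \<le> ((F + e) + mart_const p * (D + e)) ^ p) (at_right 0)"
    by (rule eventually_mono[OF eventually_at_right_less]) (intro pos, auto)
  have "integral\<^sup>L M (\<lambda>\<omega>. (f \<omega> + d \<omega>) ^ (2 * p)) \<le> ((F + 0) + mart_const p * (D + 0)) ^ p"
    by (rule tendsto_lowerbound[OF lim ev]) simp
  then show ?thesis by simp
qed

section \<open>Linear and quadratic forms in independent variables\<close>

text \<open>Factorises mixed moments of the variables already present and a new one; when the factor
  in the new variable has mean zero, this is the orthogonality that the increment bound asks
  for.\<close>

lemma (in prob_space) indep_vars_insert_expectation_mult: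
  fixes x :: "'i \<Rightarrow> 'a \<Rightarrow> real" and g :: "('i \<Rightarrow> real) \<Rightarrow> real" and h :: "real \<Rightarrow> real"
  assumes ind: "indep_vars (\<lambda>_. borel) x (insert n I)" and n: "n \<notin> I"
    and g: "g \<in> borel_measurable (PiM I (\<lambda>_. borel))" and h: "h \<in> borel_measurable borel"
    and ig: "integrable M (\<lambda>\<omega>. g (\<lambda>i\<in>I. x i \<omega>))" and ih: "integrable M (\<lambda>\<omega>. h (x n \<omega>))"
  shows "expectation (\<lambda>\<omega>. g (\<lambda>i\<in>I. x i \<omega>) * h (x n \<omega>))
       = expectation (\<lambda>\<omega>. g (\<lambda>i\<in>I. x i \<omega>)) * expectation (\<lambda>\<omega>. h (x n \<omega>))"
proof -
  have "indep_var (PiM I (\<lambda>_. borel)) (\<lambda>\<omega>. restrict (\<lambda>i. x i \<omega>) I)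
      (PiM {n} (\<lambda>_. borel)) (\<lambda>\<omega>. restrict (\<lambda>i. x i \<omega>) {n})"
    using n by (intro indep_var_restrict[OF ind]) auto
  then have "indep_var borel (g \<circ> (\<lambda>\<omega>. restrict (\<lambda>i. x i \<omega>) I))
      borel ((\<lambda>y. h (y n)) \<circ> (\<lambda>\<omega>. restrict (\<lambda>i. x i \<omega>) {n}))"
    by (rule indep_var_compose[OF _ g]) (use h in measurable)
  then have "indep_var borel (\<lambda>\<omega>. g (\<lambda>i\<in>I. x i \<omega>)) borel (\<lambda>\<omega>. h (x n \<omega>))"
    by (simp add: comp_def)
  from indep_var_lebesgue_integral[OF this ig ih] show ?thesis .
qed

text \<open>\<open>K\<close> bounds the squared norms in \<open>L^(2p)\<close> and in
  \<open>L^(4p)\<close>. The second is needed for the diagonal of a quadratic form, where squares of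
  the variables occur.\<close>

definition std_family :: "'a measure \<Rightarrow> 'i set \<Rightarrow> ('i \<Rightarrow> 'a \<Rightarrow> real) \<Rightarrow> nat \<Rightarrow> real \<Rightarrow> bool" where
  "std_family M I x p K \<longleftrightarrow> prob_space M \<and> prob_space.indep_vars M (\<lambda>_. borel) x I \<and>
     (\<forall>i\<in>I. all_moments M (x i) \<and> integral\<^sup>L M (x i) = 0 \<and> integral\<^sup>L M (\<lambda>\<omega>. (x i \<omega>)\<^sup>2) = 1 \<and>
        integral\<^sup>L M (\<lambda>\<omega>. x i \<omega> ^ (2 * p)) \<le> K ^ p \<and>
        integral\<^sup>L M (\<lambda>\<omega>. x i \<omega> ^ (2 * (2 * p))) \<le> K ^ (2 * p))"

lemma std_family_subset: "std_family M I x p K \<Longrightarrow> J \<subseteq> I \<Longrightarrow> std_family M J x p K"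
  unfolding std_family_def using prob_space.indep_vars_subset by blast

text \<open>Adding index \<open>n\<close> adds \<open>b n * x n\<close>, which has mean zero and is
  independent of the previous partial sum, hence orthogonal to its odd powers.\<close>

lemma linear_form_moment:
  assumes fin: "finite I" and p: "p \<ge> 1" and K: "K \<ge> 1" and x: "std_family M I x p K"
  shows "integral\<^sup>L M (\<lambda>\<omega>. (\<Sum>k\<in>I. b k * x k \<omega>) ^ (2 * p)) \<le> (mart_const p * K * (\<Sum>k\<in>I. (b k)\<^sup>2)) ^ p"
  using fin x
proof (induction I rule: finite_induct)
  case empty
  show ?case using p by (simp add: power_0_left)
next
  case (insert n I)
  have M: "prob_space M" and ind: "prob_space.indep_vars M (\<lambda>_. borel) x (insert n I)"
    and x: "\<And>i. i \<in> insert n I \<Longrightarrow> all_moments M (x i)"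
    and xn: "integral\<^sup>L M (x n) = 0" "integral\<^sup>L M (\<lambda>\<omega>. x n \<omega> ^ (2 * p)) \<le> K ^ p"
    using insert.prems unfolding std_family_def by auto
  interpret prob_space M by fact
  note am = all_moments_sum[OF M] all_moments_mult all_moments_const[OF M] all_moments_power[OF M] x
  let ?f = "\<lambda>\<omega>. \<Sum>k\<in>I. b k * x k \<omega>" and ?d = "\<lambda>\<omega>. b n * x n \<omega>"
  define F where "F = mart_const p * K * (\<Sum>k\<in>I. (b k)\<^sup>2)"
  have F0: "0 \<le> F" unfolding F_def using K mart_const_ge_1[of p]
    by (intro mult_nonneg_nonneg sum_nonneg) auto
  have f: "all_moments M ?f" by (intro am) auto
  have d: "all_moments M ?d" by (intro am) auto
  have "integral\<^sup>L M (\<lambda>\<omega>. (?f \<omega> + ?d \<omega>) ^ (2 * p)) \<le> (F + mart_const p * ((b n)\<^sup>2 * K)) ^ p"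
  proof (rule moment_orthogonal_increment[OF M f d p])
    show "integral\<^sup>L M (\<lambda>\<omega>. ?f \<omega> ^ (2 * p)) \<le> F ^ p"
      unfolding F_def using insert.prems by (intro insert.IH) (auto intro: std_family_subset)
    show "integral\<^sup>L M (\<lambda>\<omega>. ?d \<omega> ^ (2 * p)) \<le> ((b n)\<^sup>2 * K) ^ p"
      using xn(2) by (simp add: power_mult_distrib power_mult[symmetric] mult_left_mono)
    have "expectation (\<lambda>\<omega>. (\<lambda>y. (\<Sum>k\<in>I. b k * y k) ^ (2 * p - 1)) (\<lambda>i\<in>I. x i \<omega>) * (\<lambda>t. b n * t) (x n \<omega>))
      = expectation (\<lambda>\<omega>. (\<lambda>y. (\<Sum>k\<in>I. b k * y k) ^ (2 * p - 1)) (\<lambda>i\<in>I. x i \<omega>)) *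
        expectation (\<lambda>\<omega>. (\<lambda>t. b n * t) (x n \<omega>))"
      using insert.hyps
      by (intro indep_vars_insert_expectation_mult[OF ind])
         (auto intro!: all_moments_integrable[OF M] am)
    then show "integral\<^sup>L M (\<lambda>\<omega>. ?f \<omega> ^ (2 * p - 1) * ?d \<omega>) = 0"
      using xn(1) by simp
  qed (use F0 K in auto)
  also have "F + mart_const p * ((b n)\<^sup>2 * K) = mart_const p * K * (\<Sum>k\<in>insert n I. (b k)\<^sup>2)"
    using insert.hyps by (simp add: F_def algebra_simps)
  finally show ?case using insert.hyps by (simp add: add.commute)
qed

lemma power_add_le_power_add:
  fixes a b :: real
  assumes "0 \<le> a" "0 \<le> b" "p \<ge> 1"
  shows "a ^ p + b ^ p \<le> (a + b) ^ p"
proof -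
  have "a ^ p + b ^ p = a * a ^ (p - 1) + b * b ^ (p - 1)" using assms by (cases p) auto
  also have "\<dots> \<le> a * (a + b) ^ (p - 1) + b * (a + b) ^ (p - 1)"
    using assms by (intro add_mono mult_left_mono power_mono) auto
  also have "\<dots> = (a + b) ^ p" using assms by (cases p) (auto simp: algebra_simps)
  finally show ?thesis .
qed

text \<open>One factor \<open>mart_const p\<close> comes from the linear form inside each increment,
  the other from adding the increment; 32 collects the numerical losses in \<open>D\<close>
  below.\<close>

definition quad_const :: "nat \<Rightarrow> real \<Rightarrow> real" where
  "quad_const p K = 32 * (mart_const p)\<^sup>2 * K\<^sup>2"

lemma quad_const_nonneg: "0 \<le> quad_const p K"
  by (simp add: quad_const_def)

text \<open>Adding index \<open>n\<close> changes the centred form by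
  \<open>2 * L * x n + b n n * ((x n)^2 - 1)\<close>, with \<open>L\<close> the linear form of row
  \<open>n\<close> in the old variables. Both summands have conditional mean zero given those
  variables, so the change is an orthogonal increment, and its size is given by the linear bound and
  the 4p-th moment.\<close>

lemma quadratic_form_moment:
  fixes b :: "'i \<Rightarrow> 'i \<Rightarrow> real"
  assumes fin: "finite I" and p: "p \<ge> 1" and K: "K \<ge> 1" and x: "std_family M I x p K"
    and sym: "\<And>k l. b k l = b l k"
  shows "integral\<^sup>L M (\<lambda>\<omega>. ((\<Sum>k\<in>I. \<Sum>l\<in>I. b k l * x k \<omega> * x l \<omega>) - (\<Sum>k\<in>I. b k k)) ^ (2 * p))
    \<le> (quad_const p K * (\<Sum>k\<in>I. \<Sum>l\<in>I. (b k l)\<^sup>2)) ^ p"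
  using fin x
proof (induction I rule: finite_induct)
  case empty
  show ?case using p by (simp add: power_0_left)
next
  case (insert n I)
  have M: "prob_space M" and ind: "prob_space.indep_vars M (\<lambda>_. borel) x (insert n I)"
    and x: "\<And>i. i \<in> insert n I \<Longrightarrow> all_moments M (x i)"
    and xn: "integral\<^sup>L M (x n) = 0" "integral\<^sup>L M (\<lambda>\<omega>. (x n \<omega>)\<^sup>2) = 1"
      "integral\<^sup>L M (\<lambda>\<omega>. x n \<omega> ^ (2 * p)) \<le> K ^ p"
      "integral\<^sup>L M (\<lambda>\<omega>. x n \<omega> ^ (2 * (2 * p))) \<le> K ^ (2 * p)"
    using insert.prems unfolding std_family_def by auto
  interpret prob_space M by fact
  note am = all_moments_sum[OF M] all_moments_add all_moments_diff[OF M] all_moments_mult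
    all_moments_const[OF M] all_moments_power[OF M] x
  note int = all_moments_integrable[OF M]
  define c where "c = mart_const p"
  have c: "c \<ge> 1" by (simp add: c_def mart_const_ge_1)
  define A where "A = (\<Sum>k\<in>I. (b n k)\<^sup>2)"
  have A0: "0 \<le> A" by (auto simp: A_def intro: sum_nonneg)
  let ?L = "\<lambda>\<omega>. \<Sum>k\<in>I. b n k * x k \<omega>"
  let ?S = "\<lambda>\<omega>. (\<Sum>k\<in>I. \<Sum>l\<in>I. b k l * x k \<omega> * x l \<omega>) - (\<Sum>k\<in>I. b k k)"
  let ?d1 = "\<lambda>\<omega>. 2 * ?L \<omega> * x n \<omega>" and ?d2 = "\<lambda>\<omega>. b n n * ((x n \<omega>)\<^sup>2 - 1)"
  let ?d = "\<lambda>\<omega>. ?d1 \<omega> + ?d2 \<omega>"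
  define F where "F = quad_const p K * (\<Sum>k\<in>I. \<Sum>l\<in>I. (b k l)\<^sup>2)"
  \<comment> \<open>The pieces of the increment contribute \<open>4 * c * K^2 * A\<close> and
    \<open>8 * K^2 * (b n n)^2\<close>; splitting an even power of a sum multiplies both by 4, and
    \<open>c \<ge> 1\<close> brings them to a common factor.\<close>
  define D where "D = 32 * c * K\<^sup>2 * (A + (b n n)\<^sup>2)"
  have F0: "0 \<le> F" unfolding F_def
    by (intro mult_nonneg_nonneg sum_nonneg quad_const_nonneg) auto
  have D0: "0 \<le> D" unfolding D_def using c K A0 by (intro mult_nonneg_nonneg add_nonneg_nonneg) auto
  have L: "all_moments M ?L" by (intro am) auto
  have S: "all_moments M ?S" by (intro am) auto
  have d1: "all_moments M ?d1" by (intro am) auto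
  have d2: "all_moments M ?d2" by (intro am) auto
  have d: "all_moments M ?d" by (intro am d1 d2)
  have split: "expectation (\<lambda>\<omega>. g (\<lambda>i\<in>I. x i \<omega>) * h (x n \<omega>))
      = expectation (\<lambda>\<omega>. g (\<lambda>i\<in>I. x i \<omega>)) * expectation (\<lambda>\<omega>. h (x n \<omega>))"
    if "g \<in> borel_measurable (PiM I (\<lambda>_. borel))" "h \<in> borel_measurable borel"
      "all_moments M (\<lambda>\<omega>. g (\<lambda>i\<in>I. x i \<omega>))" "all_moments M (\<lambda>\<omega>. h (x n \<omega>))" for g h
    using insert.hyps that by (intro indep_vars_insert_expectation_mult[OF ind] int)
  have L2: "expectation (\<lambda>\<omega>. ?L \<omega> ^ (2 * p)) \<le> (c * K * A) ^ p"
    unfolding A_def c_def using insert.hyps insert.prems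
    by (intro linear_form_moment[OF _ p K]) (auto intro: std_family_subset)
  have d1_moment: "expectation (\<lambda>\<omega>. ?d1 \<omega> ^ (2 * p)) \<le> (4 * c * K\<^sup>2 * A) ^ p"
  proof -
    have "expectation (\<lambda>\<omega>. (\<lambda>y. (2 * (\<Sum>k\<in>I. b n k * y k)) ^ (2 * p)) (\<lambda>i\<in>I. x i \<omega>) * (\<lambda>t. t ^ (2 * p)) (x n \<omega>))
      = expectation (\<lambda>\<omega>. (\<lambda>y. (2 * (\<Sum>k\<in>I. b n k * y k)) ^ (2 * p)) (\<lambda>i\<in>I. x i \<omega>)) *
        expectation (\<lambda>\<omega>. (\<lambda>t. t ^ (2 * p)) (x n \<omega>))"
      by (rule split) (auto intro!: am)
    then have "expectation (\<lambda>\<omega>. ?d1 \<omega> ^ (2 * p))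
        = 4 ^ p * expectation (\<lambda>\<omega>. ?L \<omega> ^ (2 * p)) * expectation (\<lambda>\<omega>. x n \<omega> ^ (2 * p))"
      by (simp add: power_mult_distrib) (simp add: power_mult)
    also have "\<dots> \<le> 4 ^ p * (c * K * A) ^ p * K ^ p"
      using L2 xn(3) A0 c K by (intro mult_mono mult_nonneg_nonneg integral_nonneg) (auto simp: power_mult)
    also have "\<dots> = (4 * (c * K * A) * K) ^ p" by (simp only: power_mult_distrib)
    also have "4 * (c * K * A) * K = 4 * c * K\<^sup>2 * A" by (simp add: power2_eq_square)
    finally show ?thesis .
  qed
  have d2_moment: "expectation (\<lambda>\<omega>. ?d2 \<omega> ^ (2 * p)) \<le> (8 * K\<^sup>2 * (b n n)\<^sup>2) ^ p"
  proof -
    have "expectation (\<lambda>\<omega>. ((x n \<omega>)\<^sup>2 - 1) ^ (2 * p)) \<le> expectation (\<lambda>\<omega>. 4 ^ p * (x n \<omega> ^ (2 * (2 * p)) + 1))"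
    proof (rule integral_mono)
      show "integrable M (\<lambda>\<omega>. ((x n \<omega>)\<^sup>2 - 1) ^ (2 * p))" by (intro int am) auto
      show "integrable M (\<lambda>\<omega>. 4 ^ p * (x n \<omega> ^ (2 * (2 * p)) + 1))" by (intro int am) auto
      show "((x n \<omega>)\<^sup>2 - 1) ^ (2 * p) \<le> 4 ^ p * (x n \<omega> ^ (2 * (2 * p)) + 1)" for \<omega>
        using power_even_add_le[of "(x n \<omega>)\<^sup>2" "-1" p] by (simp add: power_mult[symmetric])
    qed
    also have "\<dots> = 4 ^ p * (expectation (\<lambda>\<omega>. x n \<omega> ^ (2 * (2 * p))) + 1)"
    proof -
      have "integrable M (\<lambda>\<omega>. x n \<omega> ^ (2 * (2 * p)))" by (intro int am) auto
      then show ?thesis by (simp add: prob_space)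
    qed
    also have "\<dots> \<le> 4 ^ p * (K ^ (2 * p) + K ^ (2 * p))"
      using xn(4) K by (intro mult_left_mono add_mono) auto
    also have "\<dots> = 2 * (4 * K\<^sup>2) ^ p" by (simp add: power_mult power_mult_distrib)
    also have "\<dots> \<le> 2 ^ p * (4 * K\<^sup>2) ^ p"
      using p self_le_power[of "2::real" p] by (intro mult_right_mono) auto
    finally have *: "expectation (\<lambda>\<omega>. ((x n \<omega>)\<^sup>2 - 1) ^ (2 * p)) \<le> (8 * K\<^sup>2) ^ p"
      by (simp only: power_mult_distrib[symmetric] mult.assoc[symmetric]) simp
    have "expectation (\<lambda>\<omega>. ?d2 \<omega> ^ (2 * p)) = ((b n n)\<^sup>2) ^ p * expectation (\<lambda>\<omega>. ((x n \<omega>)\<^sup>2 - 1) ^ (2 * p))"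
      by (simp add: power_mult_distrib) (simp add: power_mult)
    also have "\<dots> \<le> ((b n n)\<^sup>2) ^ p * (8 * K\<^sup>2) ^ p" by (intro mult_left_mono *) auto
    also have "\<dots> = (8 * K\<^sup>2 * (b n n)\<^sup>2) ^ p"
      by (simp only: power_mult_distrib[symmetric] mult.commute)
    finally show ?thesis .
  qed
  have d_moment: "expectation (\<lambda>\<omega>. ?d \<omega> ^ (2 * p)) \<le> D ^ p"
  proof -
    have i1: "integrable M (\<lambda>\<omega>. ?d1 \<omega> ^ (2 * p))" and i2: "integrable M (\<lambda>\<omega>. ?d2 \<omega> ^ (2 * p))"
      using all_moments_power[OF M d1] all_moments_power[OF M d2] by (auto intro: int)
    have "expectation (\<lambda>\<omega>. ?d \<omega> ^ (2 * p)) \<le> expectation (\<lambda>\<omega>. 4 ^ p * (?d1 \<omega> ^ (2 * p) + ?d2 \<omega> ^ (2 * p)))"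
    proof (rule integral_mono[OF _ _ power_even_add_le])
      show "integrable M (\<lambda>\<omega>. ?d \<omega> ^ (2 * p))" by (intro int all_moments_power[OF M] d)
      show "integrable M (\<lambda>\<omega>. 4 ^ p * (?d1 \<omega> ^ (2 * p) + ?d2 \<omega> ^ (2 * p)))"
        by (intro integrable_mult_right Bochner_Integration.integrable_add i1 i2)
    qed
    also have "\<dots> = 4 ^ p * (expectation (\<lambda>\<omega>. ?d1 \<omega> ^ (2 * p)) + expectation (\<lambda>\<omega>. ?d2 \<omega> ^ (2 * p)))"
      by (simp only: integral_mult_right_zero Bochner_Integration.integral_add[OF i1 i2])
    also have "\<dots> \<le> 4 ^ p * ((4 * c * K\<^sup>2 * A) ^ p + (8 * K\<^sup>2 * (b n n)\<^sup>2) ^ p)"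
      using d1_moment d2_moment by (intro mult_left_mono add_mono) auto
    also have "\<dots> \<le> 4 ^ p * (4 * c * K\<^sup>2 * A + 8 * K\<^sup>2 * (b n n)\<^sup>2) ^ p"
      using A0 c K p by (intro mult_left_mono power_add_le_power_add) auto
    also have "\<dots> = (4 * (4 * c * K\<^sup>2 * A + 8 * K\<^sup>2 * (b n n)\<^sup>2)) ^ p"
      by (simp only: power_mult_distrib)
    also have "4 * (4 * c * K\<^sup>2 * A + 8 * K\<^sup>2 * (b n n)\<^sup>2) = 16 * c * K\<^sup>2 * A + 32 * K\<^sup>2 * (b n n)\<^sup>2"
      by (simp add: algebra_simps)
    also have "(16 * c * K\<^sup>2 * A + 32 * K\<^sup>2 * (b n n)\<^sup>2) ^ p \<le> D ^ p"
    proof (rule power_mono)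
      have "16 * (c * K\<^sup>2 * A) \<le> 32 * (c * K\<^sup>2 * A)" "1 * (K\<^sup>2 * (b n n)\<^sup>2) \<le> c * (K\<^sup>2 * (b n n)\<^sup>2)"
        using A0 c by (simp, intro mult_right_mono) auto
      then show "16 * c * K\<^sup>2 * A + 32 * K\<^sup>2 * (b n n)\<^sup>2 \<le> D" unfolding D_def by (simp add: algebra_simps)
    qed (use A0 c in auto)
    finally show ?thesis .
  qed
  have "integral\<^sup>L M (\<lambda>\<omega>. (?S \<omega> + ?d \<omega>) ^ (2 * p)) \<le> (F + mart_const p * D) ^ p"
  proof (rule moment_orthogonal_increment[OF M S d p])
    show "integral\<^sup>L M (\<lambda>\<omega>. ?S \<omega> ^ (2 * p)) \<le> F ^ p"
      unfolding F_def using insert.prems by (intro insert.IH) (auto intro: std_family_subset)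
    let ?s = "\<lambda>y. ((\<Sum>k\<in>I. \<Sum>l\<in>I. b k l * y k * y l) - (\<Sum>k\<in>I. b k k)) ^ (2 * p - 1)"
    let ?l = "\<lambda>y. 2 * (\<Sum>k\<in>I. b n k * y k)"
    have "expectation (\<lambda>\<omega>. (\<lambda>y. ?s y * ?l y) (\<lambda>i\<in>I. x i \<omega>) * (\<lambda>t. t) (x n \<omega>))
      = expectation (\<lambda>\<omega>. (\<lambda>y. ?s y * ?l y) (\<lambda>i\<in>I. x i \<omega>)) * expectation (\<lambda>\<omega>. (\<lambda>t. t) (x n \<omega>))"
      by (rule split) (auto intro!: am)
    then have 1: "expectation (\<lambda>\<omega>. ?S \<omega> ^ (2 * p - 1) * ?d1 \<omega>) = 0"
      using xn(1) by (simp add: mult.assoc)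
    have "expectation (\<lambda>\<omega>. ?s (\<lambda>i\<in>I. x i \<omega>) * (\<lambda>t. b n n * (t\<^sup>2 - 1)) (x n \<omega>))
      = expectation (\<lambda>\<omega>. ?s (\<lambda>i\<in>I. x i \<omega>)) * expectation (\<lambda>\<omega>. (\<lambda>t. b n n * (t\<^sup>2 - 1)) (x n \<omega>))"
      by (rule split) (auto intro!: am)
    moreover have "expectation (\<lambda>\<omega>. b n n * ((x n \<omega>)\<^sup>2 - 1)) = 0"
    proof -
      have "integrable M (\<lambda>\<omega>. (x n \<omega>)\<^sup>2)" by (intro int am) auto
      then show ?thesis using xn(2) by (simp add: prob_space)
    qed
    ultimately have 2: "expectation (\<lambda>\<omega>. ?S \<omega> ^ (2 * p - 1) * ?d2 \<omega>) = 0"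
      by simp
    have "expectation (\<lambda>\<omega>. ?S \<omega> ^ (2 * p - 1) * ?d \<omega>)
      = expectation (\<lambda>\<omega>. ?S \<omega> ^ (2 * p - 1) * ?d1 \<omega>) + expectation (\<lambda>\<omega>. ?S \<omega> ^ (2 * p - 1) * ?d2 \<omega>)"
      unfolding distrib_left
      by (intro Bochner_Integration.integral_add int all_moments_mult[OF all_moments_power[OF M S]] d1 d2)
    then show "expectation (\<lambda>\<omega>. ?S \<omega> ^ (2 * p - 1) * ?d \<omega>) = 0"
      unfolding 1 2 by simp
  qed (use F0 D0 d_moment in auto)
  also have "\<dots> \<le> (quad_const p K * (\<Sum>k\<in>insert n I. \<Sum>l\<in>insert n I. (b k l)\<^sup>2)) ^ p"
  proof (rule power_mono)
    have A': "(\<Sum>k\<in>I. (b k n)\<^sup>2) = A" unfolding A_def by (intro sum.cong) (auto simp: sym[of _ n])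
    have "(\<Sum>k\<in>insert n I. \<Sum>l\<in>insert n I. (b k l)\<^sup>2)
        = (b n n)\<^sup>2 + A + A + (\<Sum>k\<in>I. \<Sum>l\<in>I. (b k l)\<^sup>2)"
      using insert.hyps A' by (simp add: sum.distrib A_def)
    moreover have "mart_const p * D = quad_const p K * (A + (b n n)\<^sup>2)"
      by (simp add: D_def quad_const_def c_def power2_eq_square algebra_simps)
    \<comment> \<open>Row and column \<open>n\<close> each contribute \<open>A\<close> to the new
      double sum, while the increment is charged for it once; this is the surplus.\<close>
    moreover have "0 \<le> A * quad_const p K" using A0 quad_const_nonneg by auto
    ultimately show "F + mart_const p * D \<le> quad_const p K * (\<Sum>k\<in>insert n I. \<Sum>l\<in>insert n I. (b k l)\<^sup>2)"
      unfolding F_def by (simp add: algebra_simps)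
    show "0 \<le> F + mart_const p * D" using F0 D0 mart_const_ge_1[of p] by auto
  qed
  also have "(\<lambda>\<omega>. (?S \<omega> + ?d \<omega>) ^ (2 * p)) = (\<lambda>\<omega>. ((\<Sum>k\<in>insert n I. \<Sum>l\<in>insert n I. b k l * x k \<omega> * x l \<omega>)
      - (\<Sum>k\<in>insert n I. b k k)) ^ (2 * p))"
  proof
    fix \<omega>
    have 1: "(\<Sum>k\<in>I. b k n * x k \<omega> * x n \<omega>) = ?L \<omega> * x n \<omega>"
      unfolding sum_distrib_right by (intro sum.cong) (auto simp: sym[of _ n])
    have 2: "(\<Sum>k\<in>I. b n k * x n \<omega> * x k \<omega>) = ?L \<omega> * x n \<omega>"
      unfolding sum_distrib_right by (intro sum.cong) auto
    show "(?S \<omega> + ?d \<omega>) ^ (2 * p) = ((\<Sum>k\<in>insert n I. \<Sum>l\<in>insert n I. b k l * x k \<omega> * x l \<omega>)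
      - (\<Sum>k\<in>insert n I. b k k)) ^ (2 * p)"
      using insert.hyps 1 2 by (simp add: sum.distrib algebra_simps power2_eq_square)
  qed
  finally show ?case .
qed

subsection \<open>The Stieltjes transform of the semicircle law\<close>

lemma of_real_norm_power2: "(complex_of_real (cmod u))\<^sup>2 = u * cnj u"
  by (metis complex_norm_square of_real_power)

text \<open>The roots have product 1 and sum \<open>-z\<close>. A root on the unit circle would make
  the other its conjugate and \<open>z\<close> real, so exactly one lies inside the disc, and there
  \<open>Im w * (1 / |w|^2 - 1) = Im z\<close>. Selecting the root by modulus avoids fixing a branch
  of the square root.\<close>

lemma quadratic_unit_disc_root:
  fixes z :: complex
  assumes "Im z > 0"
  obtains w where "w\<^sup>2 + z * w + 1 = 0" "cmod w < 1" "Im w > 0"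
proof -
  note root = that
  obtain s where s: "s\<^sup>2 = z\<^sup>2 - 4" using power2_csqrt by blast
  define u v where "u = (- z + s) / 2" and "v = (- z - s) / 2"
  have uv: "u * v = 1" "u + v = - z"
    using s by (auto simp: u_def v_def field_simps power2_eq_square)
  have no1: "cmod w \<noteq> 1" if "w * w' = 1" "w + w' = - z" for w w'
  proof
    assume 1: "cmod w = 1"
    then have "w' = cnj w" using that(1) complex_div_cnj[of 1 w]
      by (metis complex_norm_square mult.commute mult_cancel_left of_real_1 one_power2 mult_zero_left zero_neq_one)
    then have "Im (w + w') = 0" by simp
    then show False using that(2) assms by simp
  qed
  have key: thesis if w: "w * w' = 1" "w + w' = - z" "cmod w < 1" for w w'
  proof (rule root)
    have w0: "w \<noteq> 0" using w(1) by auto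
    have "w\<^sup>2 - (w + w') * w + w * w' = 0" by (simp add: power2_eq_square algebra_simps)
    then show "w\<^sup>2 + z * w + 1 = 0" unfolding w(1,2) by simp
    have "w' = cnj w / (cmod w)\<^sup>2" using w(1) w0 by (simp add: of_real_norm_power2 divide_simps mult.commute)
    then have "Im w' = - Im w / (cmod w)\<^sup>2" by (simp add: Im_divide_of_real flip: of_real_power)
    moreover have "Im w + Im w' = - Im z" using arg_cong[OF w(2), of Im] by simp
    ultimately have "Im w * (1 / (cmod w)\<^sup>2 - 1) = Im z" by (simp add: algebra_simps)
    moreover have "1 / (cmod w)\<^sup>2 - 1 > 0" using w(3) w0 by (simp add: power_less_one_iff field_simps)
    ultimately show "Im w > 0" using assms by (metis zero_less_mult_pos2)
    show "cmod w < 1" by fact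
  qed
  have "cmod u * cmod v = 1" using uv by (metis norm_mult norm_one)
  then have "cmod u < 1 \<or> cmod v < 1"
    using no1[OF uv] by (smt (verit) mult_le_one mult_less_cancel_left2 norm_ge_zero mult_mono)
  then show thesis using key[of u v] key[of v u] uv by (auto simp: mult.commute add.commute)
qed

text \<open>Mean value property on the unit circle: \<open>1 / (1 + w * u)\<close> is holomorphic on
  the closed disc and equals 1 at the centre.\<close>

lemma integral_circle_geometric:
  fixes w :: complex
  assumes "cmod w < 1"
  shows "((\<lambda>t. 1 / (1 + w * exp (\<i> * of_real t))) has_integral of_real (2 * pi)) {0..2 * pi}"
proof -
  have nz: "1 + w * u \<noteq> 0" if "cmod u \<le> 1" for u
  proof
    assume "1 + w * u = 0"
    then have "w * u = - 1" by (simp add: add_eq_0_iff)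
    then have "cmod w * cmod u = 1" by (metis norm_minus_cancel norm_mult norm_one)
    then show False using that assms by (smt (verit) mult_left_le norm_ge_zero)
  qed
  have "((\<lambda>u. (1 / (1 + w * u)) / (u - 0)) has_contour_integral (2 * of_real pi * \<i> * (1 / (1 + w * 0)))) (circlepath 0 1)"
  proof (rule Cauchy_integral_circlepath_simple)
    show "(\<lambda>u. 1 / (1 + w * u)) holomorphic_on cball 0 1"
      by (intro holomorphic_intros) (simp add: nz)
  qed auto
  then have "((\<lambda>t. (1 / (1 + w * exp (\<i> * of_real t))) / exp (\<i> * of_real t) * \<i> * exp (\<i> * of_real t))
      has_integral (2 * of_real pi * \<i>)) {0..2 * pi}"
    by (simp add: circlepath_def has_contour_integral_part_circlepath_iff cis_conv_exp mult_ac)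
  then have "((\<lambda>t. \<i> * (1 / (1 + w * exp (\<i> * of_real t)))) has_integral (\<i> * of_real (2 * pi))) {0..2 * pi}"
    by (simp add: mult_ac)
  from has_integral_mult_right[OF this, of "- \<i>"] show ?thesis
    by (simp add: mult.assoc[symmetric])
qed


text \<open>For \<open>z = - (w + 1/w)\<close> the integrand is \<open>w\<close> times the Poisson kernel of \<open>- w\<close>.\<close>

lemma integral_cos_Poisson:
  fixes w z :: complex
  assumes w: "cmod w < 1" and q: "w\<^sup>2 + z * w + 1 = 0"
  shows "((\<lambda>t. (1 - w\<^sup>2) / (2 * of_real (cos t) - z)) has_integral of_real (2 * pi) * w) {0..2 * pi}"
proof -
  have w0: "w \<noteq> 0" using q by auto
  \<comment> \<open>Conjugating the integral for \<open>cnj w\<close> leaves \<open>w\<close> in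
    place and conjugates the exponential.\<close>
  have "((\<lambda>t. cnj (1 / (1 + cnj w * exp (\<i> * of_real t)))) has_integral cnj (of_real (2 * pi))) {0..2 * pi}"
    using integral_circle_geometric[of "cnj w"] w
    by (intro has_integral_linear[unfolded o_def, OF _ bounded_linear_cnj]) simp
  then have conj: "((\<lambda>t. 1 / (1 + w * cnj (exp (\<i> * of_real t)))) has_integral of_real (2 * pi)) {0..2 * pi}"
    by simp
  have "((\<lambda>t. w * (1 / (1 + w * exp (\<i> * of_real t)) + 1 / (1 + w * cnj (exp (\<i> * of_real t))) - 1))
      has_integral w * (of_real (2 * pi) + of_real (2 * pi) - (2 * pi - 0) *\<^sub>R 1)) {0..2 * pi}"
    by (intro has_integral_mult_right has_integral_diff has_integral_add conj
          integral_circle_geometric[OF w] has_integral_const_real[THEN has_integral_eq_rhs]) auto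
  moreover have "w * (1 / (1 + w * u) + 1 / (1 + w * cnj u) - 1) = (1 - w\<^sup>2) / (2 * of_real (cos t) - z)"
    if u: "u = exp (\<i> * of_real t)" for u t
  proof -
    have uu: "u * cnj u = 1" unfolding u by (simp flip: of_real_norm_power2)
    have us: "u + cnj u = 2 * of_real (cos t)"
      unfolding u cis_conv_exp[symmetric] by (simp add: complex_eq_iff)
    have nz: "1 + w * v \<noteq> 0" if "cmod v = 1" for v
    proof
      assume "1 + w * v = 0"
      then have "w * v = - 1" by (simp add: add_eq_0_iff)
      then have "cmod w * cmod v = 1" by (metis norm_minus_cancel norm_mult norm_one)
      then show False using that w by simp
    qed
    have n1: "1 + w * u \<noteq> 0" "1 + w * cnj u \<noteq> 0" by (auto intro!: nz simp: u)
    have prod: "(1 + w * u) * (1 + w * cnj u) = w * (2 * of_real (cos t) - z)"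
    proof -
      have "(1 + w * u) * (1 + w * cnj u) = 1 + w * (u + cnj u) + w\<^sup>2 * (u * cnj u)"
        by (simp add: power2_eq_square algebra_simps)
      also have "\<dots> = (w\<^sup>2 + z * w + 1) + w * (2 * of_real (cos t) - z)"
        unfolding us uu by (simp add: algebra_simps)
      finally show ?thesis using q by simp
    qed
    have "1 / (1 + w * u) + 1 / (1 + w * cnj u) - 1 = (1 - w\<^sup>2 * (u * cnj u)) / ((1 + w * u) * (1 + w * cnj u))"
      using n1 by (simp add: divide_simps power2_eq_square) (simp add: algebra_simps)
    also have "w * \<dots> = (1 - w\<^sup>2) / (2 * of_real (cos t) - z)"
      unfolding prod uu using w0 by simp
    finally show ?thesis .
  qed
  ultimately show ?thesis
    by (simp add: algebra_simps scaleR_conv_of_real)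
qed

text \<open>Substitute \<open>x = 2 cos t\<close> and use
  \<open>4 sin\<^sup>2 t / (2 cos t - z) = - 2 cos t - z + (4 - z\<^sup>2) / (2 cos t - z)\<close>.\<close>

lemma msc_eq_root:
  assumes z: "Im z > 0" and w: "cmod w < 1" and q: "w\<^sup>2 + z * w + 1 = 0"
  shows "msc z = w"
proof -
  have w0: "w \<noteq> 0" using q by auto
  have w1: "1 - w\<^sup>2 \<noteq> 0"
    using w by (metis abs_norm_cancel norm_one norm_power power_less_one_iff abs_square_less_1 less_irrefl eq_iff_diff_eq_0)
  have nz: "2 * of_real (cos t) - z \<noteq> 0" for t :: real
    using z by (auto simp: complex_eq_iff)
  define f where "f x = 1 / (of_real x - z) * of_real (sqrt (4 - x\<^sup>2) / (2 * pi))" for x :: real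
  have cont: "continuous_on {-2..2} f"
    unfolding f_def using z by (intro continuous_intros) (auto simp: complex_eq_iff)
  have "msc z = integral {-2..2} f"
    unfolding msc_def f_def[symmetric]
    by (rule set_borel_integral_eq_integral(2)) (rule borel_integrable_atLeastAtMost'[OF cont])
  \<comment> \<open>The substitution is made with \<open>x = - 2 * cos t\<close>, which increases on
    \<open>{0..pi}\<close>; the reflection \<open>t \<mapsto> pi - t\<close> then restores
    \<open>2 * cos t\<close>.\<close>
  moreover have sub: "((\<lambda>t. (2 * sin t) *\<^sub>R f (- 2 * cos t)) has_integral integral {-2..2} f) {0..pi}"
  proof -
    have "((\<lambda>t. (2 * sin t) *\<^sub>R f (- 2 * cos t)) has_integral integral {- 2 * cos 0..- 2 * cos pi} f) {0..pi}"
      by (rule has_integral_substitution[where c = "-2" and d = 2])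
         (use cont in \<open>auto intro!: derivative_eq_intros simp: abs_le_iff minus_le_iff\<close>)
    then show ?thesis by simp
  qed
  let ?P = "\<lambda>t. of_real (4 * (sin t)\<^sup>2) / (2 * of_real (cos t) - z) :: complex"
  have ref: "((\<lambda>t. (2 * sin t) *\<^sub>R f (2 * cos t)) has_integral integral {-2..2} f) {0..pi}"
  proof -
    have "((\<lambda>t. (2 * sin (pi - t)) *\<^sub>R f (- 2 * cos (pi - t))) has_integral integral {-2..2} f) {0..pi}"
      using has_integral_affinity[of _ _ 0 pi "-1" pi, OF sub[unfolded cbox_interval[symmetric]]]
      by (simp add: image_affinity_atLeastAtMost cbox_interval)
    then show ?thesis by simp
  qed
  have half: "((\<lambda>t. of_real (2 * pi) * ((2 * sin t) *\<^sub>R f (2 * cos t))) has_integral of_real (2 * pi) * msc z) {0..pi}"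
    using has_integral_mult_right[OF ref] \<open>msc z = _\<close> by simp
  have P: "of_real (2 * pi) * ((2 * sin t) *\<^sub>R f (2 * cos t)) = ?P t" if "t \<in> {0..pi}" for t
  proof -
    have "sin t \<ge> 0" using that by (auto intro: sin_ge_zero)
    moreover have "4 - (2 * cos t)\<^sup>2 = (2 * sin t)\<^sup>2"
      by (simp add: power_mult_distrib sin_squared_eq)
    ultimately have "sqrt (4 - (2 * cos t)\<^sup>2) = 2 * sin t" by (simp add: real_sqrt_unique)
    then show ?thesis unfolding f_def
      by (simp add: scaleR_conv_of_real power2_eq_square)
  qed
  have h1: "(?P has_integral of_real (2 * pi) * msc z) {0..pi}"
    using half by (rule has_integral_eq[rotated]) (rule P)
  \<comment> \<open>The integrand is invariant under \<open>t \<mapsto> 2 * pi - t\<close>, so the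
    integral over the full circle, where the Poisson integral applies, is twice that over the half
    circle.\<close>
  have h2: "(?P has_integral of_real (2 * pi) * msc z) {pi..2 * pi}"
  proof -
    have "((\<lambda>t. ?P (2 * pi - t)) has_integral of_real (2 * pi) * msc z) {pi..2 * pi}"
      using has_integral_affinity[of _ _ 0 pi "-1" "2 * pi", OF h1[unfolded cbox_interval[symmetric]]]
      by (simp add: image_affinity_atLeastAtMost cbox_interval)
    then show ?thesis by simp
  qed
  have lhs: "(?P has_integral of_real (4 * pi) * msc z) {0..2 * pi}"
    using has_integral_combine[OF _ _ h1 h2] by (simp add: algebra_simps)
  have c0: "((\<lambda>t. of_real (cos t) :: complex) has_integral 0) {0..2 * pi}"
  proof -
    have "(cos has_integral (sin (2 * pi) - sin 0)) {0..2 * pi}"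
      by (rule fundamental_theorem_of_calculus)
         (auto intro!: derivative_eq_intros simp flip: has_real_derivative_iff_has_vector_derivative)
    then have "(cos has_integral 0) {0..2 * pi}" by simp
    from has_integral_linear[OF this bounded_linear_of_real[where 'a = complex]] show ?thesis
      by (simp add: o_def)
  qed
  have "((\<lambda>t. - 2 * of_real (cos t) - z + ((4 - z\<^sup>2) / (1 - w\<^sup>2)) * ((1 - w\<^sup>2) / (2 * of_real (cos t) - z)))
      has_integral - 2 * 0 - (2 * pi - 0) *\<^sub>R z + ((4 - z\<^sup>2) / (1 - w\<^sup>2)) * (of_real (2 * pi) * w)) {0..2 * pi}"
    by (intro has_integral_add has_integral_diff has_integral_mult_right c0 integral_cos_Poisson[OF w q]
        has_integral_const_real[THEN has_integral_eq_rhs]) auto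
  moreover have "- 2 * of_real (cos t) - z + ((4 - z\<^sup>2) / (1 - w\<^sup>2)) * ((1 - w\<^sup>2) / (2 * of_real (cos t) - z)) = ?P t" for t
  proof -
    have s: "of_real (4 * (sin t)\<^sup>2) = 4 - (2 * of_real (cos t) :: complex)\<^sup>2"
      by (simp add: power_mult_distrib sin_squared_eq)
    show ?thesis unfolding s using w1 nz[of t]
      by (simp add: divide_simps power2_eq_square) (simp add: algebra_simps)
  qed
  ultimately have "(?P has_integral - (2 * pi) *\<^sub>R z + ((4 - z\<^sup>2) / (1 - w\<^sup>2)) * (of_real (2 * pi) * w)) {0..2 * pi}"
    by simp
  from has_integral_unique[OF lhs this]
  have "of_real (2 * pi) * (2 * msc z) = of_real (2 * pi) * (- z + ((4 - z\<^sup>2) / (1 - w\<^sup>2)) * w)"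
    by (simp add: scaleR_conv_of_real algebra_simps)
  then have e: "2 * msc z = - z + ((4 - z\<^sup>2) / (1 - w\<^sup>2)) * w"
    by (subst (asm) mult_cancel_left) simp
  \<comment> \<open>With \<open>z = - (w + 1 / w)\<close> one has
    \<open>4 - z^2 = - (w - 1 / w)^2\<close>, and the right-hand side of \<open>e\<close> collapses
    to \<open>2 * w\<close>. Multiplying by \<open>w\<close> avoids the reciprocals.\<close>
  have zw: "z * w = - (1 + w\<^sup>2)" using q by (simp add: algebra_simps eq_neg_iff_add_eq_0)
  have "(4 - z\<^sup>2) * w\<^sup>2 = 4 * w\<^sup>2 - (z * w)\<^sup>2" by (simp add: algebra_simps power_mult_distrib)
  also have "\<dots> = - (1 - w\<^sup>2)\<^sup>2" unfolding zw by (simp add: power2_eq_square algebra_simps)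
  finally have "((4 - z\<^sup>2) / (1 - w\<^sup>2)) * w\<^sup>2 = - (1 - w\<^sup>2)"
    using w1 by (simp add: power2_eq_square)
  then have "w * (2 * msc z) = w * (2 * w)"
  proof -
    assume *: "((4 - z\<^sup>2) / (1 - w\<^sup>2)) * w\<^sup>2 = - (1 - w\<^sup>2)"
    have "w * (2 * msc z) = - (z * w) + ((4 - z\<^sup>2) / (1 - w\<^sup>2)) * w\<^sup>2"
      unfolding e by (simp only: power2_eq_square distrib_left mult_minus_right mult_ac)
    then show ?thesis unfolding * zw by (simp add: power2_eq_square)
  qed
  then show ?thesis using w0 by simp
qed

lemma
  assumes "Im z > 0"
  shows msc_quadratic: "(msc z)\<^sup>2 + z * msc z + 1 = 0"
    and norm_msc_less_1: "cmod (msc z) < 1"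
    and Im_msc_pos: "Im (msc z) > 0"
proof -
  obtain w where "w\<^sup>2 + z * w + 1 = 0" "cmod w < 1" "Im w > 0"
    using quadratic_unit_disc_root[OF assms] .
  then show "(msc z)\<^sup>2 + z * msc z + 1 = 0" "cmod (msc z) < 1" "Im (msc z) > 0"
    using msc_eq_root[OF assms] by auto
qed

text \<open>The real part of \<open>|m|\<^sup>2 m + |m|\<^sup>2 z + cnj m = 0\<close> gives, with \<open>E = Re z\<close>,
  \<open>(Im m)\<^sup>2 = |m|\<^sup>2 - E\<^sup>2|m|\<^sup>4/(1 + |m|\<^sup>2)\<^sup>2 \<ge> |m|\<^sup>2 (1 - E\<^sup>2/4)\<close>, and \<open>|m| = 1/|z + m| \<ge> 1/4\<close>.\<close>

lemma Im_msc_bulk: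
  assumes z: "Im z > 0" "Im z \<le> 1" and E: "\<bar>Re z\<bar> \<le> 2 - \<kappa>" and k: "\<kappa> > 0"
  shows "Im (msc z) \<ge> sqrt (\<kappa> / 32)"
proof -
  define m where "m = msc z"
  define s where "s = (cmod m)\<^sup>2"
  have q: "m\<^sup>2 + z * m + 1 = 0" and m1: "cmod m < 1" and mp: "Im m > 0"
    using msc_quadratic norm_msc_less_1 Im_msc_pos z(1) by (auto simp: m_def)
  have m0: "m \<noteq> 0" using q by auto
  have s0: "s > 0" using m0 by (simp add: s_def)
  have s1: "s < 1" using m1 by (simp add: s_def power_less_one_iff)
  have "cnj m * (m\<^sup>2 + z * m + 1) = of_real s * m + z * of_real s + cnj m"
    unfolding s_def of_real_power of_real_norm_power2
    by (simp add: algebra_simps power2_eq_square)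
  then have "of_real s * m + z * of_real s + cnj m = 0" using q by simp
  from arg_cong[OF this, of Re] have re: "Re m * (1 + s) = - Re z * s" by (simp add: algebra_simps)
  have sab: "s = (Re m)\<^sup>2 + (Im m)\<^sup>2" by (simp add: s_def cmod_power2)
  have "(Re m)\<^sup>2 * (1 + s)\<^sup>2 = (Re z)\<^sup>2 * s\<^sup>2" using arg_cong[OF re, of "\<lambda>x. x\<^sup>2"] by (simp add: power_mult_distrib)
  \<comment> \<open>This is \<open>4 * s \<le> (1 + s)^2\<close>, the source of the factor 1/4 in
    front of the squared energy.\<close>
  moreover have "(2 * s) * (2 * s) \<le> s * (1 + s)\<^sup>2"
    using s0 mult_left_mono[OF zero_le_power2[of "1 - s"], of s] by (simp add: power2_eq_square algebra_simps)
  ultimately have "4 * (Re m)\<^sup>2 * (1 + s)\<^sup>2 \<le> (Re z)\<^sup>2 * s * (1 + s)\<^sup>2"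
    using mult_left_mono[of "(2 * s) * (2 * s)" "s * (1 + s)\<^sup>2" "(Re z)\<^sup>2"] by (simp add: power2_eq_square algebra_simps)
  then have Re_le: "4 * (Re m)\<^sup>2 \<le> (Re z)\<^sup>2 * s" using s0 by (simp add: zero_less_power)
  have k2: "\<kappa> \<le> 2" using E by linarith
  have "(Re z)\<^sup>2 \<le> (2 - \<kappa>)\<^sup>2" using E by (simp add: abs_le_square_iff[symmetric])
  also have "\<dots> \<le> 4 - 2 * \<kappa>" using k k2 mult_left_mono[of \<kappa> 2 \<kappa>] by (simp add: power2_eq_square algebra_simps)
  finally have "(Re z)\<^sup>2 * s \<le> (4 - 2 * \<kappa>) * s" using s0 by (intro mult_right_mono) auto
  then have im: "(Im m)\<^sup>2 \<ge> \<kappa> / 2 * s" using Re_le sab by (simp add: algebra_simps)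
  \<comment> \<open>Here |z| \<le> 3 and |m| < 1 give |z + m| \<le> 4, hence
    \<open>s \<ge> 1 / 16\<close>; together with the factor \<open>\<kappa> / 2\<close> this
    produces \<open>\<kappa> / 32\<close>.\<close>
  have "cmod z \<le> \<bar>Re z\<bar> + \<bar>Im z\<bar>" by (rule cmod_le)
  then have zn: "cmod z \<le> 3" using E z k by linarith
  have "m * (z + m) = - 1" using q by (simp add: power2_eq_square algebra_simps eq_neg_iff_add_eq_0)
  then have "cmod m * cmod (z + m) = 1" by (metis norm_minus_cancel norm_mult norm_one)
  moreover have "cmod (z + m) \<le> 4" using norm_triangle_ineq[of z m] zn m1 by linarith
  ultimately have "1 \<le> cmod m * 4" by (metis mult_left_mono norm_ge_zero)
  then have "(1 / 4)\<^sup>2 \<le> s" unfolding s_def by (intro power_mono) auto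
  then have "\<kappa> / 32 \<le> \<kappa> / 2 * s" using k by (simp add: power2_eq_square field_simps)
  then have "\<kappa> / 32 \<le> (Im m)\<^sup>2" using im by linarith
  then show ?thesis using mp by (simp add: m_def real_le_lsqrt real_sqrt_le_iff)
qed

subsection \<open>Resolvents and minors\<close>

lemma Im_le_cmod: "Im z \<le> cmod z"
  using abs_Im_le_cmod[of z] by linarith

text \<open>Minors are kept at full size: deleting row and column \<open>i\<close> becomes setting them to zero, which
  only adds the isolated entry \<open>-1/z\<close> to the resolvent.\<close>

definition zero_out :: "nat \<Rightarrow> real mat \<Rightarrow> real mat" where
  "zero_out i h = mat (dim_row h) (dim_row h) (\<lambda>(k, l). if k = i \<or> l = i then 0 else h $$ (k, l))"

section \<open>Entries of the resolvent and the Ward identity\<close>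

locale resolvent_setup =
  fixes N :: nat and h :: "real mat" and z :: complex
  assumes h: "h \<in> carrier_mat N N" and sym: "transpose_mat h = h" and z: "Im z > 0"
begin

definition a :: "nat \<Rightarrow> nat \<Rightarrow> complex" where
  "a k l = of_real (h $$ (k, l)) - (if k = l then z else 0)"

definition G :: "nat \<Rightarrow> nat \<Rightarrow> complex" where
  "G k l = resolvent h z $$ (k, l)"

abbreviation A :: "complex mat" where
  "A \<equiv> map_mat complex_of_real h - z \<cdot>\<^sub>m 1\<^sub>m (dim_row h)"

lemma A_carrier: "A \<in> carrier_mat N N"
  using h by auto

lemma A_entry: "k < N \<Longrightarrow> l < N \<Longrightarrow> A $$ (k, l) = a k l"
  using h by (auto simp: a_def)

lemma h_sym: "k < N \<Longrightarrow> l < N \<Longrightarrow> h $$ (k, l) = h $$ (l, k)"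
  using sym h by (metis carrier_matD index_transpose_mat(1))

lemma a_sym: "k < N \<Longrightarrow> l < N \<Longrightarrow> a k l = a l k"
  using h_sym[of k l] by (auto simp: a_def)

text \<open>The form of a real symmetric matrix is real on complex vectors, so only
  \<open>-z\<close> contributes to the imaginary part. With \<open>u = 0\<close> this yields
  invertibility, with \<open>u\<close> a unit vector the Ward identity.\<close>

lemma Im_quadratic_form:
  assumes "\<And>k. k < N \<Longrightarrow> (\<Sum>l<N. a k l * v l) = u k"
  shows "Im (\<Sum>k<N. cnj (v k) * u k) = - Im z * (\<Sum>k<N. (cmod (v k))\<^sup>2)"
proof -
  define S where "S = (\<Sum>k<N. \<Sum>l<N. of_real (h $$ (k, l)) * (cnj (v k) * v l))"
  have "cnj S = (\<Sum>k<N. \<Sum>l<N. of_real (h $$ (k, l)) * (v k * cnj (v l)))"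
    by (simp add: S_def)
  also have "\<dots> = (\<Sum>l<N. \<Sum>k<N. of_real (h $$ (k, l)) * (v k * cnj (v l)))"
    by (rule sum.swap)
  also have "\<dots> = S"
    unfolding S_def by (intro sum.cong refl) (auto simp: h_sym mult.commute)
  finally have S: "Im S = 0" by (simp add: complex_eq_iff)
  have "(\<Sum>k<N. cnj (v k) * u k) = (\<Sum>k<N. cnj (v k) * (\<Sum>l<N. a k l * v l))"
    by (intro sum.cong refl) (simp add: assms)
  also have "\<dots> = (\<Sum>k<N. (\<Sum>l<N. of_real (h $$ (k, l)) * (cnj (v k) * v l)) - z * (cnj (v k) * v k))"
  proof (intro sum.cong refl)
    fix k assume k: "k \<in> {..<N}"
    have "(\<Sum>l<N. a k l * v l) = (\<Sum>l<N. of_real (h $$ (k, l)) * v l - (if k = l then z * v l else 0))"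
      by (intro sum.cong refl) (simp add: a_def algebra_simps)
    also have "\<dots> = (\<Sum>l<N. of_real (h $$ (k, l)) * v l) - z * v k"
      using k by (simp add: sum_subtractf)
    finally show "cnj (v k) * (\<Sum>l<N. a k l * v l)
        = (\<Sum>l<N. of_real (h $$ (k, l)) * (cnj (v k) * v l)) - z * (cnj (v k) * v k)"
      by (simp add: right_diff_distrib sum_distrib_left mult_ac)
  qed
  also have "\<dots> = S - z * (\<Sum>k<N. cnj (v k) * v k)"
    by (simp add: S_def sum_subtractf sum_distrib_left)
  also have "(\<Sum>k<N. cnj (v k) * v k) = of_real (\<Sum>k<N. (cmod (v k))\<^sup>2)"
    unfolding of_real_sum by (intro sum.cong refl) (simp only: complex_norm_square mult.commute)
  finally show ?thesis using S by simp
qed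

lemma det_nonzero: "Determinant.det A \<noteq> 0"
proof
  assume "Determinant.det A = 0"
  then obtain v where v: "v \<in> carrier_vec N" "v \<noteq> 0\<^sub>v N" "A *\<^sub>v v = 0\<^sub>v N"
    using det_0_iff_vec_prod_zero[OF A_carrier] by auto
  have "(\<Sum>l<N. a k l * (v $ l)) = 0" if k: "k < N" for k
  proof -
    have "0 = (A *\<^sub>v v) $ k" using v k by simp
    also have "\<dots> = row A k \<bullet> v" using A_carrier k by (intro index_mult_mat_vec) auto
    also have "\<dots> = (\<Sum>l<N. A $$ (k, l) * (v $ l))"
      using v(1) A_carrier k h unfolding scalar_prod_def by (auto simp: atLeast0LessThan intro!: sum.cong)
    also have "\<dots> = (\<Sum>l<N. a k l * (v $ l))" using k by (intro sum.cong) (auto simp: A_entry)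
    finally show ?thesis by simp
  qed
  from Im_quadratic_form[of "\<lambda>l. v $ l" "\<lambda>_. 0", OF this] have "(\<Sum>k<N. (cmod (v $ k))\<^sup>2) = 0"
    using z by simp
  then have "\<forall>k\<in>{..<N}. (cmod (v $ k))\<^sup>2 = 0" by (subst (asm) sum_nonneg_eq_0_iff) auto
  then have "v = 0\<^sub>v N" using v(1) by (intro eq_vecI) auto
  with v(2) show False by simp
qed

lemma resolvent_inverse:
  shows "A * resolvent h z = 1\<^sub>m N" "resolvent h z * A = 1\<^sub>m N" "resolvent h z \<in> carrier_mat N N"
proof -
  have "mat_inverse A \<noteq> None"
    using mat_inverse(1)[OF A_carrier, of "()"] det_non_zero_imp_unit[OF A_carrier det_nonzero, of "()"] by auto
  then obtain B where B: "mat_inverse A = Some B" by auto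
  then have "resolvent h z = B" unfolding resolvent_def by simp
  then show "A * resolvent h z = 1\<^sub>m N" "resolvent h z * A = 1\<^sub>m N" "resolvent h z \<in> carrier_mat N N"
    using mat_inverse(2)[OF A_carrier B] by auto
qed

lemma mult_entry:
  fixes X Y :: "complex mat"
  assumes "X \<in> carrier_mat N N" "Y \<in> carrier_mat N N" "k < N" "j < N"
  shows "(X * Y) $$ (k, j) = (\<Sum>l<N. X $$ (k, l) * Y $$ (l, j))"
  using assms by (auto simp: scalar_prod_def atLeast0LessThan)

lemma a_G:
  assumes "k < N" "j < N"
  shows "(\<Sum>l<N. a k l * G l j) = (if k = j then 1 else 0)"
proof -
  have "(\<Sum>l<N. a k l * G l j) = (\<Sum>l<N. A $$ (k, l) * resolvent h z $$ (l, j))"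
    using assms(1) by (intro sum.cong refl arg_cong2[of _ _ _ _ "(*)"] A_entry[symmetric] G_def) auto
  also have "\<dots> = (if k = j then 1 else 0)"
    unfolding mult_entry[OF A_carrier resolvent_inverse(3) assms, symmetric] resolvent_inverse(1)
    using assms by simp
  finally show ?thesis .
qed

lemma G_a:
  assumes "k < N" "j < N"
  shows "(\<Sum>l<N. G k l * a l j) = (if k = j then 1 else 0)"
proof -
  have "(\<Sum>l<N. G k l * a l j) = (\<Sum>l<N. resolvent h z $$ (k, l) * A $$ (l, j))"
    using assms(2) by (intro sum.cong refl arg_cong2[of _ _ _ _ "(*)"] A_entry[symmetric] G_def) auto
  also have "\<dots> = (if k = j then 1 else 0)"
    unfolding mult_entry[OF resolvent_inverse(3) A_carrier assms, symmetric] resolvent_inverse(2)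
    using assms by simp
  finally show ?thesis .
qed

lemma solution_unique:
  assumes "\<And>k. k < N \<Longrightarrow> (\<Sum>l<N. a k l * v l) = u k" and k: "k < N"
  shows "v k = (\<Sum>l<N. G k l * u l)"
proof -
  have "(\<Sum>l<N. G k l * u l) = (\<Sum>l<N. \<Sum>m<N. G k l * a l m * v m)"
    by (intro sum.cong refl) (simp add: assms(1)[symmetric] sum_distrib_left mult.assoc)
  also have "\<dots> = (\<Sum>m<N. (\<Sum>l<N. G k l * a l m) * v m)"
    by (subst sum.swap) (simp add: sum_distrib_right)
  also have "\<dots> = (\<Sum>m<N. (if k = m then 1 else 0) * v m)"
    using k by (intro sum.cong refl) (simp add: G_a)
  also have "\<dots> = v k" using k by (simp add: mult_delta_left)
  finally show ?thesis ..
qed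

text \<open>The device by which resolvent entries are identified from here on: a candidate column is
  checked against the linear system, without further matrix algebra.\<close>

lemma solution_unique_delta:
  assumes "\<And>k. k < N \<Longrightarrow> (\<Sum>l<N. a k l * v l) = (if k = j then 1 else 0)" and k: "k < N" and j: "j < N"
  shows "v k = G k j"
proof -
  have "v k = (\<Sum>l<N. G k l * (if l = j then 1 else 0))"
    by (rule solution_unique[OF assms(1) k])
  also have "\<dots> = G k j" using j by (simp add: mult_delta_right)
  finally show ?thesis .
qed

lemma G_sym:
  assumes "k < N" "j < N"
  shows "G j k = G k j"
proof (rule solution_unique_delta[where v = "G j"])
  fix k assume k: "k < N"
  have "(\<Sum>l<N. a k l * G j l) = (\<Sum>l<N. G j l * a l k)"
    using k by (intro sum.cong refl) (simp add: a_sym mult.commute)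
  also have "\<dots> = (if k = j then 1 else 0)" using G_a[of j k] k assms by auto
  finally show "(\<Sum>l<N. a k l * G j l) = (if k = j then 1 else 0)" .
qed (use assms in auto)

text \<open>Column \<open>j\<close> of \<open>G\<close> is the solution with right-hand side the
  \<open>j\<close>-th unit vector; the quadratic form then reduces to the conjugate of
  \<open>G j j\<close>.\<close>

lemma Ward:
  assumes j: "j < N"
  shows "(\<Sum>k<N. (cmod (G k j))\<^sup>2) = Im (G j j) / Im z"
proof -
  have "Im (\<Sum>k<N. cnj (G k j) * (if k = j then 1 else 0)) = - Im z * (\<Sum>k<N. (cmod (G k j))\<^sup>2)"
    using j by (intro Im_quadratic_form a_G)
  then have "- Im (G j j) = - Im z * (\<Sum>k<N. (cmod (G k j))\<^sup>2)"
    using j by (simp add: mult_delta_right)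
  then show ?thesis using z by (simp add: field_simps)
qed

lemma Im_G_nonneg:
  assumes "j < N"
  shows "Im (G j j) \<ge> 0"
proof -
  have "0 \<le> Im (G j j) / Im z" unfolding Ward[OF assms, symmetric] by (intro sum_nonneg) auto
  then show ?thesis using z by (simp add: zero_le_divide_iff)
qed

lemma norm_G_diag_le:
  assumes j: "j < N"
  shows "cmod (G j j) \<le> 1 / Im z"
proof -
  have "(cmod (G j j))\<^sup>2 \<le> (\<Sum>k<N. (cmod (G k j))\<^sup>2)"
    using j by (intro member_le_sum) auto
  also have "\<dots> \<le> cmod (G j j) / Im z"
    unfolding Ward[OF j] using z by (intro divide_right_mono) (auto intro: Im_le_cmod)
  finally have "cmod (G j j) * (cmod (G j j) * Im z) \<le> cmod (G j j) * 1"
    using z by (simp add: power2_eq_square field_simps)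
  then show ?thesis using z by (cases "G j j = 0") (auto simp: field_simps)
qed

lemma sum_norm_G_le:
  assumes j: "j < N"
  shows "(\<Sum>k<N. (cmod (G k j))\<^sup>2) \<le> 1 / (Im z)\<^sup>2"
proof -
  have "Im (G j j) / Im z \<le> (1 / Im z) / Im z"
    using z norm_G_diag_le[OF j] Im_le_cmod[of "G j j"] by (intro divide_right_mono) auto
  then show ?thesis unfolding Ward[OF j] by (simp add: power2_eq_square)
qed

lemma ntr_resolvent: "ntr (resolvent h z) = (\<Sum>k<N. G k k) / of_nat N"
  using resolvent_inverse(3) by (auto simp: ntr_def G_def)

lemma Im_ntr_nonneg: "Im (ntr (resolvent h z)) \<ge> 0"
  unfolding ntr_resolvent by (auto simp: Im_divide_of_nat intro!: divide_nonneg_nonneg sum_nonneg Im_G_nonneg)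

lemma resolvent_setup_zero_out: "resolvent_setup N (zero_out i h) z"
  using h sym z by unfold_locales (auto simp: zero_out_def intro!: eq_matI h_sym)

end

section \<open>Deleting a row: Schur complement and comparison of traces\<close>

locale resolvent_minor = resolvent_setup +
  fixes i :: nat
  assumes i: "i < N"
begin

sublocale minor: resolvent_setup N "zero_out i h" z
  by (rule resolvent_setup_zero_out)

abbreviation G' where "G' \<equiv> minor.G"
abbreviation J where "J \<equiv> {..<N} - {i}"

lemma minor_a: "k < N \<Longrightarrow> l < N \<Longrightarrow> minor.a k l = (if k = i \<or> l = i then (if k = l then - z else 0) else a k l)"
  unfolding minor.a_def a_def using h by (auto simp: zero_out_def)

lemma sum_split: "(\<Sum>l<N. f l) = f i + (\<Sum>l\<in>J. f l)" for f :: "nat \<Rightarrow> 'b :: comm_monoid_add"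
  using i by (intro sum.remove) auto

text \<open>Column \<open>i\<close> of \<open>G\<close> with its \<open>i\<close>-th entry erased
  solves the system of the minor; the erased term moves to the right-hand side.\<close>

lemma G_column:
  assumes k: "k \<in> J"
  shows "G k i = - G i i * (\<Sum>l\<in>J. G' k l * of_real (h $$ (l, i)))"
proof -
  define v where "v l = (if l = i then 0 else G l i)" for l
  define u where "u k = (if k = i then 0 else - G i i * of_real (h $$ (k, i)))" for k
  have "v k = (\<Sum>l<N. G' k l * u l)"
  proof (rule minor.solution_unique)
    fix k assume k: "k < N"
    show "(\<Sum>l<N. minor.a k l * v l) = u k"
    proof (cases "k = i")
      case True
      then have "(\<Sum>l<N. minor.a k l * v l) = (\<Sum>l<N. 0)"
        using k i by (intro sum.cong refl) (auto simp: minor_a v_def)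
      then show ?thesis using True by (simp add: u_def)
    next
      case False
      have "(\<Sum>l<N. minor.a k l * v l) = (\<Sum>l\<in>J. a k l * G l i)"
        unfolding sum_split using k False by (auto simp: v_def minor_a intro!: sum.cong)
      also have "\<dots> = (\<Sum>l<N. a k l * G l i) - a k i * G i i"
        unfolding sum_split by simp
      also have "\<dots> = u k" unfolding a_G[OF k i] using False by (simp add: u_def a_def)
      finally show ?thesis .
    qed
  qed (use k in auto)
  then show ?thesis using k unfolding sum_split by (simp add: u_def v_def sum_distrib_left sum_negf mult_ac)
qed

lemma Schur:
  "G i i * (of_real (h $$ (i, i)) - z - (\<Sum>k\<in>J. \<Sum>l\<in>J. of_real (h $$ (i, k)) * G' k l * of_real (h $$ (i, l)))) = 1"
proof -
  have "1 = (\<Sum>l<N. a i l * G l i)" using i by (simp add: a_G)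
  also have "\<dots> = a i i * G i i + (\<Sum>k\<in>J. a i k * G k i)" by (rule sum_split)
  also have "(\<Sum>k\<in>J. a i k * G k i) = (\<Sum>k\<in>J. - G i i * (\<Sum>l\<in>J. of_real (h $$ (i, k)) * G' k l * of_real (h $$ (i, l))))"
  proof (intro sum.cong refl)
    fix k assume k: "k \<in> J"
    have "(\<Sum>l\<in>J. G' k l * of_real (h $$ (l, i))) = (\<Sum>l\<in>J. G' k l * of_real (h $$ (i, l)))"
      using i by (intro sum.cong refl) (auto simp: h_sym)
    then show "a i k * G k i = - G i i * (\<Sum>l\<in>J. of_real (h $$ (i, k)) * G' k l * of_real (h $$ (i, l)))"
      using k by (auto simp: G_column a_def sum_distrib_left mult_ac)
  qed
  finally show ?thesis by (simp add: a_def algebra_simps sum_distrib_left sum_negf)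
qed

lemma G_ii_nonzero: "G i i \<noteq> 0"
  using Schur by auto

text \<open>The rank-one correction makes the column vanish at \<open>i\<close>. On such a vector
  the minor and the full matrix act alike in every row other than \<open>i\<close>, and row
  \<open>i\<close> of the minor gives 0.\<close>

lemma G_minor:
  assumes j: "j \<in> J" and k: "k < N"
  shows "G k j - G k i * G i j / G i i = G' k j"
proof -
  define v where "v l = G l j - G l i * G i j / G i i" for l
  have vi: "v i = 0" using G_ii_nonzero by (simp add: v_def)
  have "v k = G' k j"
  proof (rule minor.solution_unique_delta)
    fix k assume k: "k < N"
    show "(\<Sum>l<N. minor.a k l * v l) = (if k = j then 1 else 0)"
    proof (cases "k = i")
      case True
      then have "(\<Sum>l<N. minor.a k l * v l) = (\<Sum>l<N. 0)"
        using k i vi by (intro sum.cong refl) (auto simp: minor_a)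
      then show ?thesis using True j by auto
    next
      case False
      have "(\<Sum>l<N. minor.a k l * v l) = (\<Sum>l<N. a k l * v l)"
        using k False vi by (intro sum.cong refl) (auto simp: minor_a)
      also have "\<dots> = (\<Sum>l<N. a k l * G l j) - (\<Sum>l<N. a k l * G l i) * (G i j / G i i)"
        unfolding v_def sum_distrib_right sum_subtractf[symmetric]
        by (intro sum.cong refl) (simp add: algebra_simps)
      also have "\<dots> = (if k = j then 1 else 0)" using j k i False by (simp add: a_G)
      finally show ?thesis .
    qed
  qed (use j k in auto)
  then show ?thesis by (simp add: v_def)
qed

text \<open>By the rank-one formula the difference is the sum of \<open>(G k i)^2 / G i i\<close>
  over all \<open>k\<close>, the term \<open>k = i\<close> supplying \<open>G i i\<close> itself.
  The Ward identity bounds the sum of the numerators by |G i i| / Im z.\<close>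

lemma trace_minor: "cmod ((\<Sum>k<N. G k k) - (\<Sum>k\<in>J. G' k k)) \<le> 1 / Im z"
proof -
  have "(\<Sum>k<N. G k k) - (\<Sum>k\<in>J. G' k k) = G i i + (\<Sum>k\<in>J. G k i * G i k / G i i)"
    unfolding sum_split[of "\<lambda>k. G k k"]
    by (simp add: add_diff_eq[symmetric] sum_subtractf[symmetric] G_minor[symmetric])
  also have "\<dots> = (\<Sum>k<N. (G k i)\<^sup>2 / G i i)"
  proof -
    have "(\<Sum>k\<in>J. G k i * G i k / G i i) = (\<Sum>k\<in>J. (G k i)\<^sup>2 / G i i)"
      using i G_sym by (intro sum.cong refl) (auto simp: power2_eq_square)
    then show ?thesis unfolding sum_split using G_ii_nonzero by (simp add: power2_eq_square)
  qed
  also have "\<dots> = (\<Sum>k<N. (G k i)\<^sup>2) / G i i" by (simp add: sum_divide_distrib)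
  finally have "cmod ((\<Sum>k<N. G k k) - (\<Sum>k\<in>J. G' k k)) = cmod (\<Sum>k<N. (G k i)\<^sup>2) / cmod (G i i)"
    by (simp add: norm_divide)
  also have "cmod (\<Sum>k<N. (G k i)\<^sup>2) \<le> (\<Sum>k<N. (cmod (G k i))\<^sup>2)"
    by (rule order_trans[OF norm_sum]) (simp add: norm_power)
  also have "\<dots> \<le> cmod (G i i) / Im z"
    unfolding Ward[OF i] using z by (intro divide_right_mono) (auto intro: Im_le_cmod)
  finally show ?thesis using G_ii_nonzero z by (simp add: field_simps)
qed

lemma sum_norm_minor_le:
  "(\<Sum>k\<in>J. \<Sum>l\<in>J. (cmod (G' k l))\<^sup>2) \<le> Im (\<Sum>k\<in>J. G' k k) / Im z"
proof -
  have "(\<Sum>k\<in>J. \<Sum>l\<in>J. (cmod (G' k l))\<^sup>2) = (\<Sum>l\<in>J. \<Sum>k\<in>J. (cmod (G' k l))\<^sup>2)"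
    by (rule sum.swap)
  also have "\<dots> \<le> (\<Sum>l\<in>J. \<Sum>k<N. (cmod (G' k l))\<^sup>2)"
    by (intro sum_mono sum_mono2) auto
  also have "\<dots> = (\<Sum>l\<in>J. Im (G' l l) / Im z)"
    by (intro sum.cong refl minor.Ward) auto
  finally show ?thesis by (simp add: sum_divide_distrib)
qed

end

section \<open>Dependence on the spectral parameter and measurability\<close>

text \<open>Resolvent identity on the diagonal: the difference is \<open>z1 - z2\<close> times an
  entry of the product of the two resolvents, which is controlled by the squared column
  norms.\<close>

lemma ntr_resolvent_Lipschitz:
  assumes h: "h \<in> carrier_mat N N" "transpose_mat h = h"
    and y: "0 < y" "y \<le> Im z1" "y \<le> Im z2" and N: "N > 0"
  shows "cmod (ntr (resolvent h z1) - ntr (resolvent h z2)) \<le> cmod (z1 - z2) / y\<^sup>2"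
proof -
  interpret R1: resolvent_setup N h z1 using h y by unfold_locales auto
  interpret R2: resolvent_setup N h z2 using h y by unfold_locales auto
  have res: "R1.G k k - R2.G k k = (z1 - z2) * (\<Sum>l<N. R1.G k l * R2.G l k)" if k: "k < N" for k
  proof -
    have "R2.G k k = (\<Sum>l<N. R1.G k l * ((if l = k then 1 else 0) - (z1 - z2) * R2.G l k))"
    proof (rule R1.solution_unique[where v = "\<lambda>l. R2.G l k"])
      fix j assume j: "j < N"
      have "(\<Sum>l<N. R1.a j l * R2.G l k) = (\<Sum>l<N. R2.a j l * R2.G l k - (if j = l then (z1 - z2) * R2.G l k else 0))"
        by (intro sum.cong refl) (auto simp: R1.a_def R2.a_def algebra_simps)
      also have "\<dots> = (if j = k then 1 else 0) - (z1 - z2) * R2.G j k"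
        using j k by (simp add: sum_subtractf R2.a_G)
      finally show "(\<Sum>l<N. R1.a j l * R2.G l k) = (if j = k then 1 else 0) - (z1 - z2) * R2.G j k" .
    qed (rule k)
    also have "\<dots> = R1.G k k - (z1 - z2) * (\<Sum>l<N. R1.G k l * R2.G l k)"
      using k by (simp add: right_diff_distrib sum_subtractf sum_distrib_left mult_ac
          mult_delta_right)
    finally show ?thesis by simp
  qed
  have bound: "cmod (\<Sum>l<N. R1.G k l * R2.G l k) \<le> 1 / y\<^sup>2" if k: "k < N" for k
  proof -
    have "cmod (\<Sum>l<N. R1.G k l * R2.G l k) \<le> (\<Sum>l<N. cmod (R1.G l k) * cmod (R2.G l k))"
      by (rule order_trans[OF norm_sum]) (use k in \<open>auto simp: norm_mult R1.G_sym intro!: sum_mono\<close>)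
    also have "\<dots> \<le> (\<Sum>l<N. ((cmod (R1.G l k))\<^sup>2 + (cmod (R2.G l k))\<^sup>2) / 2)"
    proof (intro sum_mono)
      fix l
      show "cmod (R1.G l k) * cmod (R2.G l k) \<le> ((cmod (R1.G l k))\<^sup>2 + (cmod (R2.G l k))\<^sup>2) / 2"
        using zero_le_power2[of "cmod (R1.G l k) - cmod (R2.G l k)"] unfolding power2_diff by simp
    qed
    also have "\<dots> = ((\<Sum>l<N. (cmod (R1.G l k))\<^sup>2) + (\<Sum>l<N. (cmod (R2.G l k))\<^sup>2)) / 2"
      by (simp add: sum.distrib sum_divide_distrib add_divide_distrib)
    also have "\<dots> \<le> (1 / (Im z1)\<^sup>2 + 1 / (Im z2)\<^sup>2) / 2"
      using k by (intro divide_right_mono add_mono R1.sum_norm_G_le R2.sum_norm_G_le) auto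
    also have "\<dots> \<le> (1 / y\<^sup>2 + 1 / y\<^sup>2) / 2"
      using y by (intro divide_right_mono add_mono divide_left_mono power_mono) auto
    finally show ?thesis by simp
  qed
  have "ntr (resolvent h z1) - ntr (resolvent h z2) = (\<Sum>k<N. R1.G k k - R2.G k k) / of_nat N"
    unfolding R1.ntr_resolvent R2.ntr_resolvent by (simp add: sum_subtractf diff_divide_distrib)
  also have "cmod \<dots> \<le> (\<Sum>k<N. cmod (z1 - z2) * (1 / y\<^sup>2)) / real N"
    unfolding norm_divide norm_of_nat
  proof (intro divide_right_mono order_trans[OF norm_sum] sum_mono)
    fix k assume "k \<in> {..<N}"
    then show "cmod (R1.G k k - R2.G k k) \<le> cmod (z1 - z2) * (1 / y\<^sup>2)"
      using res[of k] bound[of k] mult_left_mono[OF bound[of k] norm_ge_zero[of "z1 - z2"]]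
      by (simp add: norm_mult)
  qed simp
  also have "\<dots> = cmod (z1 - z2) / y\<^sup>2" using N by simp
  finally show ?thesis .
qed

lemma borel_measurable_det:
  fixes F :: "'b \<Rightarrow> complex mat"
  assumes F: "\<And>\<omega>. \<omega> \<in> space M \<Longrightarrow> F \<omega> \<in> carrier_mat n n"
    and meas: "\<And>i j. i < n \<Longrightarrow> j < n \<Longrightarrow> (\<lambda>\<omega>. F \<omega> $$ (i, j)) \<in> borel_measurable M"
  shows "(\<lambda>\<omega>. Determinant.det (F \<omega>)) \<in> borel_measurable M"
proof -
  have "(\<lambda>\<omega>. \<Sum>p\<in>{p. p permutes {0..<n}}. signof p * (\<Prod>i = 0..<n. F \<omega> $$ (i, p i))) \<in> borel_measurable M"
  proof (intro borel_measurable_sum borel_measurable_times borel_measurable_prod borel_measurable_const meas)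
    fix p i assume "p \<in> {p. p permutes {0..<n}}" "i \<in> {0..<n}"
    then show "i < n" "p i < n" using permutes_in_image[of p "{0..<n}" i] by auto
  qed
  moreover have "Determinant.det (F \<omega>) = (\<Sum>p\<in>{p. p permutes {0..<n}}. signof p * (\<Prod>i = 0..<n. F \<omega> $$ (i, p i)))"
    if "\<omega> \<in> space M" for \<omega> using det_def'[OF F[OF that]] .
  ultimately show ?thesis by (subst measurable_cong) auto
qed

text \<open>The output of \<open>mat_inverse\<close> does not show how it depends on the entries.
  Cramer's rule writes it as cofactor over determinant, both polynomial in the entries, with a
  non-vanishing denominator.\<close>

lemma borel_measurable_resolvent:
  fixes F :: "'b \<Rightarrow> real mat"
  assumes F: "\<And>\<omega>. \<omega> \<in> space M \<Longrightarrow> F \<omega> \<in> carrier_mat n n \<and> transpose_mat (F \<omega>) = F \<omega>"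
    and meas: "\<And>i j. i < n \<Longrightarrow> j < n \<Longrightarrow> (\<lambda>\<omega>. F \<omega> $$ (i, j)) \<in> borel_measurable M"
    and z: "Im z > 0" and kj: "k < n" "j < n"
  shows "(\<lambda>\<omega>. resolvent (F \<omega>) z $$ (k, j)) \<in> borel_measurable M"
proof -
  define B where "B \<omega> = map_mat complex_of_real (F \<omega>) - z \<cdot>\<^sub>m 1\<^sub>m (dim_row (F \<omega>))" for \<omega>
  have B: "B \<omega> \<in> carrier_mat n n" if "\<omega> \<in> space M" for \<omega>
    using F[OF that] by (auto simp: B_def)
  have B_meas: "(\<lambda>\<omega>. B \<omega> $$ (i, j)) \<in> borel_measurable M" if "i < n" "j < n" for i j
  proof -
    have "(\<lambda>\<omega>. complex_of_real (F \<omega> $$ (i, j)) - (if i = j then z else 0)) \<in> borel_measurable M"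
      using meas[OF that] by measurable
    moreover have "B \<omega> $$ (i, j) = complex_of_real (F \<omega> $$ (i, j)) - (if i = j then z else 0)"
      if "\<omega> \<in> space M" for \<omega> using F[OF that] \<open>i < n\<close> \<open>j < n\<close> by (auto simp: B_def)
    ultimately show ?thesis by (subst measurable_cong) auto
  qed
  have det: "(\<lambda>\<omega>. Determinant.det (B \<omega>)) \<in> borel_measurable M"
    by (rule borel_measurable_det[of M B n, OF B B_meas])
  have "(\<lambda>\<omega>. Determinant.det (mat_delete (B \<omega>) j k)) \<in> borel_measurable M"
  proof (rule borel_measurable_det[of M _ "n - 1"])
    show "mat_delete (B \<omega>) j k \<in> carrier_mat (n - 1) (n - 1)" if "\<omega> \<in> space M" for \<omega>
      using B[OF that] by (rule mat_delete_carrier)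
    show "(\<lambda>\<omega>. mat_delete (B \<omega>) j k $$ (r, s)) \<in> borel_measurable M" if rs: "r < n - 1" "s < n - 1" for r s
    proof -
      have "(\<lambda>\<omega>. B \<omega> $$ (if r < j then r else Suc r, if s < k then s else Suc s)) \<in> borel_measurable M"
        using rs by (intro B_meas) auto
      moreover have "mat_delete (B \<omega>) j k $$ (r, s) = B \<omega> $$ (if r < j then r else Suc r, if s < k then s else Suc s)"
        if "\<omega> \<in> space M" for \<omega> using B[OF that] rs by (auto simp: mat_delete_def)
      ultimately show ?thesis by (subst measurable_cong) auto
    qed
  qed
  then have "(\<lambda>\<omega>. cofactor (B \<omega>) j k / Determinant.det (B \<omega>)) \<in> borel_measurable M"
    using det unfolding cofactor_def by measurable
  moreover have "resolvent (F \<omega>) z $$ (k, j) = cofactor (B \<omega>) j k / Determinant.det (B \<omega>)" if w: "\<omega> \<in> space M" for \<omega>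
  proof -
    interpret R: resolvent_setup n "F \<omega>" z using F[OF w] z by unfold_locales auto
    have Beq: "B \<omega> = R.A" by (simp add: B_def)
    have adj: "adj_mat (B \<omega>) \<in> carrier_mat n n" "B \<omega> * adj_mat (B \<omega>) = Determinant.det (B \<omega>) \<cdot>\<^sub>m 1\<^sub>m n"
      using adj_mat[OF B[OF w]] by auto
    have d: "Determinant.det (B \<omega>) \<noteq> 0" unfolding Beq by (rule R.det_nonzero)
    have "adj_mat (B \<omega>) $$ (k, j) / Determinant.det (B \<omega>) = R.G k j"
    proof (rule R.solution_unique_delta[where v = "\<lambda>l. adj_mat (B \<omega>) $$ (l, j) / Determinant.det (B \<omega>)"])
      fix r assume r: "r < n"
      have "(\<Sum>l<n. R.a r l * (adj_mat (B \<omega>) $$ (l, j) / Determinant.det (B \<omega>)))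
          = (\<Sum>l<n. B \<omega> $$ (r, l) * adj_mat (B \<omega>) $$ (l, j)) / Determinant.det (B \<omega>)"
        unfolding Beq sum_divide_distrib using r by (intro sum.cong refl) (simp add: R.A_entry del: index_minus_mat)
      also have "\<dots> = (B \<omega> * adj_mat (B \<omega>)) $$ (r, j) / Determinant.det (B \<omega>)"
        using R.mult_entry[OF B[OF w] adj(1) r kj(2)] by simp
      also have "\<dots> = (if r = j then 1 else 0)" unfolding adj(2) using r kj d by simp
      finally show "(\<Sum>l<n. R.a r l * (adj_mat (B \<omega>) $$ (l, j) / Determinant.det (B \<omega>))) = (if r = j then 1 else 0)" .
    qed (use kj in auto)
    then show ?thesis using kj B[OF w] by (simp add: R.G_def adj_mat_def)
  qed
  ultimately show ?thesis by (subst measurable_cong) auto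
qed

subsection \<open>Stability and the bootstrap\<close>

text \<open>The bound is relative to the random Hilbert-Schmidt norm of the minor's resolvent and so
  presupposes nothing about \<open>m\<close>. The centring divides by \<open>N\<close>, although
  only N - 1 terms occur, because the entries have variance 1/N. The factor 2 joins real and
  imaginary parts.\<close>

definition row_fluctuation_le :: "nat \<Rightarrow> real mat \<Rightarrow> real \<Rightarrow> complex \<Rightarrow> nat \<Rightarrow> bool" where
  "row_fluctuation_le N h T z i \<longleftrightarrow> \<bar>h $$ (i, i)\<bar> \<le> T / sqrt (real N) \<and>
     cmod ((\<Sum>k\<in>{..<N} - {i}. \<Sum>l\<in>{..<N} - {i}.
              of_real (h $$ (i, k)) * resolvent (zero_out i h) z $$ (k, l) * of_real (h $$ (i, l)))
           - (\<Sum>k\<in>{..<N} - {i}. resolvent (zero_out i h) z $$ (k, k)) / of_nat N)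
       \<le> 2 * T / real N * sqrt (\<Sum>k\<in>{..<N} - {i}. \<Sum>l\<in>{..<N} - {i}.
              (cmod (resolvent (zero_out i h) z $$ (k, l)))\<^sup>2)"

text \<open>The constant 6 is 4 + 1 + 1: quadratic form, difference of traces, diagonal entry.
  \<open>Im m \<le> 2\<close> and \<open>1 / Im z \<le> N\<close> bound the imaginary trace of the
  minor by 4N, which turns the relative bound on the form into an absolute one. The other two errors
  are coarsened to the same order.\<close>

lemma (in resolvent_minor) Schur_error:
  assumes good: "row_fluctuation_le N h T z i" and T: "T \<ge> 1" and y: "Im z \<le> 1"
    and K: "K \<ge> 1" "K \<le> real N * Im z" and m2: "Im (ntr (resolvent h z)) \<le> 2"
  obtains \<epsilon> where "cmod \<epsilon> \<le> 6 * T / sqrt K" "G i i * (z + ntr (resolvent h z) + \<epsilon>) = - 1"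
proof -
  define m where "m = ntr (resolvent h z)"
  define Q where "Q = (\<Sum>k\<in>J. \<Sum>l\<in>J. of_real (h $$ (i, k)) * G' k l * of_real (h $$ (i, l)))"
  define \<tau> where "\<tau> = (\<Sum>k\<in>J. G' k k)"
  define S where "S = (\<Sum>k\<in>J. \<Sum>l\<in>J. (cmod (G' k l))\<^sup>2)"
  have N: "real N > 0" using i by simp
  have K0: "K > 0" using K by simp
  have good': "\<bar>h $$ (i, i)\<bar> \<le> T / sqrt (real N)" "cmod (Q - \<tau> / of_nat N) \<le> 2 * T / real N * sqrt S"
    using good unfolding row_fluctuation_le_def Q_def \<tau>_def S_def minor.G_def by auto
  have m: "m = (\<Sum>k<N. G k k) / of_nat N" by (simp add: m_def ntr_resolvent)
  have yN: "1 / Im z \<le> real N" "1 / (real N * Im z) \<le> 1 / K" using K N z by (auto simp: field_simps)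
  have tr: "cmod ((\<Sum>k<N. G k k) - \<tau>) \<le> 1 / Im z" unfolding \<tau>_def by (rule trace_minor)
  have tr': "cmod (\<tau> / of_nat N - m) \<le> T / sqrt K"
  proof -
    have "cmod (\<tau> / of_nat N - m) = cmod ((\<Sum>k<N. G k k) - \<tau>) / real N"
      unfolding m diff_divide_distrib[symmetric] norm_divide by (simp add: norm_minus_commute)
    also have "\<dots> \<le> (1 / Im z) / real N" using tr by (intro divide_right_mono) auto
    also have "\<dots> \<le> 1 / K" using yN by (simp add: field_simps)
    also have "\<dots> \<le> 1 / sqrt K"
      using K real_sqrt_le_mono[of K "K * K"] mult_left_mono[of 1 K K] by (intro divide_left_mono) auto
    also have "\<dots> \<le> T / sqrt K" using T K by (intro divide_right_mono) auto
    finally show ?thesis .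
  qed
  have "Im \<tau> = Im (\<Sum>k<N. G k k) - Im ((\<Sum>k<N. G k k) - \<tau>)" by simp
  also have "\<dots> \<le> 2 * real N + 1 / Im z"
  proof -
    have "Im (\<Sum>k<N. G k k) = Im m * real N" using N unfolding m by (simp add: Im_divide_of_nat)
    then have "Im (\<Sum>k<N. G k k) \<le> 2 * real N" using m2 N unfolding m_def by (simp add: mult_right_mono)
    moreover have "- Im ((\<Sum>k<N. G k k) - \<tau>) \<le> 1 / Im z"
      using tr abs_Im_le_cmod[of "(\<Sum>k<N. G k k) - \<tau>"] by linarith
    ultimately show ?thesis by linarith
  qed
  also have "\<dots> \<le> 4 * real N" using yN(1) N by linarith
  finally have im: "Im \<tau> / Im z \<le> 4 * real N / Im z" using z by (intro divide_right_mono) auto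
  have "sqrt S \<le> sqrt (4 * real N / Im z)"
    using sum_norm_minor_le im unfolding S_def \<tau>_def by (intro real_sqrt_le_mono) linarith
  then have "2 * T / real N * sqrt S \<le> 2 * T / real N * sqrt (4 * real N / Im z)"
    using T N by (intro mult_left_mono) auto
  also have "\<dots> = 2 * T * sqrt (4 * (1 / (real N * Im z)))"
  proof -
    have "sqrt (4 * real N / Im z) / real N = sqrt (4 * real N / Im z) / sqrt ((real N)\<^sup>2)"
      using N by simp
    also have "\<dots> = sqrt (4 * real N / Im z / (real N)\<^sup>2)" by (simp only: real_sqrt_divide)
    also have "4 * real N / Im z / (real N)\<^sup>2 = 4 * (1 / (real N * Im z))"
      using N z by (simp add: field_simps power2_eq_square)
    finally have "sqrt (4 * real N / Im z) / real N = sqrt (4 * (1 / (real N * Im z)))" .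
    then show ?thesis by (metis times_divide_eq_left times_divide_eq_right)
  qed
  also have "\<dots> \<le> 2 * T * sqrt (4 * (1 / K))"
    using yN(2) T by (intro mult_left_mono real_sqrt_le_mono) auto
  also have "\<dots> = 4 * T / sqrt K" by (simp add: real_sqrt_mult real_sqrt_divide)
  finally have dev: "cmod (Q - \<tau> / of_nat N) \<le> 4 * T / sqrt K" using good'(2) by linarith
  have KN: "K \<le> real N" using K(2) y N mult_left_mono[of "Im z" 1 "real N"] by linarith
  have "T / sqrt (real N) \<le> T / sqrt K" using KN K0 T by (intro divide_left_mono) auto
  then have hii: "cmod (of_real (h $$ (i, i)) :: complex) \<le> T / sqrt K" using good'(1) by simp
  define \<epsilon> where "\<epsilon> = Q - of_real (h $$ (i, i)) - m"
  have "\<epsilon> = (Q - \<tau> / of_nat N) + (\<tau> / of_nat N - m) - of_real (h $$ (i, i))" by (simp add: \<epsilon>_def)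
  also have "cmod \<dots> \<le> cmod (Q - \<tau> / of_nat N) + cmod (\<tau> / of_nat N - m) + cmod (of_real (h $$ (i, i)) :: complex)"
    by (meson norm_triangle_ineq4 norm_triangle_ineq add_right_mono order_trans)
  also have "\<dots> \<le> 4 * T / sqrt K + T / sqrt K + T / sqrt K" by (intro add_mono dev tr' hii)
  finally have "cmod \<epsilon> \<le> 6 * T / sqrt K" by (simp add: add_divide_distrib[symmetric])
  moreover have "G i i * (z + m + \<epsilon>) = - 1"
  proof -
    have "G i i * (z + m + \<epsilon>) = - (G i i * (of_real (h $$ (i, i)) - z - Q))"
      by (simp add: \<epsilon>_def algebra_simps)
    then show ?thesis using Schur by (simp add: Q_def)
  qed
  ultimately show thesis by (intro that[of \<epsilon>]) (simp_all add: m_def)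
qed

text \<open>Averaging \<open>1 + (z + m) G\<^sub>i\<^sub>i = - \<epsilon>\<^sub>i G\<^sub>i\<^sub>i\<close> gives \<open>m\<^sup>2 + z m + 1 = r\<close>, that is
  \<open>(m - m\<^sub>s\<^sub>c) (m + m\<^sub>s\<^sub>c + z) = r\<close>, and the second factor has imaginary part at least \<open>Im m\<^sub>s\<^sub>c\<close>.\<close>

lemma (in resolvent_setup) self_consistent_stability:
  assumes N: "N > 0" and g: "\<And>i. i < N \<Longrightarrow> cmod (G i i) \<le> g"
    and eps: "\<And>i. i < N \<Longrightarrow> cmod (\<epsilon> i) \<le> \<delta>"
    and eq: "\<And>i. i < N \<Longrightarrow> G i i * (z + ntr (resolvent h z) + \<epsilon> i) = - 1"
    and c: "0 < c" "c \<le> Im (msc z)"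
  shows "cmod (ntr (resolvent h z) - msc z) \<le> \<delta> * g / c"
proof -
  define m where "m = ntr (resolvent h z)"
  have m: "of_nat N * m = (\<Sum>k<N. G k k)" using N by (simp add: m_def ntr_resolvent)
  have "of_nat N * (1 + z * m + m\<^sup>2) = of_nat N + (z + m) * (\<Sum>k<N. G k k)"
    unfolding m[symmetric] by (simp add: algebra_simps power2_eq_square)
  also have "\<dots> = (\<Sum>k<N. 1 + (z + m) * G k k)" by (simp add: sum.distrib sum_distrib_left)
  also have "\<dots> = (\<Sum>k<N. - (G k k * \<epsilon> k))"
  proof (intro sum.cong refl)
    fix k assume "k \<in> {..<N}"
    then have "G k k * (z + m + \<epsilon> k) = - 1" using eq[of k] by (simp add: m_def)
    then show "1 + (z + m) * G k k = - (G k k * \<epsilon> k)" by (simp add: algebra_simps eq_neg_iff_add_eq_0)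
  qed
  finally have "real N * cmod (1 + z * m + m\<^sup>2) = cmod (\<Sum>k<N. - (G k k * \<epsilon> k))"
    by (metis norm_mult norm_of_nat)
  also have "\<dots> \<le> (\<Sum>k<N. g * \<delta>)"
  proof (rule order_trans[OF norm_sum], rule sum_mono)
    fix k assume k: "k \<in> {..<N}"
    then have "cmod (G k k) \<le> g" "cmod (\<epsilon> k) \<le> \<delta>" using g eps by auto
    then show "cmod (- (G k k * \<epsilon> k)) \<le> g * \<delta>"
      by (simp add: norm_mult mult_mono order_trans[OF norm_ge_zero])
  qed
  also have "\<dots> = real N * (g * \<delta>)" by simp
  finally have r: "cmod (1 + z * m + m\<^sup>2) \<le> g * \<delta>" using N by simp
  have "(m - msc z) * (m + msc z + z) = (1 + z * m + m\<^sup>2) - ((msc z)\<^sup>2 + z * msc z + 1)"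
    by (simp add: algebra_simps power2_eq_square)
  also have "\<dots> = 1 + z * m + m\<^sup>2" using msc_quadratic[OF z] by simp
  finally have e: "cmod (m - msc z) * cmod (m + msc z + z) = cmod (1 + z * m + m\<^sup>2)"
    by (metis norm_mult)
  have "c \<le> Im (m + msc z + z)" using c Im_ntr_nonneg z by (simp add: m_def)
  also have "\<dots> \<le> cmod (m + msc z + z)" by (rule Im_le_cmod)
  finally have "cmod (m - msc z) * c \<le> cmod (m - msc z) * cmod (m + msc z + z)"
    by (intro mult_left_mono) auto
  then have "cmod (m - msc z) * c \<le> g * \<delta>" using e r by linarith
  then show ?thesis using c by (simp add: m_def field_simps)
qed

section \<open>Lipschitz bounds and the spectral grid\<close>

text \<open>Subtracting the two quadratic equations leaves the factor
  \<open>msc z1 + msc z2 + z1\<close>, whose imaginary part is at least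
  \<open>Im z1\<close>.\<close>

lemma msc_Lipschitz:
  assumes "Im z1 > 0" "Im z2 > 0"
  shows "cmod (msc z1 - msc z2) \<le> cmod (z1 - z2) / Im z1"
proof -
  have "(msc z1 - msc z2) * (msc z1 + msc z2 + z1)
      = ((msc z1)\<^sup>2 + z1 * msc z1 + 1) - ((msc z2)\<^sup>2 + z2 * msc z2 + 1) - (z1 - z2) * msc z2"
    by (simp add: algebra_simps power2_eq_square)
  also have "\<dots> = - ((z1 - z2) * msc z2)" using assms by (simp add: msc_quadratic)
  finally have "cmod (msc z1 - msc z2) * cmod (msc z1 + msc z2 + z1) = cmod (z1 - z2) * cmod (msc z2)"
    by (metis norm_minus_cancel norm_mult)
  also have "\<dots> \<le> cmod (z1 - z2)"
    using norm_msc_less_1[OF assms(2)] by (intro mult_left_le) auto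
  finally have "cmod (msc z1 - msc z2) * cmod (msc z1 + msc z2 + z1) \<le> cmod (z1 - z2)" .
  moreover have "Im z1 \<le> cmod (msc z1 + msc z2 + z1)"
    using Im_le_cmod[of "msc z1 + msc z2 + z1"] Im_msc_pos assms by simp
      (smt (verit) Im_msc_pos assms)
  then have "cmod (msc z1 - msc z2) * Im z1 \<le> cmod (msc z1 - msc z2) * cmod (msc z1 + msc z2 + z1)"
    by (intro mult_left_mono) auto
  ultimately have "cmod (msc z1 - msc z2) * Im z1 \<le> cmod (z1 - z2)" by linarith
  then show ?thesis using assms by (simp add: field_simps)
qed

lemma resolvent_msc_diff_Lipschitz:
  assumes h: "h \<in> carrier_mat N N" "transpose_mat h = h" "N > 0"
    and z: "1 / real N \<le> Im z1" "1 / real N \<le> Im z2"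
  shows "cmod (ntr (resolvent h z1) - msc z1)
       \<le> cmod (ntr (resolvent h z2) - msc z2) + 2 * (real N)\<^sup>2 * cmod (z1 - z2)"
proof -
  have N: "0 < 1 / real N" "1 \<le> real N" using h by auto
  have z0: "Im z1 > 0" "Im z2 > 0" using N z by linarith+
  have "cmod (ntr (resolvent h z1) - ntr (resolvent h z2)) \<le> cmod (z1 - z2) / (1 / real N)\<^sup>2"
    by (rule ntr_resolvent_Lipschitz[OF h(1,2) N(1) z h(3)])
  then have 1: "cmod (ntr (resolvent h z1) - ntr (resolvent h z2)) \<le> (real N)\<^sup>2 * cmod (z1 - z2)"
    by (simp add: power_divide mult.commute)
  have "cmod (msc z1 - msc z2) \<le> cmod (z1 - z2) / Im z1" by (rule msc_Lipschitz[OF z0])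
  also have "\<dots> \<le> cmod (z1 - z2) / (1 / real N)" using z N z0 by (intro divide_left_mono) auto
  also have "\<dots> \<le> cmod (z1 - z2) * (real N)\<^sup>2"
    using N(2) mult_left_mono[of 1 "real N" "real N"] by (auto simp: power2_eq_square intro!: mult_left_mono)
  finally have 2: "cmod (msc z1 - msc z2) \<le> (real N)\<^sup>2 * cmod (z1 - z2)" by (simp add: mult.commute)
  have "ntr (resolvent h z1) - msc z1 = (ntr (resolvent h z2) - msc z2)
      + (ntr (resolvent h z1) - ntr (resolvent h z2)) - (msc z1 - msc z2)" by simp
  also have "cmod \<dots> \<le> cmod (ntr (resolvent h z2) - msc z2)
      + cmod (ntr (resolvent h z1) - ntr (resolvent h z2)) + cmod (msc z1 - msc z2)"
    by (meson norm_triangle_ineq4 norm_triangle_ineq add_right_mono order_trans)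
  finally show ?thesis using 1 2 by linarith
qed

text \<open>Spacing 1/N^3 against the Lipschitz constant 2N^2 makes each step cost 2/N. Heights are
  counted downwards from 1, so each column starts on the line \<open>Im z = 1\<close>, where the
  resolvent is bounded trivially; 4N^3 horizontal steps cover any interval of length at most
  4.\<close>

definition spectral_grid :: "nat \<Rightarrow> real \<Rightarrow> real \<Rightarrow> real \<Rightarrow> complex set" where
  "spectral_grid N W1 W2 \<eta> = {z. \<exists>a b :: nat. a \<le> 4 * N ^ 3 \<and> b \<le> N ^ 3 \<and>
     z = Complex (W1 + real a / real N ^ 3) (1 - real b / real N ^ 3) \<and> Re z \<le> W2 \<and> \<eta> \<le> Im z}"

lemma
  assumes "N > 0"
  shows finite_spectral_grid: "finite (spectral_grid N W1 W2 \<eta>)"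
    and card_spectral_grid: "card (spectral_grid N W1 W2 \<eta>) \<le> 10 * N ^ 6"
proof -
  let ?f = "\<lambda>(a, b). Complex (W1 + real a / real N ^ 3) (1 - real b / real N ^ 3)"
  have sub: "spectral_grid N W1 W2 \<eta> \<subseteq> ?f ` ({..4 * N ^ 3} \<times> {..N ^ 3})"
    unfolding spectral_grid_def by auto
  then show "finite (spectral_grid N W1 W2 \<eta>)" by (rule finite_subset) auto
  have "card (spectral_grid N W1 W2 \<eta>) \<le> card ({..4 * N ^ 3} \<times> {..N ^ 3})"
    by (rule surj_card_le[OF _ sub]) auto
  also have "\<dots> = (4 * N ^ 3 + 1) * (N ^ 3 + 1)" by (simp add: card_cartesian_product)
  also have "\<dots> \<le> (4 * N ^ 3 + N ^ 3) * (N ^ 3 + N ^ 3)"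
    using assms by (intro mult_mono add_mono) auto
  also have "\<dots> = 10 * N ^ 6" by (simp add: algebra_simps power_add[symmetric])
  finally show "card (spectral_grid N W1 W2 \<eta>) \<le> 10 * N ^ 6" .
qed

text \<open>Bootstrap in \<open>Im z\<close>: one grid step changes \<open>m - m\<^sub>s\<^sub>c\<close> by at most \<open>2/N\<close>, so a bound at one height
  keeps \<open>Im m\<close> bounded below at the next, which improves the bound again.\<close>

lemma local_law_deterministic:
  assumes h: "h \<in> carrier_mat N N" "transpose_mat h = h" and N: "N > 0"
    and T: "T \<ge> 1" and K: "K \<ge> 1" "K \<le> real N * \<eta>"
    and c: "0 < c" "c \<le> 1" "\<And>z. W1 \<le> Re z \<Longrightarrow> Re z \<le> W2 \<Longrightarrow> 0 < Im z \<Longrightarrow> Im z \<le> 1 \<Longrightarrow> c \<le> Im (msc z)"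
    and W: "W2 - W1 \<le> 4"
    and B: "B = 24 * T / (sqrt K * c\<^sup>2)" "B + 2 / real N \<le> c / 2"
    and good: "\<And>z i. z \<in> spectral_grid N W1 W2 \<eta> \<Longrightarrow> i < N \<Longrightarrow> row_fluctuation_le N h T z i"
    and z: "z \<in> spectral_domain {W1..W2} \<eta>"
  shows "cmod (ntr (resolvent h z) - msc z) \<le> B + 4 / real N"
proof -
  define \<delta> where "\<delta> = 6 * T / sqrt K"
  have sK: "sqrt K > 0" using K by simp
  have \<delta>0: "\<delta> > 0" using T sK by (simp add: \<delta>_def)
  have N1: "real N \<ge> 1" using N by simp
  \<comment> \<open>\<open>B\<close> is what stability returns, \<open>\<delta> * g / c\<close>, for
    the diagonal bound \<open>g = 4 / c\<close>.\<close>
  have B\<delta>: "B = 4 * \<delta> / c\<^sup>2" using c by (simp add: B(1) \<delta>_def)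
  have B_le: "B \<le> c / 2" using B(2) N1 by (smt (verit) divide_nonneg_nonneg)
  have \<delta>c: "\<delta> \<le> c / 4"
  proof -
    have "4 * \<delta> \<le> c / 2 * c\<^sup>2" using B_le c unfolding B\<delta> by (simp add: field_simps)
    also have "\<dots> \<le> c / 2 * 1" using c by (intro mult_left_mono) (auto simp: power_le_one)
    finally show ?thesis using c by linarith
  qed
  have \<eta>N: "1 / real N \<le> \<eta>" using K N1 by (simp add: field_simps)
  have \<eta>0: "\<eta> > 0" using \<eta>N N1 by (smt (verit) divide_pos_pos)
  let ?D = "\<lambda>z. cmod (ntr (resolvent h z) - msc z)"
  define N3 where "N3 = real N ^ 3"
  have N3: "N3 > 0" using N by (simp add: N3_def)
  have step: "2 * (real N)\<^sup>2 * (r / N3) = 2 * r / real N" for r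
    using N1 by (simp add: N3_def power3_eq_cube power2_eq_square)
  \<comment> \<open>The self-improving step: on the top line nothing is assumed, elsewhere the crude
    bound \<open>c / 2\<close> is upgraded to \<open>B\<close>.\<close>
  have stable: "?D w \<le> B" if w: "w \<in> spectral_grid N W1 W2 \<eta>" and ap: "Im w = 1 \<or> ?D w \<le> c / 2" for w
  proof -
    have w': "W1 \<le> Re w" "Re w \<le> W2" "\<eta> \<le> Im w" "Im w \<le> 1"
      using w N by (auto simp: spectral_grid_def)
    have y: "Im w > 0" using w' \<eta>0 by linarith
    interpret resolvent_setup N h w using h y by unfold_locales
    define m where "m = ntr (resolvent h w)"
    have cw: "c \<le> Im (msc w)" using c w' y by auto
    have "real N * \<eta> \<le> real N * Im w" using w' by (intro mult_left_mono) auto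
    then have Kw: "K \<le> real N * Im w" using K by linarith
    have diag1: "cmod m \<le> 1" if "Im w = 1"
    proof -
      have "cmod m \<le> (\<Sum>k<N. 1) / real N"
        unfolding m_def ntr_resolvent norm_divide norm_of_nat
        using norm_G_diag_le that by (intro divide_right_mono order_trans[OF norm_sum] sum_mono) auto
      then show ?thesis using N by simp
    qed
    have m2: "Im m \<le> 2"
    proof (cases "Im w = 1")
      case True then show ?thesis using diag1 Im_le_cmod[of m] by linarith
    next
      case False
      have "cmod m \<le> cmod (m - msc w) + cmod (msc w)" by (metis diff_add_cancel norm_triangle_ineq)
      then show ?thesis using False ap norm_msc_less_1[OF y] Im_le_cmod[of m] c by (auto simp: m_def)
    qed
    have "\<exists>\<epsilon>. cmod \<epsilon> \<le> \<delta> \<and> G i i * (w + m + \<epsilon>) = - 1" if "i < N" for i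
    proof -
      interpret resolvent_minor N h w i using that by unfold_locales
      show ?thesis
        using Schur_error[OF good[OF w that] T w'(4) K(1) Kw m2[unfolded m_def]] unfolding \<delta>_def m_def by metis
    qed
    then obtain \<epsilon> where \<epsilon>: "\<And>i. i < N \<Longrightarrow> cmod (\<epsilon> i) \<le> \<delta>" "\<And>i. i < N \<Longrightarrow> G i i * (w + m + \<epsilon> i) = - 1"
      by metis
    \<comment> \<open>Away from the top line, |G i i| is the reciprocal of |w + m + \<epsilon> i|,
      and the crude bound keeps \<open>Im m\<close> above \<open>c / 2\<close> while the error is at
      most \<open>c / 4\<close>.\<close>
    have g: "cmod (G i i) \<le> 4 / c" if i: "i < N" for i
    proof (cases "Im w = 1")
      case True
      then have "cmod (G i i) \<le> 1" using norm_G_diag_le[OF i] by simp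
      also have "1 \<le> 4 / c" using c by (simp add: field_simps)
      finally show ?thesis .
    next
      case False
      then have "?D w \<le> c / 2" using ap by simp
      then have "- Im (m - msc w) \<le> c / 2"
        using abs_Im_le_cmod[of "m - msc w"] unfolding m_def by linarith
      then have "c / 2 \<le> Im m" using cw by simp
      then have "c / 2 - \<delta> \<le> Im (w + m) - cmod (\<epsilon> i)" using y \<epsilon>(1)[OF i] by simp
      also have "\<dots> \<le> cmod (w + m) - cmod (\<epsilon> i)" using Im_le_cmod[of "w + m"] by simp
      also have "\<dots> \<le> cmod (w + m + \<epsilon> i)" using norm_diff_ineq by blast
      finally have "c / 4 \<le> cmod (w + m + \<epsilon> i)" using \<delta>c by linarith
      then have "cmod (G i i) * (c / 4) \<le> cmod (G i i) * cmod (w + m + \<epsilon> i)" by (intro mult_left_mono) auto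
      also have "\<dots> = 1" using \<epsilon>(2)[OF i] by (metis norm_minus_cancel norm_mult norm_one)
      finally show ?thesis using c by (simp add: field_simps)
    qed
    have "?D w \<le> \<delta> * (4 / c) / c"
      by (rule self_consistent_stability[OF N g \<epsilon>(1) _ c(1) cw]) (use \<epsilon>(2) in \<open>auto simp: m_def\<close>)
    also have "\<dots> = B" by (simp add: B\<delta> power2_eq_square)
    finally show ?thesis .
  qed
  have descend: "?D (Complex (W1 + real a / N3) (1 - real b / N3)) \<le> B"
    if "Complex (W1 + real a / N3) (1 - real b / N3) \<in> spectral_grid N W1 W2 \<eta>" for a b
    using that
  proof (induction b)
    case 0
    then show ?case by (intro stable) auto
  next
    case (Suc b)
    let ?w = "\<lambda>b. Complex (W1 + real a / N3) (1 - real b / N3)"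
    \<comment> \<open>Membership supplies its own witnesses; positive spacing identifies them with
      \<open>a\<close> and \<open>Suc b\<close>, which transfers the index bounds.\<close>
    from Suc.prems obtain a' b' where ab: "a' \<le> 4 * N ^ 3" "b' \<le> N ^ 3" "real a / N3 = real a' / N3"
        "real (Suc b) / N3 = real b' / N3" "W1 + real a / N3 \<le> W2" "\<eta> \<le> 1 - real (Suc b) / N3"
      unfolding spectral_grid_def N3_def by auto
    then have ab': "a = a'" "Suc b = b'" using N3 by (auto simp del: of_nat_Suc)
    have le: "real b / N3 \<le> real (Suc b) / N3" using N3 by (intro divide_right_mono) auto
    have w: "?w b \<in> spectral_grid N W1 W2 \<eta>"
      unfolding spectral_grid_def N3_def[symmetric] using ab ab' le
      by (intro CollectI exI[of _ a] exI[of _ b]) auto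
    have "?D (?w (Suc b)) \<le> ?D (?w b) + 2 * (real N)\<^sup>2 * cmod (?w (Suc b) - ?w b)"
      using ab(6) le \<eta>N by (intro resolvent_msc_diff_Lipschitz[OF h N]) auto
    also have "?w (Suc b) - ?w b = Complex 0 (- (1 / N3))"
      by (simp add: complex_eq_iff diff_divide_distrib add_divide_distrib)
    also have "cmod \<dots> = 1 / N3" using N3 by (simp add: cmod_def)
    also have "2 * (real N)\<^sup>2 * (1 / N3) = 2 / real N" using step[of 1] by simp
    finally have "?D (?w (Suc b)) \<le> c / 2" using Suc.IH[OF w] B(2) by linarith
    then show ?case using Suc.prems by (intro stable) auto
  qed
  have z': "W1 \<le> Re z" "Re z \<le> W2" "\<eta> < Im z" "Im z < 1" using z by (auto simp: spectral_domain_def)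
  \<comment> \<open>\<open>Re z\<close> is rounded down and \<open>Im z\<close> up, so the grid
    point stays left of \<open>W2\<close> and above \<open>\<eta>\<close>. It lies within 2/N^3 of
    \<open>z\<close>, whence the extra 4/N.\<close>
  define a b where "a = nat \<lfloor>(Re z - W1) * N3\<rfloor>" and "b = nat \<lfloor>(1 - Im z) * N3\<rfloor>"
  have fl: "real (nat \<lfloor>x\<rfloor>) \<le> x" "x \<le> real (nat \<lfloor>x\<rfloor>) + 1" if "0 \<le> x" for x
    using that floor_correct[of x] by (simp_all add: less_imp_le)
  have a: "real a \<le> (Re z - W1) * N3" "(Re z - W1) * N3 \<le> real a + 1"
    unfolding a_def using z' N3 by (intro fl mult_nonneg_nonneg; simp)+
  have b: "real b \<le> (1 - Im z) * N3" "(1 - Im z) * N3 \<le> real b + 1"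
    unfolding b_def using z' N3 by (intro fl mult_nonneg_nonneg; simp)+
  define w where "w = Complex (W1 + real a / N3) (1 - real b / N3)"
  have wz: "\<bar>Re z - Re w\<bar> \<le> 1 / N3" "Re w \<le> Re z" "\<bar>Im z - Im w\<bar> \<le> 1 / N3" "Im z \<le> Im w"
  proof -
    have "real a / N3 \<le> Re z - W1" "Re z - W1 \<le> (real a + 1) / N3"
      "real b / N3 \<le> 1 - Im z" "1 - Im z \<le> (real b + 1) / N3"
      using a b N3 by (simp_all only: pos_divide_le_eq pos_le_divide_eq)
    then show "\<bar>Re z - Re w\<bar> \<le> 1 / N3" "Re w \<le> Re z" "\<bar>Im z - Im w\<bar> \<le> 1 / N3" "Im z \<le> Im w"
      unfolding w_def add_divide_distrib complex.sel by linarith+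
  qed
  have "w \<in> spectral_grid N W1 W2 \<eta>"
  proof -
    have "real a \<le> 4 * N3" using a(1) z' W mult_right_mono[of "Re z - W1" 4 N3] N3 by linarith
    then have "real a \<le> real (4 * N ^ 3)" by (simp add: N3_def)
    then have "a \<le> 4 * N ^ 3" by (simp only: of_nat_le_iff)
    moreover have "real b \<le> 1 * N3" using b(1) z' \<eta>0 mult_right_mono[of "1 - Im z" 1 N3] N3 by linarith
    then have "real b \<le> real (N ^ 3)" by (simp add: N3_def)
    then have "b \<le> N ^ 3" by (simp only: of_nat_le_iff)
    ultimately show ?thesis
      using wz z' unfolding spectral_grid_def N3_def[symmetric]
      by (intro CollectI exI[of _ a] exI[of _ b]) (auto simp: w_def)
  qed
  then have Dw: "?D w \<le> B" unfolding w_def by (rule descend)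
  have "cmod (z - w) \<le> \<bar>Re (z - w)\<bar> + \<bar>Im (z - w)\<bar>" by (rule cmod_le)
  also have "\<dots> \<le> 1 / N3 + 1 / N3" using wz by (intro add_mono) auto
  finally have "2 * (real N)\<^sup>2 * cmod (z - w) \<le> 2 * (real N)\<^sup>2 * (2 / N3)" by (intro mult_left_mono) auto
  moreover have "?D z \<le> ?D w + 2 * (real N)\<^sup>2 * cmod (z - w)"
    using z' wz \<eta>N by (intro resolvent_msc_diff_Lipschitz[OF h N]) auto
  ultimately show ?thesis using Dw step[of 2] by linarith
qed

subsection \<open>Fluctuations of a row\<close>

text \<open>Needed because row \<open>i\<close> of a symmetric matrix is stored under upper
  triangular positions; injectivity lets products over an index set pass to its image.\<close>

lemma (in prob_space) indep_vars_reindex: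
  assumes f: "inj_on f K" and ind: "indep_vars M' X (f ` K)"
  shows "indep_vars (\<lambda>k. M' (f k)) (\<lambda>k. X (f k)) K"
proof -
  have rv: "\<And>k. k \<in> K \<Longrightarrow> random_variable (M' (f k)) (X (f k))"
    and iset: "indep_sets (\<lambda>i. {X i -` A \<inter> space M |A. A \<in> sets (M' i)}) (f ` K)"
    using ind unfolding indep_vars_def2 by auto
  have "indep_sets (\<lambda>k. {X (f k) -` A \<inter> space M |A. A \<in> sets (M' (f k))}) K"
  proof (rule indep_setsI)
    fix k assume "k \<in> K"
    then show "{X (f k) -` A \<inter> space M |A. A \<in> sets (M' (f k))} \<subseteq> events"
      using rv[of k] by (auto intro: measurable_sets)
  next
    fix A J
    assume J: "J \<noteq> {}" "J \<subseteq> K" "finite J"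
      and A: "\<forall>j\<in>J. A j \<in> {X (f j) -` A \<inter> space M |A. A \<in> sets (M' (f j))}"
    have inv: "inv_into K f (f j) = j" if "j \<in> J" for j using J f that by (auto intro: inv_into_f_f)
    have injJ: "inj_on f J" using f J by (auto intro: inj_on_subset)
    have "prob (\<Inter>i\<in>f ` J. A (inv_into K f i)) = (\<Prod>i\<in>f ` J. prob (A (inv_into K f i)))"
      using J A by (intro indep_setsD[OF iset]) (auto simp: inv)
    then show "prob (\<Inter> (A ` J)) = (\<Prod>j\<in>J. prob (A j))"
      using inv by (simp add: prod.reindex[OF injJ])
  qed
  then show ?thesis using rv unfolding indep_vars_def2 by auto
qed

text \<open>This is conditioning on \<open>Y\<close>: the joint law is a product, so the probability
  is the average over \<open>y\<close> of the probabilities of the sections.\<close>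

lemma (in prob_space) indep_var_prob_le:
  assumes ind: "indep_var S X T Y" and A: "A \<in> sets (S \<Otimes>\<^sub>M T)"
    and le: "\<And>y. y \<in> space T \<Longrightarrow> prob {\<omega> \<in> space M. (X \<omega>, y) \<in> A} \<le> c"
  shows "prob {\<omega> \<in> space M. (X \<omega>, Y \<omega>) \<in> A} \<le> c"
proof -
  have rv[measurable]: "X \<in> measurable M S" "Y \<in> measurable M T"
    and eq: "distr M S X \<Otimes>\<^sub>M distr M T Y = distr M (S \<Otimes>\<^sub>M T) (\<lambda>x. (X x, Y x))"
    using ind unfolding indep_var_distribution_eq by auto
  interpret P: prob_space "distr M S X" by (rule prob_space_distr) fact
  interpret Q: prob_space "distr M T Y" by (rule prob_space_distr) fact
  interpret PQ: pair_prob_space "distr M S X" "distr M T Y" ..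
  obtain \<omega> where "\<omega> \<in> space M" using not_empty by auto
  then have "Y \<omega> \<in> space T" using measurable_space[OF rv(2)] by auto
  then have c: "c \<ge> 0" using le[of "Y \<omega>"] measure_nonneg[of M] order_trans by blast
  have A': "A \<in> sets (distr M S X \<Otimes>\<^sub>M distr M T Y)"
    using A by (simp cong: sets_pair_measure_cong)
  have "emeasure M {\<omega> \<in> space M. (X \<omega>, Y \<omega>) \<in> A} = emeasure (distr M (S \<Otimes>\<^sub>M T) (\<lambda>x. (X x, Y x))) A"
    using A by (subst emeasure_distr) (auto intro!: arg_cong[where f = "emeasure M"])
  also have "\<dots> = (\<integral>\<^sup>+y. emeasure (distr M S X) ((\<lambda>x. (x, y)) -` A) \<partial>distr M T Y)"
    unfolding eq[symmetric] by (rule PQ.emeasure_pair_measure_alt2[OF A'])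
  also have "\<dots> \<le> (\<integral>\<^sup>+y. ennreal c \<partial>distr M T Y)"
  proof (rule nn_integral_mono)
    fix y assume "y \<in> space (distr M T Y)"
    then have y: "y \<in> space T" by simp
    have "(\<lambda>x. (x, y)) -` A \<in> sets S" by (rule sets_Pair2[OF A])
    then have "emeasure (distr M S X) ((\<lambda>x. (x, y)) -` A) = emeasure M {\<omega> \<in> space M. (X \<omega>, y) \<in> A}"
      by (subst emeasure_distr) (auto intro!: arg_cong[where f = "emeasure M"])
    also have "\<dots> \<le> ennreal c" unfolding emeasure_eq_measure using le[OF y] by (rule ennreal_leI)
    finally show "emeasure (distr M S X) ((\<lambda>x. (x, y)) -` A) \<le> ennreal c" .
  qed
  also have "\<dots> = ennreal c" using Q.emeasure_space_1 by simp
  finally show ?thesis unfolding emeasure_eq_measure using c by simp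
qed

lemma std_family_reindex:
  assumes "inj_on f I" "std_family M (f ` I) x p K"
  shows "std_family M I (\<lambda>i. x (f i)) p K"
  using assms prob_space.indep_vars_reindex[OF _ assms(1), of M "\<lambda>_. borel" x]
  unfolding std_family_def by auto

text \<open>Markov's inequality for the 2p-th power. Measuring the deviation in units of
  \<open>sqrt S\<close> cancels \<open>S\<close>, so the bound is uniform over coefficient
  matrices.\<close>

lemma moment_tail:
  assumes M: "prob_space M" and Y: "all_moments M Y"
    and m: "integral\<^sup>L M (\<lambda>\<omega>. Y \<omega> ^ (2 * p)) \<le> (C * S) ^ p" and C: "C \<ge> 0" and T: "T > 0" and S: "S > 0"
  shows "measure M {\<omega> \<in> space M. T * sqrt S < \<bar>Y \<omega>\<bar>} \<le> C ^ p / T ^ (2 * p)"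
proof -
  interpret prob_space M by fact
  note [measurable] = all_moments_borel[OF Y]
  have "integrable M (\<lambda>\<omega>. Y \<omega> ^ (2 * p))" using Y unfolding all_moments_def by blast
  then have "measure M {\<omega> \<in> space M. T ^ (2 * p) * S ^ p \<le> Y \<omega> ^ (2 * p)}
      \<le> integral\<^sup>L M (\<lambda>\<omega>. Y \<omega> ^ (2 * p)) / (T ^ (2 * p) * S ^ p)"
    using T S by (intro integral_Markov_inequality_measure[where A = "space M"]) (auto simp: power_mult)
  also have "\<dots> \<le> (C * S) ^ p / (T ^ (2 * p) * S ^ p)"
    using T S m by (intro divide_right_mono) auto
  also have "\<dots> = C ^ p / T ^ (2 * p)" using S by (simp add: power_mult_distrib)
  finally have le: "measure M {\<omega> \<in> space M. T ^ (2 * p) * S ^ p \<le> Y \<omega> ^ (2 * p)} \<le> C ^ p / T ^ (2 * p)" .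
  have "T ^ (2 * p) * S ^ p \<le> y ^ (2 * p)" if "T * sqrt S < \<bar>y\<bar>" for y
  proof -
    have "(T * sqrt S) ^ (2 * p) \<le> \<bar>y\<bar> ^ (2 * p)" using that T S by (intro power_mono) auto
    then show ?thesis using S by (simp add: power_mult_distrib power_mult)
  qed
  then have "measure M {\<omega> \<in> space M. T * sqrt S < \<bar>Y \<omega>\<bar>}
      \<le> measure M {\<omega> \<in> space M. T ^ (2 * p) * S ^ p \<le> Y \<omega> ^ (2 * p)}"
    by (intro finite_measure_mono) auto
  then show ?thesis using le by linarith
qed

lemma quadratic_form_tail:
  fixes b :: "'i \<Rightarrow> 'i \<Rightarrow> real"
  assumes fin: "finite I" and p: "p \<ge> 1" and K: "K \<ge> 1" and x: "std_family M I x p K"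
    and sym: "\<And>k l. b k l = b l k" and T: "T > 0"
  shows "measure M {\<omega> \<in> space M. T * sqrt (\<Sum>k\<in>I. \<Sum>l\<in>I. (b k l)\<^sup>2)
      < \<bar>(\<Sum>k\<in>I. \<Sum>l\<in>I. b k l * x k \<omega> * x l \<omega>) - (\<Sum>k\<in>I. b k k)\<bar>} \<le> quad_const p K ^ p / T ^ (2 * p)"
proof -
  have M: "prob_space M" and am: "\<And>i. i \<in> I \<Longrightarrow> all_moments M (x i)"
    using x unfolding std_family_def by auto
  define S where "S = (\<Sum>k\<in>I. \<Sum>l\<in>I. (b k l)\<^sup>2)"
  have "S \<ge> 0" unfolding S_def by (intro sum_nonneg) auto
  then consider "S = 0" | "S > 0" by linarith
  then show ?thesis
  proof cases
    \<comment> \<open>All coefficients vanish; the strict inequality makes the event empty, which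
      avoids dividing by \<open>S\<close>.\<close>
    case 1
    have "b k l = 0" if "k \<in> I" "l \<in> I" for k l
    proof -
      have "(\<Sum>l\<in>I. (b k l)\<^sup>2) = 0"
        using 1 that fin unfolding S_def by (subst (asm) sum_nonneg_eq_0_iff) (auto intro: sum_nonneg)
      then show ?thesis using that fin by (subst (asm) sum_nonneg_eq_0_iff) auto
    qed
    then show ?thesis using T quad_const_nonneg[of p K] by simp
  next
    case 2
    show ?thesis unfolding S_def[symmetric]
    proof (rule moment_tail[OF M _ _ quad_const_nonneg T 2])
      show "integral\<^sup>L M (\<lambda>\<omega>. ((\<Sum>k\<in>I. \<Sum>l\<in>I. b k l * x k \<omega> * x l \<omega>) - (\<Sum>k\<in>I. b k k)) ^ (2 * p))
          \<le> (quad_const p K * S) ^ p"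
        unfolding S_def by (rule quadratic_form_moment[OF fin p K x sym])
      show "all_moments M (\<lambda>\<omega>. (\<Sum>k\<in>I. \<Sum>l\<in>I. b k l * x k \<omega> * x l \<omega>) - (\<Sum>k\<in>I. b k k))"
        by (intro all_moments_diff[OF M] all_moments_sum[OF M] all_moments_mult all_moments_const[OF M] am)
    qed
  qed
qed

abbreviation upper_indices :: "nat \<Rightarrow> (nat \<times> nat) set" where
  "upper_indices N \<equiv> {(i, j). i \<le> j \<and> j < N}"

text \<open>Row \<open>i\<close> is independent of the minor, so the tail bound for deterministic coefficients applies
  conditionally on the minor.\<close>

lemma row_quadratic_form_tail:
  fixes f :: "complex \<Rightarrow> real"
  assumes H: "\<And>\<omega>. \<omega> \<in> space M \<Longrightarrow> H \<omega> \<in> carrier_mat N N \<and> transpose_mat (H \<omega>) = H \<omega>"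
    and X: "std_family M (upper_indices N) (\<lambda>(i, j) \<omega>. sqrt (real N) * H \<omega> $$ (i, j)) p K"
    and p: "p \<ge> 1" and K: "K \<ge> 1" and i: "i < N" and z: "Im z > 0"
    and f[measurable]: "f \<in> borel_measurable borel" and T: "T > 0"
  obtains E where "E \<in> sets M" "measure M E \<le> quad_const p K ^ p / T ^ (2 * p)"
    "\<And>\<omega>. \<omega> \<in> space M - E \<Longrightarrow>
       \<bar>(\<Sum>k\<in>{..<N} - {i}. \<Sum>l\<in>{..<N} - {i}.
           H \<omega> $$ (i, k) * f (resolvent (zero_out i (H \<omega>)) z $$ (k, l)) * H \<omega> $$ (i, l))
        - (\<Sum>k\<in>{..<N} - {i}. f (resolvent (zero_out i (H \<omega>)) z $$ (k, k))) / real N\<bar>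
       \<le> T / real N * sqrt (\<Sum>k\<in>{..<N} - {i}. \<Sum>l\<in>{..<N} - {i}.
           (f (resolvent (zero_out i (H \<omega>)) z $$ (k, l)))\<^sup>2)"
proof -
  have M: "prob_space M" using X by (simp add: std_family_def)
  interpret prob_space M by fact
  define x where "x = (\<lambda>(i, j) \<omega>. sqrt (real N) * H \<omega> $$ (i, j))"
  \<comment> \<open>The upper triangular position that stores entry \<open>(i, k)\<close>. Row
    \<open>i\<close> off the diagonal occupies \<open>A\<close>, the minor occupies
    \<open>B\<close>, and these are disjoint.\<close>
  define e where "e k = (min i k, max i k)" for k
  let ?J = "{..<N} - {i}"
  define A where "A = e ` ?J"
  define B where "B = {(k, l). k \<le> l \<and> l < N \<and> k \<noteq> i \<and> l \<noteq> i}"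
  have N: "real N > 0" using i by simp
  have Hs: "H \<omega> $$ (k, l) = H \<omega> $$ (l, k)" if "\<omega> \<in> space M" "k < N" "l < N" for \<omega> k l
    using H[OF that(1)] that(2,3) by (metis carrier_matD index_transpose_mat(1))
  have AI: "A \<subseteq> upper_indices N" using i by (auto simp: A_def e_def)
  have BI: "B \<subseteq> upper_indices N" by (auto simp: B_def)
  have AB: "A \<inter> B = {}" by (auto simp: A_def B_def e_def min_def max_def split: if_splits)
  have inj: "inj_on e ?J" by (auto simp: inj_on_def e_def min_def max_def split: if_splits)
  have eA: "e k \<in> A" if "k \<in> ?J" for k using that by (simp add: A_def)
  have xe: "x (e k) \<omega> = sqrt (real N) * H \<omega> $$ (i, k)" if "k \<in> ?J" "\<omega> \<in> space M" for k \<omega>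
    using that i Hs[of \<omega> i k] by (auto simp: x_def e_def min_def max_def)
  have row: "std_family M ?J (\<lambda>k. x (e k)) p K"
    using X AI unfolding A_def x_def[symmetric] by (intro std_family_reindex[OF inj]) (rule std_family_subset)
  let ?PA = "PiM A (\<lambda>_. borel) :: (nat \<times> nat \<Rightarrow> real) measure"
  let ?PB = "PiM B (\<lambda>_. borel) :: (nat \<times> nat \<Rightarrow> real) measure"
  have ind: "indep_var ?PA (\<lambda>\<omega>. restrict (\<lambda>a. x a \<omega>) A) ?PB (\<lambda>\<omega>. restrict (\<lambda>a. x a \<omega>) B)"
    using X unfolding std_family_def x_def[symmetric] by (intro indep_var_restrict[OF _ AB AI BI]) auto
  \<comment> \<open>Rebuilds the minor from its coordinates in \<open>B\<close>, so its resolvent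
    becomes a function of a variable independent of the row.\<close>
  define Z where "Z y = mat N N (\<lambda>(k, l). if k = i \<or> l = i then 0 else y (min k l, max k l) / sqrt (real N))"
    for y :: "nat \<times> nat \<Rightarrow> real"
  have Z: "Z y \<in> carrier_mat N N" "transpose_mat (Z y) = Z y" for y
    by (auto simp: Z_def min.commute max.commute intro!: eq_matI)
  have Zx: "Z (restrict (\<lambda>a. x a \<omega>) B) = zero_out i (H \<omega>)" if w: "\<omega> \<in> space M" for \<omega>
  proof (rule eq_matI)
    fix k l assume "k < dim_row (zero_out i (H \<omega>))" "l < dim_col (zero_out i (H \<omega>))"
    then have kl: "k < N" "l < N" using H[OF w] by (auto simp: zero_out_def)
    have "x (min k l, max k l) \<omega> = sqrt (real N) * H \<omega> $$ (k, l)"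
      using Hs[OF w kl] by (auto simp: x_def min_def max_def)
    moreover have "(min k l, max k l) \<in> B" if "k \<noteq> i" "l \<noteq> i"
      using kl that by (auto simp: B_def min_def max_def)
    ultimately show "Z (restrict (\<lambda>a. x a \<omega>) B) $$ (k, l) = zero_out i (H \<omega>) $$ (k, l)"
      using kl H[OF w] N by (auto simp: Z_def zero_out_def)
  qed (use H[OF w] in \<open>auto simp: Z_def zero_out_def\<close>)
  define R where "R y k l = f (resolvent (Z y) z $$ (k, l))" for y k l
  have R_meas: "(\<lambda>y. R y k l) \<in> borel_measurable ?PB" if "k < N" "l < N" for k l
  proof -
    have "(\<lambda>y. resolvent (Z y) z $$ (k, l)) \<in> borel_measurable ?PB"
    proof (rule borel_measurable_resolvent[OF _ _ z that])
      fix a b assume ab: "a < N" "b < N"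
      show "(\<lambda>y. Z y $$ (a, b)) \<in> borel_measurable ?PB"
      proof (cases "a = i \<or> b = i")
        case True then show ?thesis using ab by (simp add: Z_def)
      next
        case False
        then have "(min a b, max a b) \<in> B" using ab by (auto simp: B_def min_def max_def)
        then have "(\<lambda>y. y (min a b, max a b)) \<in> borel_measurable ?PB"
          by (rule measurable_component_singleton)
        then show ?thesis using False ab by (simp add: Z_def)
      qed
    qed (use Z in auto)
    then show ?thesis unfolding R_def by measurable
  qed
  have R_sym: "R y k l = R y l k" if "k < N" "l < N" for y k l
  proof -
    interpret resolvent_setup N "Z y" z using Z z by unfold_locales
    show ?thesis using G_sym[OF that] by (simp add: R_def G_def)
  qed
  define V where "V y = (\<Sum>k\<in>?J. \<Sum>l\<in>?J. (R y k l)\<^sup>2)" for y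
  define Q where "Q u y = (\<Sum>k\<in>?J. \<Sum>l\<in>?J. R y k l * u (e k) * u (e l)) - (\<Sum>k\<in>?J. R y k k)"
    for u :: "nat \<times> nat \<Rightarrow> real" and y
  define S where "S = {w \<in> space (?PA \<Otimes>\<^sub>M ?PB). T * sqrt (V (snd w)) < \<bar>Q (fst w) (snd w)\<bar>}"
  have R2: "(\<lambda>w. R (snd w) k l) \<in> borel_measurable (?PA \<Otimes>\<^sub>M ?PB)" if "k \<in> ?J" "l \<in> ?J" for k l
    using that by (intro measurable_compose[OF measurable_snd R_meas]) auto
  have u1: "(\<lambda>w. fst w (e k)) \<in> borel_measurable (?PA \<Otimes>\<^sub>M ?PB)" if "k \<in> ?J" for k
    by (rule measurable_compose[OF measurable_fst measurable_component_singleton[OF eA[OF that]]])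
  have Vm: "(\<lambda>w. V (snd w)) \<in> borel_measurable (?PA \<Otimes>\<^sub>M ?PB)"
    unfolding V_def by (intro borel_measurable_sum borel_measurable_power R2)
  have Qm: "(\<lambda>w. Q (fst w) (snd w)) \<in> borel_measurable (?PA \<Otimes>\<^sub>M ?PB)"
    unfolding Q_def by (intro borel_measurable_diff borel_measurable_sum borel_measurable_times R2 u1)
  have S: "S \<in> sets (?PA \<Otimes>\<^sub>M ?PB)"
    using Vm Qm unfolding S_def by measurable
  define E where "E = {\<omega> \<in> space M. (restrict (\<lambda>a. x a \<omega>) A, restrict (\<lambda>a. x a \<omega>) B) \<in> S}"
  have rvA: "(\<lambda>\<omega>. restrict (\<lambda>a. x a \<omega>) A) \<in> measurable M ?PA"
    and rvB: "(\<lambda>\<omega>. restrict (\<lambda>a. x a \<omega>) B) \<in> measurable M ?PB"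
    using ind by (auto dest: indep_var_rv1 indep_var_rv2)
  show thesis
  proof (rule that[of E])
    show "E \<in> sets M"
      unfolding E_def using S rvA rvB by measurable
    show "measure M E \<le> quad_const p K ^ p / T ^ (2 * p)"
      unfolding E_def
    proof (rule indep_var_prob_le[OF ind S])
      fix y assume y: "y \<in> space ?PB"
      \<comment> \<open>The tail bound asks for symmetry at all indices, but \<open>R\<close> is
        known to be symmetric only below \<open>N\<close>; hence the extension by zero.\<close>
      define b where "b k l = (if k < N \<and> l < N then R y k l else 0)" for k l
      have bR: "b k l = R y k l" if "k \<in> ?J" "l \<in> ?J" for k l using that by (simp add: b_def)
      have "measure M {\<omega> \<in> space M. T * sqrt (\<Sum>k\<in>?J. \<Sum>l\<in>?J. (b k l)\<^sup>2)
        < \<bar>(\<Sum>k\<in>?J. \<Sum>l\<in>?J. b k l * x (e k) \<omega> * x (e l) \<omega>) - (\<Sum>k\<in>?J. b k k)\<bar>} \<le> quad_const p K ^ p / T ^ (2 * p)"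
        using R_sym by (intro quadratic_form_tail[OF _ p K row _ T]) (auto simp: b_def)
      also have "{\<omega> \<in> space M. T * sqrt (\<Sum>k\<in>?J. \<Sum>l\<in>?J. (b k l)\<^sup>2)
        < \<bar>(\<Sum>k\<in>?J. \<Sum>l\<in>?J. b k l * x (e k) \<omega> * x (e l) \<omega>) - (\<Sum>k\<in>?J. b k k)\<bar>}
        = {\<omega> \<in> space M. (restrict (\<lambda>a. x a \<omega>) A, y) \<in> S}"
      proof -
        have "(\<Sum>k\<in>?J. \<Sum>l\<in>?J. (b k l)\<^sup>2) = V y"
          unfolding V_def by (intro sum.cong refl) (simp add: bR)
        moreover have "(\<Sum>k\<in>?J. \<Sum>l\<in>?J. b k l * x (e k) \<omega> * x (e l) \<omega>) - (\<Sum>k\<in>?J. b k k)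
            = Q (restrict (\<lambda>a. x a \<omega>) A) y" for \<omega>
          unfolding Q_def by (intro arg_cong2[where f = "(-)"] sum.cong refl) (simp_all add: bR eA)
        ultimately show ?thesis
          using y measurable_space[OF rvA] by (auto simp: S_def space_pair_measure)
      qed
      finally show "prob {\<omega> \<in> space M. (restrict (\<lambda>a. x a \<omega>) A, y) \<in> S} \<le> quad_const p K ^ p / T ^ (2 * p)" .
    qed
  next
    fix \<omega> assume w: "\<omega> \<in> space M - E"
    define y where "y = restrict (\<lambda>a. x a \<omega>) B"
    define g where "g k l = f (resolvent (zero_out i (H \<omega>)) z $$ (k, l))" for k l
    have Rg: "R y k l = g k l" for k l using Zx w by (simp add: R_def g_def y_def)
    have "\<not> T * sqrt (V y) < \<bar>Q (restrict (\<lambda>a. x a \<omega>) A) y\<bar>"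
      using w measurable_space[OF rvA] measurable_space[OF rvB]
      unfolding E_def S_def y_def by (auto simp: space_pair_measure)
    moreover have "Q (restrict (\<lambda>a. x a \<omega>) A) y = real N *
       ((\<Sum>k\<in>?J. \<Sum>l\<in>?J. H \<omega> $$ (i, k) * g k l * H \<omega> $$ (i, l)) - (\<Sum>k\<in>?J. g k k) / real N)"
    proof -
      have "(\<Sum>k\<in>?J. \<Sum>l\<in>?J. R y k l * restrict (\<lambda>a. x a \<omega>) A (e k) * restrict (\<lambda>a. x a \<omega>) A (e l))
          = (\<Sum>k\<in>?J. \<Sum>l\<in>?J. real N * (H \<omega> $$ (i, k) * g k l * H \<omega> $$ (i, l)))"
      proof (intro sum.cong refl)
        fix k l assume kl: "k \<in> ?J" "l \<in> ?J"
        have "R y k l * restrict (\<lambda>a. x a \<omega>) A (e k) * restrict (\<lambda>a. x a \<omega>) A (e l)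
            = (sqrt (real N) * sqrt (real N)) * (H \<omega> $$ (i, k) * g k l * H \<omega> $$ (i, l))"
          using kl w by (simp add: Rg xe eA del: real_sqrt_mult_self)
        then show "R y k l * restrict (\<lambda>a. x a \<omega>) A (e k) * restrict (\<lambda>a. x a \<omega>) A (e l)
            = real N * (H \<omega> $$ (i, k) * g k l * H \<omega> $$ (i, l))" by simp
      qed
      then show ?thesis unfolding Q_def using N
        by (simp add: Rg sum_distrib_left[symmetric] right_diff_distrib)
    qed
    moreover have "V y = (\<Sum>k\<in>?J. \<Sum>l\<in>?J. (g k l)\<^sup>2)" by (simp add: V_def Rg)
    ultimately have "real N * \<bar>(\<Sum>k\<in>?J. \<Sum>l\<in>?J. H \<omega> $$ (i, k) * g k l * H \<omega> $$ (i, l)) - (\<Sum>k\<in>?J. g k k) / real N\<bar>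
        \<le> T * sqrt (\<Sum>k\<in>?J. \<Sum>l\<in>?J. (g k l)\<^sup>2)"
      by (simp add: abs_mult)
    then show "\<bar>(\<Sum>k\<in>?J. \<Sum>l\<in>?J. H \<omega> $$ (i, k) * f (resolvent (zero_out i (H \<omega>)) z $$ (k, l)) * H \<omega> $$ (i, l))
        - (\<Sum>k\<in>?J. f (resolvent (zero_out i (H \<omega>)) z $$ (k, k))) / real N\<bar>
       \<le> T / real N * sqrt (\<Sum>k\<in>?J. \<Sum>l\<in>?J. (f (resolvent (zero_out i (H \<omega>)) z $$ (k, l)))\<^sup>2)"
      using N unfolding g_def by (simp add: pos_le_divide_eq mult.commute)
  qed
qed

subsection \<open>The local law\<close>

lemma wigner_std_family:
  fixes \<rho> :: "real \<Rightarrow> real"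
  assumes M: "prob_space M" and w: "wigner_matrix M \<rho> N H"
    and pos: "\<And>x. \<rho> x \<ge> 0" and mom: "\<And>n. integrable lborel (\<lambda>x. \<rho> x * x ^ n)"
    and mean: "(LBINT x. \<rho> x * x) = 0" and var: "(LBINT x. \<rho> x * x\<^sup>2) = 1"
    and K: "(LBINT x. \<rho> x * x ^ (2 * p)) \<le> K ^ p" "(LBINT x. \<rho> x * x ^ (2 * (2 * p))) \<le> K ^ (2 * p)"
  shows "std_family M (upper_indices N) (\<lambda>(i, j) \<omega>. sqrt (real N) * H \<omega> $$ (i, j)) p K"
proof -
  interpret prob_space M by fact
  have ind: "indep_vars (\<lambda>_. borel) (\<lambda>(i, j) \<omega>. H \<omega> $$ (i, j)) (upper_indices N)"
    and distr: "\<And>i j. i \<le> j \<Longrightarrow> j < N \<Longrightarrow>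
      distributed M lborel (\<lambda>\<omega>. sqrt (real N) * H \<omega> $$ (i, j)) (\<lambda>x. ennreal (\<rho> x))"
    using w unfolding wigner_matrix_def by auto
  have "indep_vars (\<lambda>_. borel) (\<lambda>a \<omega>. sqrt (real N) * (\<lambda>(i, j) \<omega>. H \<omega> $$ (i, j)) a \<omega>) (upper_indices N)"
    by (rule indep_vars_compose2[OF ind]) simp
  moreover have "(\<lambda>a \<omega>. sqrt (real N) * (\<lambda>(i, j) \<omega>. H \<omega> $$ (i, j)) a \<omega>)
      = (\<lambda>(i, j) \<omega>. sqrt (real N) * H \<omega> $$ (i, j))" by (auto simp: fun_eq_iff)
  ultimately have ind': "indep_vars (\<lambda>_. borel) (\<lambda>(i, j) \<omega>. sqrt (real N) * H \<omega> $$ (i, j)) (upper_indices N)"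
    by simp
  have moments: "all_moments M x \<and> integral\<^sup>L M x = 0 \<and> integral\<^sup>L M (\<lambda>\<omega>. (x \<omega>)\<^sup>2) = 1 \<and>
      integral\<^sup>L M (\<lambda>\<omega>. x \<omega> ^ (2 * p)) \<le> K ^ p \<and> integral\<^sup>L M (\<lambda>\<omega>. x \<omega> ^ (2 * (2 * p))) \<le> K ^ (2 * p)"
    if "distributed M lborel x (\<lambda>x. ennreal (\<rho> x))" for x
  proof -
    have "integrable M (\<lambda>\<omega>. x \<omega> ^ n)" for n
      using distributed_integrable[OF that, of "\<lambda>t. t ^ n"] pos mom by simp
    moreover have "integral\<^sup>L M (\<lambda>\<omega>. x \<omega> ^ n) = (LBINT t. \<rho> t * t ^ n)" for n
      using distributed_integral[OF that, of "\<lambda>t. t ^ n"] pos by simp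
    moreover from this[of 1] have "integral\<^sup>L M x = (LBINT t. \<rho> t * t)" by simp
    moreover have "x \<in> borel_measurable M" using distributed_measurable[OF that] by simp
    ultimately show ?thesis using mean var K unfolding all_moments_def by simp
  qed
  show ?thesis
    unfolding std_family_def
  proof (intro conjI[OF M] conjI[OF ind'] ballI)
    fix a assume "a \<in> upper_indices N"
    then obtain i j where a: "a = (i, j)" "i \<le> j" "j < N" by auto
    show "all_moments M ((\<lambda>(i, j) \<omega>. sqrt (real N) * H \<omega> $$ (i, j)) a) \<and>
        integral\<^sup>L M ((\<lambda>(i, j) \<omega>. sqrt (real N) * H \<omega> $$ (i, j)) a) = 0 \<and>
        integral\<^sup>L M (\<lambda>\<omega>. ((\<lambda>(i, j) \<omega>. sqrt (real N) * H \<omega> $$ (i, j)) a \<omega>)\<^sup>2) = 1 \<and>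
        integral\<^sup>L M (\<lambda>\<omega>. (\<lambda>(i, j) \<omega>. sqrt (real N) * H \<omega> $$ (i, j)) a \<omega> ^ (2 * p)) \<le> K ^ p \<and>
        integral\<^sup>L M (\<lambda>\<omega>. (\<lambda>(i, j) \<omega>. sqrt (real N) * H \<omega> $$ (i, j)) a \<omega> ^ (2 * (2 * p))) \<le> K ^ (2 * p)"
      unfolding a(1) prod.case by (rule moments[OF distr[OF a(2,3)]])
  qed
qed

text \<open>Three bad events: real part of the form, imaginary part, diagonal entry. The split is
  forced by the moment bound, which is for real coefficients.\<close>

lemma row_fluctuation_prob:
  assumes H: "\<And>\<omega>. \<omega> \<in> space M \<Longrightarrow> H \<omega> \<in> carrier_mat N N \<and> transpose_mat (H \<omega>) = H \<omega>"
    and X: "std_family M (upper_indices N) (\<lambda>(i, j) \<omega>. sqrt (real N) * H \<omega> $$ (i, j)) p K"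
    and p: "p \<ge> 1" and K: "K \<ge> 1" and i: "i < N" and z: "Im z > 0" and T: "T > 0"
  obtains E where "E \<in> sets M" "measure M E \<le> 3 * (quad_const p K ^ p / T ^ (2 * p))"
    "\<And>\<omega>. \<omega> \<in> space M - E \<Longrightarrow> row_fluctuation_le N (H \<omega>) T z i"
proof -
  have M: "prob_space M" using X by (simp add: std_family_def)
  interpret prob_space M by fact
  define C where "C = quad_const p K ^ p / T ^ (2 * p)"
  have N: "real N > 0" using i by simp
  let ?J = "{..<N} - {i}"
  define g where "g \<omega> k l = resolvent (zero_out i (H \<omega>)) z $$ (k, l)" for \<omega> k l
  obtain E1 where E1: "E1 \<in> sets M" "measure M E1 \<le> C"
    "\<And>\<omega>. \<omega> \<in> space M - E1 \<Longrightarrow>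
       \<bar>(\<Sum>k\<in>?J. \<Sum>l\<in>?J. H \<omega> $$ (i, k) * Re (g \<omega> k l) * H \<omega> $$ (i, l)) - (\<Sum>k\<in>?J. Re (g \<omega> k k)) / real N\<bar>
       \<le> T / real N * sqrt (\<Sum>k\<in>?J. \<Sum>l\<in>?J. (Re (g \<omega> k l))\<^sup>2)"
    unfolding C_def g_def using row_quadratic_form_tail[OF H X p K i z borel_measurable_Re T] by blast
  obtain E2 where E2: "E2 \<in> sets M" "measure M E2 \<le> C"
    "\<And>\<omega>. \<omega> \<in> space M - E2 \<Longrightarrow>
       \<bar>(\<Sum>k\<in>?J. \<Sum>l\<in>?J. H \<omega> $$ (i, k) * Im (g \<omega> k l) * H \<omega> $$ (i, l)) - (\<Sum>k\<in>?J. Im (g \<omega> k k)) / real N\<bar>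
       \<le> T / real N * sqrt (\<Sum>k\<in>?J. \<Sum>l\<in>?J. (Im (g \<omega> k l))\<^sup>2)"
    unfolding C_def g_def using row_quadratic_form_tail[OF H X p K i z borel_measurable_Im T] by blast
  define x where "x \<omega> = sqrt (real N) * H \<omega> $$ (i, i)" for \<omega>
  have x: "all_moments M x" "integral\<^sup>L M (\<lambda>\<omega>. x \<omega> ^ (2 * p)) \<le> K ^ p"
    using X i unfolding std_family_def x_def by auto
  note [measurable] = all_moments_borel[OF x(1)]
  define E3 where "E3 = {\<omega> \<in> space M. T * sqrt 1 < \<bar>x \<omega>\<bar>}"
  \<comment> \<open>Lets the tail of the diagonal entry share the bound of the two quadratic
    forms.\<close>
  have "K \<le> quad_const p K"
  proof -
    have "1 \<le> (mart_const p)\<^sup>2" using mart_const_ge_1 by (rule one_le_power)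
    then have "1 \<le> 32 * (mart_const p)\<^sup>2" by linarith
    then have "1 * (1 * K) \<le> (32 * (mart_const p)\<^sup>2) * (K * K)"
      using K by (intro mult_mono mult_right_mono) auto
    then show ?thesis by (simp add: quad_const_def power2_eq_square mult.assoc)
  qed
  then have "K ^ p \<le> quad_const p K ^ p" using K by (intro power_mono) auto
  then have x2: "integral\<^sup>L M (\<lambda>\<omega>. x \<omega> ^ (2 * p)) \<le> (quad_const p K * 1) ^ p" using x(2) by simp
  have E3: "E3 \<in> sets M" "measure M E3 \<le> C"
  proof -
    show "E3 \<in> sets M" unfolding E3_def by measurable
    show "measure M E3 \<le> C" unfolding E3_def C_def
      by (rule moment_tail[OF M x(1) x2]) (use T quad_const_nonneg in auto)
  qed
  show thesis
  proof (rule that[of "E1 \<union> E2 \<union> E3"])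
    show "E1 \<union> E2 \<union> E3 \<in> sets M" using E1 E2 E3 by auto
    have "measure M (E1 \<union> E2 \<union> E3) \<le> measure M E1 + measure M E2 + measure M E3"
      using measure_Un_le[of "E1 \<union> E2" M E3] measure_Un_le[of E1 M E2] E1(1) E2(1) E3(1) by auto
    then show "measure M (E1 \<union> E2 \<union> E3) \<le> 3 * (quad_const p K ^ p / T ^ (2 * p))"
      using E1(2) E2(2) E3(2) unfolding C_def[symmetric] by linarith
  next
    fix \<omega> assume w: "\<omega> \<in> space M - (E1 \<union> E2 \<union> E3)"
    define D where "D = (\<Sum>k\<in>?J. \<Sum>l\<in>?J. complex_of_real (H \<omega> $$ (i, k)) * g \<omega> k l * complex_of_real (H \<omega> $$ (i, l)))
       - (\<Sum>k\<in>?J. g \<omega> k k) / of_nat N"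
    define S where "S = (\<Sum>k\<in>?J. \<Sum>l\<in>?J. (cmod (g \<omega> k l))\<^sup>2)"
    have le: "(\<Sum>k\<in>?J. \<Sum>l\<in>?J. (Re (g \<omega> k l))\<^sup>2) \<le> S" "(\<Sum>k\<in>?J. \<Sum>l\<in>?J. (Im (g \<omega> k l))\<^sup>2) \<le> S"
      unfolding S_def by (intro sum_mono; simp add: cmod_power2)+
    have TN: "T / real N \<ge> 0" using T by simp
    have "\<bar>Re D\<bar> \<le> T / real N * sqrt (\<Sum>k\<in>?J. \<Sum>l\<in>?J. (Re (g \<omega> k l))\<^sup>2)"
      using E1(3)[of \<omega>] w by (simp add: D_def Re_divide_of_nat)
    also have "\<dots> \<le> T / real N * sqrt S" using le TN by (intro mult_left_mono real_sqrt_le_mono) auto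
    finally have re: "\<bar>Re D\<bar> \<le> T / real N * sqrt S" .
    have "\<bar>Im D\<bar> \<le> T / real N * sqrt (\<Sum>k\<in>?J. \<Sum>l\<in>?J. (Im (g \<omega> k l))\<^sup>2)"
      using E2(3)[of \<omega>] w by (simp add: D_def Im_divide_of_nat)
    also have "\<dots> \<le> T / real N * sqrt S" using le TN by (intro mult_left_mono real_sqrt_le_mono) auto
    finally have im: "\<bar>Im D\<bar> \<le> T / real N * sqrt S" .
    have "cmod D \<le> 2 * T / real N * sqrt S" using re im cmod_le[of D] by simp
    moreover have "\<bar>H \<omega> $$ (i, i)\<bar> \<le> T / sqrt (real N)"
      using w N unfolding E3_def x_def by (auto simp: abs_mult pos_le_divide_eq mult.commute)
    ultimately show "row_fluctuation_le N (H \<omega>) T z i"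
      unfolding row_fluctuation_le_def D_def S_def g_def by blast
  qed
qed

text \<open>Union bound: 3 events for each of at most \<open>10 * N ^ 6\<close> grid points and
  \<open>N\<close> rows. Off the union, the deterministic statement covers the whole continuum of
  \<open>z\<close>.\<close>

lemma local_law_prob:
  assumes H: "\<And>\<omega>. \<omega> \<in> space M \<Longrightarrow> H \<omega> \<in> carrier_mat N N \<and> transpose_mat (H \<omega>) = H \<omega>"
    and X: "std_family M (upper_indices N) (\<lambda>(i, j) \<omega>. sqrt (real N) * H \<omega> $$ (i, j)) p K"
    and p: "p \<ge> 1" and K: "K \<ge> 1" and N: "N > 0" and T: "T \<ge> 1" and \<eta>: "\<eta> > 0" "1 \<le> real N * \<eta>"
    and c: "0 < c" "c \<le> 1" "\<And>z. W1 \<le> Re z \<Longrightarrow> Re z \<le> W2 \<Longrightarrow> 0 < Im z \<Longrightarrow> Im z \<le> 1 \<Longrightarrow> c \<le> Im (msc z)"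
    and W: "W2 - W1 \<le> 4"
    and B: "B = 24 * T / (sqrt (real N * \<eta>) * c\<^sup>2)" "B + 2 / real N \<le> c / 2"
  obtains E where "E \<in> sets M" "measure M E \<le> 30 * real N ^ 7 * (quad_const p K ^ p / T ^ (2 * p))"
    "\<And>\<omega> z. \<omega> \<in> space M - E \<Longrightarrow> z \<in> spectral_domain {W1..W2} \<eta> \<Longrightarrow>
       cmod (ntr (resolvent (H \<omega>) z) - msc z) \<le> B + 4 / real N"
proof -
  interpret prob_space M using X by (simp add: std_family_def)
  define C where "C = quad_const p K ^ p / T ^ (2 * p)"
  have C0: "C \<ge> 0" using T quad_const_nonneg[of p K] by (simp add: C_def)
  let ?\<Gamma> = "spectral_grid N W1 W2 \<eta> \<times> {..<N}"
  have fin: "finite ?\<Gamma>" using finite_spectral_grid[OF N] by auto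
  have "\<exists>E. E \<in> sets M \<and> measure M E \<le> 3 * C \<and>
      (\<forall>\<omega>\<in>space M - E. row_fluctuation_le N (H \<omega>) T (fst a) (snd a))" if "a \<in> ?\<Gamma>" for a
  proof -
    have "snd a < N" "\<eta> \<le> Im (fst a)" using that by (auto simp: spectral_grid_def)
    then have sa: "snd a < N" "Im (fst a) > 0" using \<eta>(1) by auto
    have T0: "T > 0" using T by simp
    show ?thesis
    proof (rule row_fluctuation_prob[OF H X p K sa T0])
      fix E assume "E \<in> sets M" "measure M E \<le> 3 * (quad_const p K ^ p / T ^ (2 * p))"
        "\<And>\<omega>. \<omega> \<in> space M - E \<Longrightarrow> row_fluctuation_le N (H \<omega>) T (fst a) (snd a)"
      then show ?thesis unfolding C_def by (intro exI[of _ E] conjI ballI)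
    qed
  qed
  then have "\<forall>a\<in>?\<Gamma>. \<exists>E. E \<in> sets M \<and> measure M E \<le> 3 * C \<and>
      (\<forall>\<omega>\<in>space M - E. row_fluctuation_le N (H \<omega>) T (fst a) (snd a))"
    by (rule ballI)
  from bchoice[OF this] obtain E where E': "\<forall>a\<in>?\<Gamma>. E a \<in> sets M \<and> measure M (E a) \<le> 3 * C \<and>
      (\<forall>\<omega>\<in>space M - E a. row_fluctuation_le N (H \<omega>) T (fst a) (snd a))"
    by (elim exE)
  have E: "E a \<in> sets M" "measure M (E a) \<le> 3 * C"
    "\<omega> \<in> space M - E a \<Longrightarrow> row_fluctuation_le N (H \<omega>) T (fst a) (snd a)" if "a \<in> ?\<Gamma>" for a \<omega>
    using bspec[OF E' that] by blast+
  show thesis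
  proof (rule that[of "\<Union>a\<in>?\<Gamma>. E a"])
    show "(\<Union>a\<in>?\<Gamma>. E a) \<in> sets M" using E(1) fin by auto
    have "measure M (\<Union>a\<in>?\<Gamma>. E a) \<le> (\<Sum>a\<in>?\<Gamma>. measure M (E a))"
      using fin E(1) by (intro measure_UNION_le) auto
    also have "\<dots> \<le> (\<Sum>a\<in>?\<Gamma>. 3 * C)" by (intro sum_mono E(2))
    also have "\<dots> = real (card (spectral_grid N W1 W2 \<eta>) * N) * (3 * C)"
      by (simp add: card_cartesian_product)
    also have "\<dots> \<le> real (10 * N ^ 6 * N) * (3 * C)"
      using card_spectral_grid[OF N, of W1 W2 \<eta>] C0 by (intro mult_right_mono of_nat_mono mult_le_mono1) auto
    also have "\<dots> = 30 * real N ^ 7 * C" by (simp add: numeral_eq_Suc)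
    finally show "measure M (\<Union>a\<in>?\<Gamma>. E a) \<le> 30 * real N ^ 7 * (quad_const p K ^ p / T ^ (2 * p))"
      unfolding C_def .
  next
    fix \<omega> z assume w: "\<omega> \<in> space M - (\<Union>a\<in>?\<Gamma>. E a)" and z: "z \<in> spectral_domain {W1..W2} \<eta>"
    have h: "H \<omega> \<in> carrier_mat N N" "transpose_mat (H \<omega>) = H \<omega>" using H w by auto
    show "cmod (ntr (resolvent (H \<omega>) z) - msc z) \<le> B + 4 / real N"
    proof (rule local_law_deterministic[OF h N T \<eta>(2) order_refl c W B _ z])
      fix z i assume "z \<in> spectral_grid N W1 W2 \<eta>" "i < N"
      then show "row_fluctuation_le N (H \<omega>) T z i" using E(3)[of "(z, i)" \<omega>] w by auto
    qed
  qed
qed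

section \<open>Measurability of the supremum\<close>

text \<open>For each fixed sample the function is Lipschitz in \<open>z\<close> with constant 2N^2
  on the domain, so a countable dense subset has the same supremum.\<close>

lemma borel_measurable_SUP_resolvent:
  assumes H: "\<And>\<omega>. \<omega> \<in> space M \<Longrightarrow> H \<omega> \<in> carrier_mat N N \<and> transpose_mat (H \<omega>) = H \<omega>"
    and meas: "\<And>i j. i \<le> j \<Longrightarrow> j < N \<Longrightarrow> (\<lambda>\<omega>. H \<omega> $$ (i, j)) \<in> borel_measurable M"
    and N: "N > 0" and \<eta>: "1 / real N \<le> \<eta>"
  shows "(\<lambda>\<omega>. SUP z\<in>spectral_domain W \<eta>. ennreal (cmod (ntr (resolvent (H \<omega>) z) - msc z))) \<in> borel_measurable M"
proof -
  let ?S = "spectral_domain W \<eta>"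
  let ?f = "\<lambda>\<omega> z. cmod (ntr (resolvent (H \<omega>) z) - msc z)"
  obtain D where D: "countable D" "D \<subseteq> ?S" "?S \<subseteq> closure D" by (rule separable)
  have \<eta>0: "\<eta> > 0" using N \<eta> by (smt (verit) divide_pos_pos of_nat_0_less_iff)
  have entry: "(\<lambda>\<omega>. H \<omega> $$ (i, j)) \<in> borel_measurable M" if "i < N" "j < N" for i j
  proof (cases "i \<le> j")
    case True then show ?thesis using meas that by auto
  next
    case False
    have "H \<omega> $$ (i, j) = H \<omega> $$ (j, i)" if "\<omega> \<in> space M" for \<omega>
      using H[OF that] \<open>i < N\<close> \<open>j < N\<close> by (metis carrier_matD index_transpose_mat(1))
    then show ?thesis using meas[of j i] False that by (subst measurable_cong) auto
  qed
  have fm: "(\<lambda>\<omega>. ennreal (?f \<omega> z)) \<in> borel_measurable M" if z: "z \<in> ?S" for z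
  proof -
    have z0: "Im z > 0" using z \<eta>0 by (simp add: spectral_domain_def)
    have "(\<lambda>\<omega>. (\<Sum>k<N. resolvent (H \<omega>) z $$ (k, k)) / of_nat N) \<in> borel_measurable M"
      using z0 by (intro borel_measurable_divide borel_measurable_sum borel_measurable_const
          borel_measurable_resolvent[OF H entry]) auto
    moreover have "ntr (resolvent (H \<omega>) z) = (\<Sum>k<N. resolvent (H \<omega>) z $$ (k, k)) / of_nat N" if "\<omega> \<in> space M" for \<omega>
    proof -
      interpret resolvent_setup N "H \<omega>" z using H[OF that] z0 by unfold_locales auto
      show ?thesis using ntr_resolvent by (simp add: G_def)
    qed
    ultimately have "(\<lambda>\<omega>. ntr (resolvent (H \<omega>) z)) \<in> borel_measurable M" by (subst measurable_cong) auto
    then show ?thesis by measurable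
  qed
  have eq: "(SUP z\<in>?S. ennreal (?f \<omega> z)) = (SUP z\<in>D. ennreal (?f \<omega> z))" if w: "\<omega> \<in> space M" for \<omega>
  proof (rule antisym)
    show "(SUP z\<in>D. ennreal (?f \<omega> z)) \<le> (SUP z\<in>?S. ennreal (?f \<omega> z))"
      using D(2) by (rule SUP_subset_mono) simp
    show "(SUP z\<in>?S. ennreal (?f \<omega> z)) \<le> (SUP z\<in>D. ennreal (?f \<omega> z))"
    proof (rule SUP_least, rule ennreal_le_epsilon)
      fix z and e :: real assume z: "z \<in> ?S" and e: "0 < e"
      define d where "d = e / (2 * (real N)\<^sup>2)"
      have d: "d > 0" using e N by (simp add: d_def)
      have "z \<in> closure D" using D(3) z by (rule subsetD)
      then have "\<exists>t\<in>D. dist t z < d" using d unfolding closure_approachable by (elim allE impE)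
      then obtain t where t: "t \<in> D" "dist t z < d" by (elim bexE)
      have tS: "t \<in> ?S" using t D by auto
      have "?f \<omega> z \<le> ?f \<omega> t + 2 * (real N)\<^sup>2 * cmod (z - t)"
        using H[OF w] N z tS \<eta> by (intro resolvent_msc_diff_Lipschitz) (auto simp: spectral_domain_def)
      also have "2 * (real N)\<^sup>2 * cmod (z - t) \<le> 2 * (real N)\<^sup>2 * d"
        using t by (intro mult_left_mono) (auto simp: dist_norm norm_minus_commute)
      also have "\<dots> = e" using N by (simp add: d_def)
      finally have "ennreal (?f \<omega> z) \<le> ennreal (?f \<omega> t) + ennreal e"
        using e by (simp add: ennreal_plus[symmetric] ennreal_leI del: ennreal_plus)
      also have "\<dots> \<le> (SUP z\<in>D. ennreal (?f \<omega> z)) + ennreal e"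
        using t(1) by (intro add_right_mono SUP_upper)
      finally show "ennreal (?f \<omega> z) \<le> (SUP z\<in>D. ennreal (?f \<omega> z)) + ennreal e" .
    qed
  qed
  have "(\<lambda>\<omega>. SUP z\<in>D. ennreal (?f \<omega> z)) \<in> borel_measurable M"
    using D by (intro borel_measurable_SUP fm) auto
  then show ?thesis using eq by (subst measurable_cong) auto
qed

theorem theorem1p2:
  fixes \<rho> :: "real \<Rightarrow> real"
    and M :: "nat \<Rightarrow> 'a measure"
    and H :: "nat \<Rightarrow> 'a \<Rightarrow> real mat"
    and \<kappa> W1 W2 \<theta> :: real
    and \<eta> :: "nat \<Rightarrow> real"
  assumes density_pos: "\<And>x. \<rho> x > 0"
    and density_prob: "has_bochner_integral lborel \<rho> 1"
    and density_mean: "has_bochner_integral lborel (\<lambda>x. x * \<rho> x) 0"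
    and density_var: "has_bochner_integral lborel (\<lambda>x. x\<^sup>2 * \<rho> x) 1"
    and tail_bounded: "bounded (range (tail_ratio \<rho>))"
    and tail_Lipschitz: "\<exists>L. L-lipschitz_on UNIV (tail_ratio \<rho>)"
    and prob: "\<And>N. N \<ge> 1 \<Longrightarrow> prob_space (M N)"
    and wigner: "\<And>N. N \<ge> 1 \<Longrightarrow> wigner_matrix (M N) \<rho> N (H N)"
    and kappa: "\<kappa> > 0"
    and W: "W1 \<le> W2" "{W1..W2} \<subseteq> {-2 + \<kappa>..2 - \<kappa>}"
    and theta: "0 < \<theta>" "\<theta> < 1"
    and eta: "\<And>N. \<eta> N = real N powr (-1 + \<theta>)"
  shows "stoch_dom_single M
    (\<lambda>N \<omega>. SUP z\<in>spectral_domain {W1..W2} (\<eta> N).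
       ennreal (cmod (ntr (resolvent (H N \<omega>) z) - msc z)))
    (\<lambda>N \<omega>. ennreal (1 / sqrt (real N * \<eta> N)))"
proof -
  define c where "c = sqrt (\<kappa> / 32)"
  have W': "-2 + \<kappa> \<le> W1" "W2 \<le> 2 - \<kappa>" using W by auto
  have \<kappa>2: "\<kappa> \<le> 2" using W' W(1) by linarith
  have c: "0 < c" "c \<le> 1" using kappa \<kappa>2 by (auto simp: c_def)
  have c_bulk: "c \<le> Im (msc z)" if "W1 \<le> Re z" "Re z \<le> W2" "0 < Im z" "Im z \<le> 1" for z
    unfolding c_def using that W' kappa by (intro Im_msc_bulk) auto
  have pos: "\<And>x. \<rho> x \<ge> 0" using density_pos less_imp_le by blast
  have mom: "integrable lborel (\<lambda>x. \<rho> x * x ^ n)" for n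
    using tail_ratio_bounded_imp_moments[OF density_pos _ density_mean tail_bounded] density_prob
    by (auto simp: has_bochner_integral_iff)
  have mean: "(LBINT x. \<rho> x * x) = 0" and var: "(LBINT x. \<rho> x * x\<^sup>2) = 1"
    using density_mean density_var by (auto simp: has_bochner_integral_iff mult.commute)
  have N\<eta>: "real N * \<eta> N = real N powr \<theta>" if "N \<ge> 1" for N
    using that powr_add[of "real N" 1 "-1 + \<theta>"] by (simp add: eta)
  have sqrtN\<eta>: "sqrt (real N * \<eta> N) = real N powr (\<theta> / 2)" if "N \<ge> 1" for N
    using that by (simp add: N\<eta> powr_half_sqrt[symmetric] powr_powr)
  have sym: "H N \<omega> \<in> carrier_mat N N \<and> transpose_mat (H N \<omega>) = H N \<omega>" if "N \<ge> 1" "\<omega> \<in> space (M N)" for N \<omega>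
    using wigner[OF that(1)] that(2) by (auto simp: wigner_matrix_def)
  have meas: "(\<lambda>\<omega>. SUP z\<in>spectral_domain {W1..W2} (\<eta> N). ennreal (cmod (ntr (resolvent (H N \<omega>) z) - msc z)))
      \<in> borel_measurable (M N)" if N: "N \<ge> 1" for N
  proof (rule borel_measurable_SUP_resolvent[OF sym[OF N]])
    interpret prob_space "M N" using prob N by simp
    fix i j assume "i \<le> j" "j < N"
    then show "(\<lambda>\<omega>. H N \<omega> $$ (i, j)) \<in> borel_measurable (M N)"
      using wigner[OF N] unfolding wigner_matrix_def indep_vars_def by auto
  next
    have "1 \<le> real N powr \<theta>" using N theta by (simp add: ge_one_powr_ge_zero)
    then show "1 / real N \<le> \<eta> N" using N\<eta>[OF N] N by (simp add: field_simps)
  qed (use N in auto)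
  have tail: "\<exists>N0. \<forall>N\<ge>max 1 N0. emeasure (M N) {\<omega> \<in> space (M N).
        (SUP z\<in>spectral_domain {W1..W2} (\<eta> N). ennreal (cmod (ntr (resolvent (H N \<omega>) z) - msc z)))
          > ennreal (real N powr \<epsilon>) * ennreal (1 / sqrt (real N * \<eta> N))} \<le> ennreal (real N powr (- p))"
    if \<epsilon>: "\<epsilon> > 0" and p: "p > 0" for \<epsilon> p
  proof -
    \<comment> \<open>The budget of exponents, with \<open>T = N^a\<close>: the final estimate
      spends \<open>T^2 \<le> N^\<epsilon>\<close>, and smallness of \<open>B\<close> spends
      \<open>a - \<theta> / 2 \<le> - a\<close>.\<close>
    define a where "a = min \<epsilon> \<theta> / 4"
    have a: "a > 0" "4 * a \<le> \<epsilon>" "4 * a \<le> \<theta>" using \<epsilon> theta by (auto simp: a_def)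
    \<comment> \<open>\<open>T ^ (2 * q)\<close> has to beat N^7 from the union, N^p from the claim,
      and one more N that absorbs the constant \<open>30 * C\<close>.\<close>
    define q where "q = nat \<lceil>(p + 8) / (2 * a)\<rceil>"
    have q: "2 * a * real q \<ge> p + 8"
    proof -
      have "(p + 8) / (2 * a) \<le> real q" unfolding q_def by (rule real_nat_ceiling_ge)
      then show ?thesis using a by (simp add: field_simps)
    qed
    have q1: "q \<ge> 1"
    proof (rule ccontr)
      assume "\<not> q \<ge> 1"
      then have "q = 0" by simp
      then show False using q p by simp
    qed
    \<comment> \<open>Since \<open>K \<ge> 1\<close> is below both of its powers in question, one
      \<open>K\<close> serves both moment bounds.\<close>
    define K where "K = 1 + \<bar>LBINT x. \<rho> x * x ^ (2 * q)\<bar> + \<bar>LBINT x. \<rho> x * x ^ (2 * (2 * q))\<bar>"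
    have K: "K \<ge> 1" by (simp add: K_def)
    have KK: "K \<le> K ^ q" "K \<le> K ^ (2 * q)" using K q1 by (auto intro!: self_le_power)
    have K1: "(LBINT x. \<rho> x * x ^ (2 * q)) \<le> K ^ q" using KK unfolding K_def by linarith
    have K2: "(LBINT x. \<rho> x * x ^ (2 * (2 * q))) \<le> K ^ (2 * q)" using KK unfolding K_def by linarith
    define C where "C = quad_const q K ^ q"
    have C: "C \<ge> 0" by (simp add: C_def quad_const_nonneg)
    \<comment> \<open>\<open>24 / c^2 + 4\<close> is for the final estimate, \<open>96 / c^3\<close>
      for \<open>B \<le> c / 4\<close>; both are met once \<open>T \<ge> Y\<close>.\<close>
    define Y where "Y = 24 / c\<^sup>2 + 4 + 96 / c ^ 3"
    have Y: "Y > 0" using c by (simp add: Y_def add_pos_pos)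
    \<comment> \<open>The summands ensure, in turn, \<open>Y \<le> T\<close>,
      \<open>2 / N \<le> c / 4\<close> and \<open>30 * C \<le> N\<close>.\<close>
    define N0 where "N0 = nat \<lceil>Y powr (1 / a) + 8 / c + 30 * C\<rceil>"
    show ?thesis
    proof (intro exI[of _ N0] allI impI)
      fix N assume "N \<ge> max 1 N0"
      then have N: "N \<ge> 1" and "real N \<ge> real N0" by auto
      then have "real N \<ge> Y powr (1 / a) + 8 / c + 30 * C"
        unfolding N0_def using real_nat_ceiling_ge order_trans by blast
      moreover have "Y powr (1 / a) \<ge> 0" "8 / c \<ge> 0" using c by auto
      ultimately have NY: "real N \<ge> Y powr (1 / a)" and Nc: "real N \<ge> 8 / c" and NC: "real N \<ge> 30 * C"
        using C by linarith+
      have N1: "real N \<ge> 1" using N by simp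
      define T where "T = real N powr a"
      have "(Y powr (1 / a)) powr a \<le> real N powr a" using NY a by (intro powr_mono2) auto
      then have TY: "Y \<le> T" using a Y by (simp add: powr_powr T_def)
      have T1: "T \<ge> 1" using N1 a by (simp add: T_def ge_one_powr_ge_zero)
      define B where "B = 24 * T / (sqrt (real N * \<eta> N) * c\<^sup>2)"
      have B: "B = 24 / c\<^sup>2 * real N powr (a - \<theta> / 2)"
        using N1 by (simp add: B_def T_def sqrtN\<eta>[OF N] powr_diff)
      have "real N powr (a - \<theta> / 2) \<le> real N powr (- a)" using a N1 by (intro powr_mono) auto
      also have "\<dots> = 1 / T" by (simp add: T_def powr_minus_divide)
      also have "\<dots> \<le> c ^ 3 / 96"
      proof -
        have "96 / c ^ 3 \<le> T" using TY c unfolding Y_def by (smt (verit) divide_nonneg_nonneg zero_le_power2)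
        then show ?thesis using c T1 by (simp add: field_simps)
      qed
      finally have "B \<le> 24 / c\<^sup>2 * (c ^ 3 / 96)" unfolding B by (intro mult_left_mono) auto
      also have "\<dots> = c / 4" using c by (simp add: power2_eq_square power3_eq_cube)
      finally have "B \<le> c / 4" .
      moreover have "2 / real N \<le> c / 4" using Nc c N1 by (simp add: field_simps)
      ultimately have Bc: "B + 2 / real N \<le> c / 2" by linarith
      have fam: "std_family (M N) (upper_indices N) (\<lambda>(i, j) \<omega>. sqrt (real N) * H N \<omega> $$ (i, j)) q K"
        by (rule wigner_std_family[OF prob[OF N] wigner[OF N] pos mom mean var K1 K2])
      have \<eta>N: "0 < \<eta> N" "1 \<le> real N * \<eta> N"
        using N1 theta unfolding N\<eta>[OF N] by (simp_all add: eta ge_one_powr_ge_zero)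
      have Wle: "W2 - W1 \<le> 4" using W' kappa by linarith
      obtain E where E: "E \<in> sets (M N)" "measure (M N) E \<le> 30 * real N ^ 7 * (quad_const q K ^ q / T ^ (2 * q))"
        "\<And>\<omega> z. \<omega> \<in> space (M N) - E \<Longrightarrow> z \<in> spectral_domain {W1..W2} (\<eta> N) \<Longrightarrow>
           cmod (ntr (resolvent (H N \<omega>) z) - msc z) \<le> B + 4 / real N"
        using local_law_prob[OF sym[OF N] fam q1 K _ T1 \<eta>N c c_bulk Wle B_def Bc] N by auto
      have prob_E: "measure (M N) E \<le> real N powr (- p)"
      proof -
        have "T ^ (2 * q) = real N powr (2 * a * real q)"
          using N1 by (simp add: T_def powr_realpow[symmetric] powr_powr mult_ac)
        also have "\<dots> \<ge> real N powr (p + 8)" using N1 q by (intro powr_mono) auto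
        finally have Tq: "real N powr (p + 8) \<le> T ^ (2 * q)" .
        have "measure (M N) E \<le> 30 * real N ^ 7 * (C / T ^ (2 * q))" using E(2) by (simp add: C_def)
        also have "\<dots> \<le> 30 * real N ^ 7 * (C / real N powr (p + 8))"
          using Tq C N1 T1 by (intro mult_left_mono divide_left_mono mult_pos_pos zero_less_power) auto
        also have "\<dots> = 30 * C * (real N ^ 7 / real N powr (p + 8))" by simp
        also have "real N ^ 7 / real N powr (p + 8) = real N powr (- p) / real N"
        proof -
          have "real N ^ 7 / real N powr (p + 8) = real N powr (7 - (p + 8))"
            using N1 powr_realpow[of "real N" 7] by (simp only: powr_diff) simp
          also have "7 - (p + 8) = - p - 1" by simp
          also have "real N powr (- p - 1) = real N powr (- p) / real N" using N1 by (subst powr_diff) simp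
          finally show ?thesis .
        qed
        also have "30 * C * (real N powr (- p) / real N) = (30 * C / real N) * real N powr (- p)" by simp
        also have "\<dots> \<le> 1 * real N powr (- p)" using NC N1 by (intro mult_right_mono) auto
        finally show ?thesis by simp
      qed
      have bound: "B + 4 / real N \<le> real N powr \<epsilon> * (1 / sqrt (real N * \<eta> N))"
      proof -
        have "4 / real N = 4 * real N powr (- 1)" using N1 by (simp add: powr_minus_divide)
        also have "\<dots> \<le> 4 * real N powr (- (\<theta> / 2))" using N1 theta by (intro mult_left_mono powr_mono) auto
        finally have "B + 4 / real N \<le> 24 / c\<^sup>2 * real N powr (a - \<theta> / 2) + 4 * real N powr (- (\<theta> / 2))"
          unfolding B by simp
        also have "\<dots> = (24 / c\<^sup>2 * T + 4) * real N powr (- (\<theta> / 2))"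
          by (simp add: T_def powr_diff powr_minus_divide add_divide_distrib)
        also have "\<dots> \<le> real N powr \<epsilon> * real N powr (- (\<theta> / 2))"
        proof (rule mult_right_mono)
          have "24 / c\<^sup>2 * T + 4 \<le> (24 / c\<^sup>2 + 4) * T" using T1 by (simp add: distrib_right)
          also have "\<dots> \<le> T * T"
            using TY T1 c unfolding Y_def by (intro mult_right_mono) (smt (verit) divide_nonneg_nonneg zero_le_power, simp)
          also have "\<dots> = real N powr (2 * a)" by (simp add: T_def powr_add[symmetric])
          also have "\<dots> \<le> real N powr \<epsilon>" using a N1 by (intro powr_mono) auto
          finally show "24 / c\<^sup>2 * T + 4 \<le> real N powr \<epsilon>" .
        qed simp
        also have "real N powr (- (\<theta> / 2)) = 1 / sqrt (real N * \<eta> N)"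
          by (simp add: sqrtN\<eta>[OF N] powr_minus_divide)
        finally show ?thesis .
      qed
      have "{\<omega> \<in> space (M N).
        (SUP z\<in>spectral_domain {W1..W2} (\<eta> N). ennreal (cmod (ntr (resolvent (H N \<omega>) z) - msc z)))
          > ennreal (real N powr \<epsilon>) * ennreal (1 / sqrt (real N * \<eta> N))} \<subseteq> E"
      proof (rule subsetI, rule ccontr)
        fix \<omega>
        assume \<omega>: "\<omega> \<in> {\<omega> \<in> space (M N).
          (SUP z\<in>spectral_domain {W1..W2} (\<eta> N). ennreal (cmod (ntr (resolvent (H N \<omega>) z) - msc z)))
            > ennreal (real N powr \<epsilon>) * ennreal (1 / sqrt (real N * \<eta> N))}" and "\<omega> \<notin> E"
        then have "\<omega> \<in> space (M N) - E" by simp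
        then have "(SUP z\<in>spectral_domain {W1..W2} (\<eta> N). ennreal (cmod (ntr (resolvent (H N \<omega>) z) - msc z)))
            \<le> ennreal (real N powr \<epsilon> * (1 / sqrt (real N * \<eta> N)))"
          using bound by (intro SUP_least ennreal_leI) (meson E(3) order_trans)
        moreover have "ennreal (real N powr \<epsilon> * (1 / sqrt (real N * \<eta> N)))
            = ennreal (real N powr \<epsilon>) * ennreal (1 / sqrt (real N * \<eta> N))"
          using \<eta>N by (intro ennreal_mult) auto
        moreover have "ennreal (real N powr \<epsilon>) * ennreal (1 / sqrt (real N * \<eta> N))
            < (SUP z\<in>spectral_domain {W1..W2} (\<eta> N). ennreal (cmod (ntr (resolvent (H N \<omega>) z) - msc z)))"
          using \<omega> by simp
        ultimately show False by (metis leD)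
      qed
      then have "emeasure (M N) {\<omega> \<in> space (M N).
        (SUP z\<in>spectral_domain {W1..W2} (\<eta> N). ennreal (cmod (ntr (resolvent (H N \<omega>) z) - msc z)))
          > ennreal (real N powr \<epsilon>) * ennreal (1 / sqrt (real N * \<eta> N))} \<le> emeasure (M N) E"
        using E(1) by (rule emeasure_mono)
      also have "\<dots> = ennreal (measure (M N) E)"
        using prob_space.axioms(1)[OF prob[OF N]] by (rule finite_measure.emeasure_eq_measure)
      also have "\<dots> \<le> ennreal (real N powr (- p))" using prob_E by (rule ennreal_leI)
      finally show "emeasure (M N) {\<omega> \<in> space (M N).
        (SUP z\<in>spectral_domain {W1..W2} (\<eta> N). ennreal (cmod (ntr (resolvent (H N \<omega>) z) - msc z)))
          > ennreal (real N powr \<epsilon>) * ennreal (1 / sqrt (real N * \<eta> N))} \<le> ennreal (real N powr (- p))" .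
    qed
  qed
  show ?thesis
    unfolding stoch_dom_single_def stoch_dom_def using meas tail by simp
qed

end
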